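(* Let $(M,g)$, $1\leqslant p\leqslant n$ and $F$ be as in the context. Let $\tilde f=\tilde f(x,z,q)>0$ be a smooth function and let $A=A(x,z,q)$ be a smooth family of symmetric $(0,2)$ tensors, for $x\in\bar M$, $z\in\mathbb{R}$, $q\in T_x^*\bar M$; write $A^{\xi\eta}(x,z,q)=A(x,z,q)(\xi,\eta)$. Assume that there are constants $0<\gamma_0<1$, $0<\gamma<2$, $C_0>0$ and continuous functions $\bar\omega_1,\bar\omega_2\geqslant 0$ of $(x,z)$ such that (i) for all $(x,z,q)$, $\ |\nabla_x\tilde f|+|\tilde f_z|\,|q|+|\tilde f_q|\,|q|^2\leqslant C_0|q|^{2+\gamma_0}$; (ii) for $|q|$ sufficiently large and all $\xi,\eta\in T_x\bar M$, $\ |q|^{-1}|\nabla_xA^{\xi\eta}(x,z,q)|+|A^{\xi\eta}_z(x,z,q)|\leqslant\bar\omega_1(x,z)|\xi||\eta|(1+|q|^\gamma)$; (iii) for $|q|$ sufficiently large and all nonzero $\xi,\eta\in T_x\bar M$, $$|\tilde f(x,z,q)|+|q\cdot D_q\tilde f(x,z,q)|+\frac{|A^{\xi\eta}(x,z,q)|}{|\xi||\eta|}+\frac{|q\cdot D_qA^{\xi\eta}(x,z,q)|}{|\xi||\eta|}\leqslant\bar\omega_2(x,z)(1+|q|^\gamma).$$ Let $u\in C^3(M)$ be an admissible solution of $$F\big(\lambda(\nabla^2u+A(x,u,\nabla u))\big)=\tilde f(x,u,\nabla u)\quad\text{in }M,$$ i.e. $\lambda(\nabla^2u+A(x,u,\nabla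 u))\in\mathcal{P}_p$ at every point of $M$. Then there is a positive constant $C$, depending only on $|u|_{C^0}$ and the known data ($(M,g)$, $n$, $p$, $A$, $\tilde f$, and the constants and functions in (i)–(iii)), such that for every geodesic ball $B_r(x_0)\subset M$ with center $x_0\in M$ and radius $r<1$, $$|\nabla u(x_0)|\leqslant\frac Cr .$$
   Context: $\bar M=M\cup\partial M$ is a compact Riemannian manifold of dimension $n\geqslant 2$ with metric $g$, smooth boundary $\partial M$ and interior $M$; $\nabla$ is the Levi-Civita connection. For a symmetric $(0,2)$ tensor $T$, $\lambda(T)=(\lambda_1,\dots,\lambda_n)$ denotes its eigenvalues with respect to $g$. For an integer $1\leqslant p\leqslant n$ let $$\mathcal{P}_p=\{\lambda\in\mathbb{R}^n:\ \lambda_{i_1}+\cdots+\lambda_{i_p}>0\ \ \forall\,1\leqslant i_1<\cdots<i_p\leqslant n\},$$ $$F(\lambda)=\Big(\prod_{1\leqslant i_1<\cdots<i_p\leqslant n}(\lambda_{i_1}+\cdots+\lambda_{i_p})\Big)^{1/C_n^p}\ \ (\lambda\in\mathcal{P}_p),\qquad C_n^p=\frac{n!}{p!(n-p)!}.$$ The gradient variable is denoted $q$; using $g$, $\nabla u(x)$ is identified with an element of $T_x^*\bar M$. $\nabla_x$ denotes the partial covariant derivative in $x$ with $z,q$ held fixed; the subscripts $z,q$ and $D_q$ denote partial derivatives in $z$ and $q$; $q\cdot D_q=\sum_lq_l\,\partial_{q_l}$; $|\cdot|$ are norms induced by $g$. $|u|_{C^0}=\sup_M|u|$. *)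

theory Defs
  imports "HOL-Analysis.Analysis"
begin

fun Ck_open :: "nat \<Rightarrow> 'a::real_normed_vector set \<Rightarrow> ('a \<Rightarrow> 'b::real_normed_vector) \<Rightarrow> bool" where
  "Ck_open 0 S f \<longleftrightarrow> continuous_on S f"
| "Ck_open (Suc k) S f \<longleftrightarrow>
     (\<forall>x\<in>S. f differentiable (at x)) \<and>
     (\<forall>v. Ck_open k S (\<lambda>x. frechet_derivative f (at x) v))"

text \<open>On a relatively open subset of a half-space, being of class \<open>C\<^sup>k\<close> up to the boundary
  means having local \<open>C\<^sup>k\<close> extensions to open sets of the ambient space.\<close>

definition Ck_on :: "nat \<Rightarrow> 'a::real_normed_vector set \<Rightarrow> ('a \<Rightarrow> 'b::real_normed_vector) \<Rightarrow> bool" where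
  "Ck_on k S f \<longleftrightarrow>
     (\<forall>x\<in>S. \<exists>U h. open U \<and> x \<in> U \<and> Ck_open k U h \<and> (\<forall>y\<in>U \<inter> S. h y = f y))"

definition smooth_on :: "'a::real_normed_vector set \<Rightarrow> ('a \<Rightarrow> 'b::real_normed_vector) \<Rightarrow> bool" where
  "smooth_on S f \<longleftrightarrow>
     (\<forall>x\<in>S. \<exists>U h. open U \<and> x \<in> U \<and> (\<forall>k. Ck_open k U h) \<and> (\<forall>y\<in>U \<inter> S. h y = f y))"

text \<open>Vector of partial derivatives, taken within \<open>S\<close>; for the half-space-like sets used below
  the derivative within \<open>S\<close> is unique also at boundary points.\<close>

definition pdv :: "(real ^ 'n) set \<Rightarrow> (real ^ 'n \<Rightarrow> real) \<Rightarrow> real ^ 'n \<Rightarrow> real ^ 'n" where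
  "pdv S f y = (\<chi> i. frechet_derivative f (at y within S) (axis i 1))"

text \<open>The underlying set of the manifold is the whole point type \<open>'a\<close>. A chart is a pair of its
  domain and its coordinate map; which coordinate cuts out the half-space is immaterial.\<close>

type_synonym ('a, 'n) chart = "'a set \<times> ('a \<Rightarrow> (real, 'n) vec)"

definition half_space :: "(real ^ 'n) set" where
  "half_space = {y. 0 \<le> y $ (SOME i. True)}"

definition cimg :: "('a, 'n::finite) chart \<Rightarrow> (real ^ 'n) set" where
  "cimg c = snd c ` fst c"

definition cinv :: "('a, 'n::finite) chart \<Rightarrow> real ^ 'n \<Rightarrow> 'a" where
  "cinv c = inv_into (fst c) (snd c)"

definition smooth_atlas :: "('a::t2_space, 'n::finite) chart set \<Rightarrow> bool" where
  "smooth_atlas \<A> \<longleftrightarrow>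
     (\<Union>c\<in>\<A>. fst c) = UNIV \<and>
     (\<forall>c\<in>\<A>. open (fst c) \<and>
             openin (top_of_set half_space) (cimg c) \<and>
             homeomorphism (fst c) (cimg c) (snd c) (cinv c)) \<and>
     (\<forall>c\<in>\<A>. \<forall>d\<in>\<A>. smooth_on (snd c ` (fst c \<inter> fst d)) (snd d \<circ> cinv c))"

definition interior_pts :: "('a, 'n::finite) chart set \<Rightarrow> 'a set" where
  "interior_pts \<A> = {x. \<exists>c\<in>\<A>. x \<in> fst c \<and> 0 < snd c x $ (SOME i. True)}"

definition transition_jacobian ::
    "('a, 'n::finite) chart \<Rightarrow> ('a, 'n) chart \<Rightarrow> 'a \<Rightarrow> real ^ 'n ^ 'n" where
  "transition_jacobian c d x =
     jacobian (snd d \<circ> cinv c) (at (snd c x) within snd c ` (fst c \<inter> fst d))"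

text \<open>Tensorial objects are families of components, one for each chart, that transform according to
  the usual laws. Vectors and covectors at \<open>x\<close> are represented by their components in a chart \<open>c\<close>
  with \<open>x \<in> fst c\<close>. If \<open>J\<close> is the Jacobian of the change of coordinates from \<open>c\<close> to \<open>d\<close>, covector
  components satisfy \<open>q\<^sub>c = J\<^sup>T q\<^sub>d\<close>, and the matrix of a (0,2) tensor satisfies
  \<open>T\<^sub>c = J\<^sup>T T\<^sub>d J\<close>.\<close>

type_synonym ('a, 'n) metric = "('a, 'n) chart \<Rightarrow> (real, 'n) vec \<Rightarrow> ((real, 'n) vec, 'n) vec"

definition riemannian_metric ::
    "('a::t2_space, 'n::finite) chart set \<Rightarrow> ('a, 'n) metric \<Rightarrow> bool" where
  "riemannian_metric \<A> g \<longleftrightarrow>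
     (\<forall>c\<in>\<A>. smooth_on (cimg c) (g c) \<and>
        (\<forall>y\<in>cimg c. transpose (g c y) = g c y \<and> (\<forall>v. v \<noteq> 0 \<longrightarrow> 0 < v \<bullet> (g c y *v v)))) \<and>
     (\<forall>c\<in>\<A>. \<forall>d\<in>\<A>. \<forall>x\<in>fst c \<inter> fst d.
        let J = transition_jacobian c d x
        in g c (snd c x) = transpose J ** g d (snd d x) ** J)"

text \<open>Functions \<open>f(x,z,q)\<close> and families \<open>A(x,z,q)\<close> of symmetric (0,2) tensors, for a point \<open>x\<close>, a
  real \<open>z\<close> and a covector \<open>q\<close> at \<open>x\<close>: the arguments of \<open>f c\<close> and \<open>A c\<close> are the coordinates of \<open>x\<close>,
  the number \<open>z\<close>, and the components of \<open>q\<close>.\<close>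

type_synonym ('a, 'n) bundle_fun =
  "('a, 'n) chart \<Rightarrow> (real, 'n) vec \<Rightarrow> real \<Rightarrow> (real, 'n) vec \<Rightarrow> real"

type_synonym ('a, 'n) tensor_family =
  "('a, 'n) chart \<Rightarrow> (real, 'n) vec \<Rightarrow> real \<Rightarrow> (real, 'n) vec \<Rightarrow> ((real, 'n) vec, 'n) vec"

definition smooth_bundle_fun ::
    "('a::t2_space, 'n::finite) chart set \<Rightarrow> ('a, 'n) bundle_fun \<Rightarrow> bool" where
  "smooth_bundle_fun \<A> f \<longleftrightarrow>
     (\<forall>c\<in>\<A>. smooth_on (cimg c \<times> UNIV \<times> UNIV) (\<lambda>(y, z, q). f c y z q)) \<and>
     (\<forall>c\<in>\<A>. \<forall>d\<in>\<A>. \<forall>x\<in>fst c \<inter> fst d. \<forall>z q.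
        f c (snd c x) z (transpose (transition_jacobian c d x) *v q) = f d (snd d x) z q)"

definition smooth_symmetric_tensor_family ::
    "('a::t2_space, 'n::finite) chart set \<Rightarrow> ('a, 'n) tensor_family \<Rightarrow> bool" where
  "smooth_symmetric_tensor_family \<A> A \<longleftrightarrow>
     (\<forall>c\<in>\<A>. smooth_on (cimg c \<times> UNIV \<times> UNIV) (\<lambda>(y, z, q). A c y z q) \<and>
        (\<forall>y\<in>cimg c. \<forall>z q. transpose (A c y z q) = A c y z q)) \<and>
     (\<forall>c\<in>\<A>. \<forall>d\<in>\<A>. \<forall>x\<in>fst c \<inter> fst d. \<forall>z q.
        let J = transition_jacobian c d x
        in A c (snd c x) z (transpose J *v q) = transpose J ** A d (snd d x) z q ** J)"

definition vnorm :: "real ^ 'n ^ 'n \<Rightarrow> real ^ 'n \<Rightarrow> real" where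
  "vnorm G v = sqrt (v \<bullet> (G *v v))"

definition conorm :: "real ^ 'n ^ 'n \<Rightarrow> real ^ 'n \<Rightarrow> real" where
  "conorm G q = sqrt (q \<bullet> (matrix_inv G *v q))"

definition christoffel ::
    "('a, 'n::finite) metric \<Rightarrow> ('a, 'n) chart \<Rightarrow> real ^ 'n \<Rightarrow> 'n \<Rightarrow> 'n \<Rightarrow> 'n \<Rightarrow> real" where
  \<comment> \<open>\<open>christoffel g c y k i j\<close> has upper index \<open>k\<close> and lower indices \<open>i\<close>, \<open>j\<close>\<close>
  "christoffel g c y k i j =
     (\<Sum>l\<in>UNIV. matrix_inv (g c y) $ k $ l *
        (pdv (cimg c) (\<lambda>w. g c w $ j $ l) y $ i
         + pdv (cimg c) (\<lambda>w. g c w $ i $ l) y $ j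
         - pdv (cimg c) (\<lambda>w. g c w $ i $ j) y $ l)) / 2"

definition grad :: "('a, 'n::finite) chart \<Rightarrow> ('a \<Rightarrow> real) \<Rightarrow> real ^ 'n \<Rightarrow> real ^ 'n" where
  \<comment> \<open>components of the covector \<open>du\<close>\<close>
  "grad c u y = pdv (cimg c) (u \<circ> cinv c) y"

definition hess :: "('a, 'n::finite) metric \<Rightarrow> ('a, 'n) chart \<Rightarrow> ('a \<Rightarrow> real) \<Rightarrow> real ^ 'n \<Rightarrow> real ^ 'n ^ 'n" where
  "hess g c u y =
     (\<chi> i j. pdv (cimg c) (\<lambda>w. grad c u w $ j) y $ i
             - (\<Sum>k\<in>UNIV. christoffel g c y k i j * grad c u y $ k))"

text \<open>The partial covariant derivative in \<open>x\<close> differentiates along curves of points with \<open>z\<close>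
  constant and \<open>q\<close> parallel, that is, along \<open>\<partial>\<^sub>i + \<Sum>\<^sub>k\<^sub>l \<Gamma>\<^sup>k\<^sub>i\<^sub>l q\<^sub>k \<partial>/\<partial>q\<^sub>l\<close>.\<close>

definition horizontal_deriv :: "('a, 'n::finite) metric \<Rightarrow> ('a, 'n) chart \<Rightarrow>
    (real ^ 'n \<Rightarrow> real \<Rightarrow> real ^ 'n \<Rightarrow> real) \<Rightarrow> real ^ 'n \<Rightarrow> real \<Rightarrow> real ^ 'n \<Rightarrow> real ^ 'n" where
  "horizontal_deriv g c \<phi> y z q =
     (\<chi> i. pdv (cimg c) (\<lambda>w. \<phi> w z q) y $ i
           + (\<Sum>k\<in>UNIV. \<Sum>l\<in>UNIV. christoffel g c y k i l * q $ k * pdv UNIV (\<phi> y z) q $ l))"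

definition cov_x_fun :: "('a, 'n::finite) metric \<Rightarrow> ('a, 'n) bundle_fun \<Rightarrow> ('a, 'n) chart \<Rightarrow>
    real ^ 'n \<Rightarrow> real \<Rightarrow> real ^ 'n \<Rightarrow> real ^ 'n" where
  "cov_x_fun g f c y z q = horizontal_deriv g c (f c) y z q"

text \<open>The covector \<open>(\<nabla>\<^sub>x A)(\<xi>, \<eta>)\<close>, where \<open>\<nabla>\<^sub>x A\<close> is a tensor in all its indices.\<close>

definition cov_x_tensor :: "('a, 'n::finite) metric \<Rightarrow> ('a, 'n) tensor_family \<Rightarrow> ('a, 'n) chart \<Rightarrow>
    real ^ 'n \<Rightarrow> real \<Rightarrow> real ^ 'n \<Rightarrow> real ^ 'n \<Rightarrow> real ^ 'n \<Rightarrow> real ^ 'n" where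
  "cov_x_tensor g A c y z q \<xi> \<eta> =
     (\<chi> i. \<Sum>j\<in>UNIV. \<Sum>k\<in>UNIV. \<xi> $ j * \<eta> $ k *
        (horizontal_deriv g c (\<lambda>w z q. A c w z q $ j $ k) y z q $ i
         - (\<Sum>m\<in>UNIV. christoffel g c y m i j * A c y z q $ m $ k)
         - (\<Sum>m\<in>UNIV. christoffel g c y m i k * A c y z q $ j $ m)))"

text \<open>\<open>joined_by \<A> g x x' L\<close>: there is a piecewise \<open>C\<^sup>1\<close> curve of length \<open>L\<close> from \<open>x\<close> to \<open>x'\<close>. Such
  curves are concatenations of finitely many \<open>C\<^sup>1\<close> pieces, each contained in the domain of a chart.\<close>

inductive joined_by :: "('a, 'n::finite) chart set \<Rightarrow> ('a, 'n) metric \<Rightarrow> 'a \<Rightarrow> 'a \<Rightarrow> real \<Rightarrow> bool"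
  for \<A> g x where
  const: "joined_by \<A> g x x 0"
| piece: "joined_by \<A> g x x' L \<Longrightarrow> c \<in> \<A> \<Longrightarrow> a \<le> b \<Longrightarrow> \<sigma> C1_differentiable_on {a..b} \<Longrightarrow>
     \<sigma> ` {a..b} \<subseteq> cimg c \<Longrightarrow> cinv c (\<sigma> a) = x' \<Longrightarrow>
     joined_by \<A> g x (cinv c (\<sigma> b))
       (L + integral {a..b} (\<lambda>t. vnorm (g c (\<sigma> t)) (vector_derivative \<sigma> (at t))))"

definition geodesic_dist :: "('a, 'n::finite) chart set \<Rightarrow> ('a, 'n) metric \<Rightarrow> 'a \<Rightarrow> 'a \<Rightarrow> ereal" where
  \<comment> \<open>infinite between different components\<close>
  "geodesic_dist \<A> g x x' = (INF L\<in>{L. joined_by \<A> g x x' L}. ereal L)"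

definition geodesic_ball :: "('a, 'n::finite) chart set \<Rightarrow> ('a, 'n) metric \<Rightarrow> 'a \<Rightarrow> real \<Rightarrow> 'a set" where
  "geodesic_ball \<A> g x r = {x'. geodesic_dist \<A> g x x' < ereal r}"

definition pcone :: "nat \<Rightarrow> (real ^ 'n) set" where
  "pcone p = {l. \<forall>I :: 'n set. card I = p \<longrightarrow> 0 < (\<Sum>i\<in>I. l $ i)}"

definition F_op :: "nat \<Rightarrow> real ^ 'n \<Rightarrow> real" where
  "F_op p l = (\<Prod>I\<in>{I :: 'n set. card I = p}. \<Sum>i\<in>I. l $ i) powr (1 / real (CARD('n) choose p))"

text \<open>The eigenvalues of \<open>T\<close> with respect to \<open>G\<close> are those of \<open>G\<^sup>-\<^sup>1 T\<close>, listed with multiplicity. They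
  are real if \<open>T\<close> is symmetric and \<open>G\<close> symmetric positive definite; the order is immaterial, since
  \<open>pcone\<close> and \<open>F_op\<close> are symmetric.\<close>

definition eigenvalues :: "real ^ 'n ^ 'n \<Rightarrow> real ^ 'n ^ 'n \<Rightarrow> real ^ 'n" where
  "eigenvalues G T =
     (SOME l. \<forall>t. det (t *\<^sub>R mat 1 - matrix_inv G ** T) = (\<Prod>i\<in>UNIV. t - l $ i))"

definition C3_interior :: "('a::t2_space, 'n::finite) chart set \<Rightarrow> ('a \<Rightarrow> real) \<Rightarrow> bool" where
  "C3_interior \<A> u \<longleftrightarrow>
     (\<forall>c\<in>\<A>. Ck_on 3 (snd c ` (fst c \<inter> interior_pts \<A>)) (u \<circ> cinv c))"

definition admissible_solution :: "('a::t2_space, 'n::finite) chart set \<Rightarrow> ('a, 'n) metric \<Rightarrow> nat \<Rightarrow>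
    ('a, 'n) tensor_family \<Rightarrow> ('a, 'n) bundle_fun \<Rightarrow> ('a \<Rightarrow> real) \<Rightarrow> bool" where
  "admissible_solution \<A> g p A f u \<longleftrightarrow>
     (\<forall>c\<in>\<A>. \<forall>x\<in>fst c \<inter> interior_pts \<A>.
        let y = snd c x; \<mu> = eigenvalues (g c y) (hess g c u y + A c y (u x) (grad c u y))
        in \<mu> \<in> pcone p \<and> F_op p \<mu> = f c y (u x) (grad c u y))"

end

theory Submission
  imports Defs
begin

text \<open>The gradient bound comes from doubling variables, without differentiating the equation. In a
  coordinate ball of radius \<open>\<rho>\<close> comparable to \<open>r\<close>,
  maximise \<open>u x - u y - L |x - y| + a |x - y|\<^sup>2 - \<kappa> |x - y\<^sub>0|\<^sup>2\<close> with \<open>a = L\<^sup>2 / (12 K)\<close>,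
  \<open>\<kappa> = 32 K / \<rho>\<^sup>2\<close> and \<open>|u| \<le> K\<close>. If the maximum is not positive, then \<open>|\<nabla>u y\<^sub>0| \<le> L\<close>. Otherwise
  \<open>x \<noteq> y\<close>, the gradients at \<open>x\<close> and \<open>y\<close> have size comparable to \<open>L\<close>, and the second-order condition,
  tested with vectors related by the reflection in the direction of \<open>x - y\<close>, gives
  \<open>D \<ge> B + N e e\<^sup>T - E\<close> for the augmented Hessians \<open>B\<close> at \<open>x\<close> and \<open>D\<close> at \<open>y\<close> in suitable orthonormal
  frames, together with \<open>e\<^sup>T B e \<le> - N\<close>, where \<open>N\<close> is of order \<open>L\<^sup>2\<close> and
  \<open>E = O(\<rho>\<^sup>-\<^sup>2 + L\<^sup>\<gamma>)\<close>. Since the sums of \<open>p\<close> eigenvalues of \<open>B\<close> are positive, a very negative direction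
  \<open>e\<close> forces the trace of \<open>B\<close> on every \<open>p\<close>-plane nearly orthogonal to \<open>e\<close> to be large. Hence all sums of
  \<open>p\<close> eigenvalues of \<open>D\<close> are at least \<open>N / (4 p)\<close>, and so is \<open>F\<close> at \<open>y\<close>, which contradicts
  \<open>F = f = O(L\<^sup>\<gamma>)\<close> as \<open>\<gamma> < 2\<close>, once \<open>L\<close> is a large multiple of \<open>1 / \<rho>\<close>.\<close>

section \<open>Traces on projections\<close>

text \<open>The constants come from the profile \<open>L t - a t\<^sup>2\<close> on
  \<open>0 \<le> t \<le> b\<close> with \<open>b = 3 K / L\<close>. As \<open>a b = L / 4\<close>,
  its slope stays between \<open>L / 2\<close> and \<open>L\<close>, while its value
  \<open>9 K / 4\<close> at \<open>b\<close> exceeds the oscillation \<open>2 K\<close>, so a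
  positive maximum is not attained at \<open>t = b\<close>. The penalty reaches \<open>2 K\<close>
  at distance \<open>\<rho> / 4\<close> from \<open>y\<^sub>0\<close>. The concavity
  \<open>- 2 a\<close> of the profile is the source of \<open>N\<close>. The obstacle is the factor
  \<open>L / t\<close> in the second-order condition, singular as \<open>x\<close> and
  \<open>y\<close> merge, together with the fact that the metrics at the two points differ, so that
  a reflection in coordinates does not preserve orthonormality. Orthonormal frames for the two
  metrics at distance \<open>O(t)\<close> from each other remove it: the mismatch enters squared,
  and \<open>L / t * t\<^sup>2 = L t \<le> 3 K\<close>. Admissibility is read off at
  \<open>x\<close>, the value of \<open>F\<close> at \<open>y\<close>. The Christoffel terms of the
  Hessian are linear in the gradient and join \<open>A\<close> in the error, whose growth exponent
  is then \<open>max \<gamma> 1\<close>, still below 2.\<close>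

definition orthonormal_family :: "('n::finite \<Rightarrow> real ^ 'n) \<Rightarrow> bool" where
  "orthonormal_family b \<longleftrightarrow> (\<forall>i j. b i \<bullet> b j = (if i = j then 1 else 0))"

text \<open>A \<open>p\<close>-plane is encoded by its orthogonal projection, the trace condition
  fixing the rank. Traces over planes then become sums over the standard \<open>Basis\<close>, with
  no basis of the plane to choose.\<close>

definition orth_proj :: "nat \<Rightarrow> (real ^ 'n \<Rightarrow> real ^ 'n) \<Rightarrow> bool" where
  "orth_proj p P \<longleftrightarrow> linear P \<and> (\<forall>x. P (P x) = P x) \<and> (\<forall>x y. P x \<bullet> y = x \<bullet> P y) \<and>
     (\<Sum>i\<in>Basis. P i \<bullet> i) = real p"

text \<open>For an orthogonal projection this is the trace of \<open>P B P\<close>, that is, of the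
  form of \<open>B\<close> restricted to the range of \<open>P\<close>.\<close>

definition trace_on :: "(real ^ 'n \<Rightarrow> real ^ 'n) \<Rightarrow> (real ^ 'n \<Rightarrow> real ^ 'n) \<Rightarrow> real" where
  "trace_on P B = (\<Sum>i\<in>Basis. P i \<bullet> B (P i))"

lemma orthonormal_family_expand:
  fixes b :: "'n::finite \<Rightarrow> real ^ 'n"
  assumes "orthonormal_family b"
  shows "x = (\<Sum>k\<in>UNIV. (b k \<bullet> x) *\<^sub>R b k)"
proof -
  let ?Q = "(\<chi> i j. b j $ i) :: real ^ 'n ^ 'n"
  have "transpose ?Q ** ?Q = mat 1"
    using assms
    by (simp add: orthonormal_family_def matrix_matrix_mult_def transpose_def mat_def vec_eq_iff inner_vec_def)
  then have "?Q ** transpose ?Q = mat 1"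
    by (simp add: matrix_left_right_inverse)
  then have "x = ?Q *v (transpose ?Q *v x)"
    by (metis matrix_vector_mul_assoc matrix_vector_mul_lid)
  also have "transpose ?Q *v x = (\<chi> k. b k \<bullet> x)"
    by (simp add: matrix_vector_mult_def transpose_def vec_eq_iff inner_vec_def)
  also have "?Q *v (\<chi> k. b k \<bullet> x) = (\<Sum>k\<in>UNIV. (b k \<bullet> x) *\<^sub>R b k)"
    by (simp add: matrix_vector_mult_def vec_eq_iff mult.commute)
  finally show ?thesis .
qed

lemma orthonormal_family_norm:
  assumes "orthonormal_family b"
  shows "(\<Sum>k\<in>UNIV. (b k \<bullet> x)\<^sup>2) = x \<bullet> x"
proof -
  have "x \<bullet> x = (\<Sum>k\<in>UNIV. (b k \<bullet> x) *\<^sub>R b k) \<bullet> x"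
    using orthonormal_family_expand[OF assms, of x] by simp
  then show ?thesis by (simp add: inner_sum_left power2_eq_square)
qed

lemma orth_proj_norm_le:
  assumes "orth_proj p P"
  shows "P x \<bullet> P x \<le> x \<bullet> x"
proof -
  have "P x \<bullet> P x = P x \<bullet> x" using assms by (metis orth_proj_def)
  moreover have "0 \<le> (x - P x) \<bullet> (x - P x)" by simp
  ultimately show ?thesis by (simp add: inner_diff inner_commute)
qed

lemma orth_proj_sum_norm:
  assumes "orth_proj p P"
  shows "(\<Sum>i\<in>Basis. P i \<bullet> P i) = real p"
proof -
  have "P i \<bullet> P i = P i \<bullet> i" for i using assms by (metis orth_proj_def)
  moreover have "(\<Sum>i\<in>Basis. P i \<bullet> i) = real p" using assms unfolding orth_proj_def by blast
  ultimately show ?thesis by simp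
qed

lemma orth_proj_sum_norm_family:
  assumes "orth_proj p P" "orthonormal_family b"
  shows "(\<Sum>k\<in>UNIV. P (b k) \<bullet> P (b k)) = real p"
proof -
  have "(\<Sum>k\<in>UNIV. P (b k) \<bullet> P (b k)) = (\<Sum>k\<in>UNIV. \<Sum>i\<in>Basis. (P (b k) \<bullet> i)\<^sup>2)"
    by (subst euclidean_inner) (simp add: power2_eq_square)
  also have "\<dots> = (\<Sum>i\<in>Basis. \<Sum>k\<in>UNIV. (b k \<bullet> P i)\<^sup>2)"
    using assms(1) by (subst sum.swap) (simp add: orth_proj_def)
  also have "\<dots> = (\<Sum>i\<in>Basis. P i \<bullet> P i)"
    by (simp add: orthonormal_family_norm[OF assms(2)])
  finally show ?thesis using orth_proj_sum_norm[OF assms(1)] by simp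
qed

lemma trace_on_eigenbasis:
  assumes P: "orth_proj p P" and b: "orthonormal_family b" and "linear B"
    and ev: "\<And>k. B (b k) = \<mu> k *\<^sub>R b k"
  shows "trace_on P B = (\<Sum>k\<in>UNIV. \<mu> k * (P (b k) \<bullet> P (b k)))"
proof -
  have 1: "x \<bullet> B x = (\<Sum>k\<in>UNIV. \<mu> k * (b k \<bullet> x)\<^sup>2)" for x
  proof -
    have "B x = B (\<Sum>k\<in>UNIV. (b k \<bullet> x) *\<^sub>R b k)"
      using orthonormal_family_expand[OF b, of x] by simp
    also have "\<dots> = (\<Sum>k\<in>UNIV. (b k \<bullet> x) *\<^sub>R \<mu> k *\<^sub>R b k)"
      using \<open>linear B\<close> by (simp add: linear_sum linear_cmul ev)
    finally have "x \<bullet> B x = x \<bullet> (\<Sum>k\<in>UNIV. (b k \<bullet> x) *\<^sub>R \<mu> k *\<^sub>R b k)" by simp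
    then show ?thesis
      by (simp add: inner_sum_right power2_eq_square inner_commute algebra_simps)
  qed
  have "trace_on P B = (\<Sum>i\<in>Basis. \<Sum>k\<in>UNIV. \<mu> k * (P (b k) \<bullet> i)\<^sup>2)"
    using P by (simp add: trace_on_def 1 orth_proj_def)
  also have "\<dots> = (\<Sum>k\<in>UNIV. \<mu> k * (\<Sum>i\<in>Basis. (P (b k) \<bullet> i)\<^sup>2))"
    by (subst sum.swap) (simp add: sum_distrib_left)
  also have "\<dots> = (\<Sum>k\<in>UNIV. \<mu> k * (P (b k) \<bullet> P (b k)))"
    by (subst (2) euclidean_inner) (simp add: power2_eq_square)
  finally show ?thesis .
qed

text \<open>A minimiser of the sum over \<open>p\<close>-element sets collects the \<open>p\<close>
  smallest values: if a value inside exceeded one outside, exchanging the two would lower the sum.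
  The threshold is the largest value inside.\<close>

lemma threshold_subset:
  fixes \<mu> :: "'n::finite \<Rightarrow> real"
  assumes "1 \<le> p" "p \<le> CARD('n)"
  obtains I m where "card I = p" "\<And>k. k \<in> I \<Longrightarrow> \<mu> k \<le> m" "\<And>k. k \<notin> I \<Longrightarrow> m \<le> \<mu> k"
proof -
  let ?S = "{I :: 'n set. card I = p}"
  have "\<exists>I. I \<in> ?S" using obtain_subset_with_card_n[OF assms(2)] by auto
  then obtain I where I: "I \<in> ?S" and min: "\<And>J. J \<in> ?S \<Longrightarrow> sum \<mu> I \<le> sum \<mu> J"
    using arg_min_if_finite[of ?S "sum \<mu>"] by (metis empty_iff finite linorder_le_less_linear)
  have le: "\<mu> k \<le> \<mu> j" if "k \<in> I" "j \<notin> I" for k j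
  proof -
    have "card (insert j (I - {k})) = p"
      using that I assms by (simp add: card_Diff_singleton)
    then have "sum \<mu> I \<le> sum \<mu> (insert j (I - {k}))" using min by simp
    also have "\<dots> = \<mu> j + (sum \<mu> I - \<mu> k)"
      using that by (simp add: sum_diff1)
    finally show ?thesis by simp
  qed
  have "I \<noteq> {}" using I assms by auto
  show ?thesis
  proof
    show "card I = p" using I by simp
    show "\<mu> k \<le> Max (\<mu> ` I)" if "k \<in> I" for k using that by simp
    show "Max (\<mu> ` I) \<le> \<mu> k" if "k \<notin> I" for k using that le \<open>I \<noteq> {}\<close> by simp
  qed
qed

text \<open>Ky Fan's minimum principle. In the trace, each eigenvalue has a weight in
  \<open>[0, 1]\<close>, and the weights add up to \<open>p\<close>; shifting all weight to the
  \<open>p\<close> smallest eigenvalues can only lower the sum, and that lower value is positive by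
  assumption.\<close>

lemma ky_fan_trace_on_pos:
  fixes b :: "'n::finite \<Rightarrow> real ^ 'n"
  assumes P: "orth_proj p P" and b: "orthonormal_family b" and "linear B"
    and ev: "\<And>k. B (b k) = \<mu> k *\<^sub>R b k"
    and p: "1 \<le> p" "p \<le> CARD('n)"
    and pos: "\<And>I. card I = p \<Longrightarrow> 0 < sum \<mu> I"
  shows "0 < trace_on P B"
proof -
  obtain I m where I: "card I = p" "\<And>k. k \<in> I \<Longrightarrow> \<mu> k \<le> m" "\<And>k. k \<notin> I \<Longrightarrow> m \<le> \<mu> k"
    using threshold_subset[OF p] by metis
  define c where "c k = P (b k) \<bullet> P (b k)" for k
  have c: "0 \<le> c k" "c k \<le> 1" for k
    using orth_proj_norm_le[OF P, of "b k"] b by (auto simp: c_def orthonormal_family_def)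
  have s: "(\<Sum>k\<in>UNIV. c k) = real p"
    using orth_proj_sum_norm_family[OF P b] by (simp add: c_def)
  \<comment> \<open>Deviation of the weights from the indicator of \<open>I\<close>. It sums to
    zero, so the threshold \<open>m\<close> may be subtracted from every eigenvalue, and then each
    product \<open>(\<mu> k - m) * d k\<close> is nonnegative.\<close>
  define d where "d k = c k - (if k \<in> I then 1 else 0)" for k
  have "(\<Sum>k\<in>UNIV. d k) = 0"
    using s I(1) by (simp add: d_def sum_subtractf sum.If_cases)
  moreover have "0 \<le> (\<Sum>k\<in>UNIV. (\<mu> k - m) * d k)"
  proof (rule sum_nonneg)
    fix k show "0 \<le> (\<mu> k - m) * d k"
      using I(2,3)[of k] c[of k] by (cases "k \<in> I") (auto simp: d_def mult_nonpos_nonpos)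
  qed
  moreover have "(\<Sum>k\<in>UNIV. (\<mu> k - m) * d k) = (\<Sum>k\<in>UNIV. \<mu> k * d k) - m * (\<Sum>k\<in>UNIV. d k)"
    by (simp add: sum_distrib_left sum_subtractf left_diff_distrib)
  ultimately have "0 \<le> (\<Sum>k\<in>UNIV. \<mu> k * d k)" by simp
  also have "(\<Sum>k\<in>UNIV. \<mu> k * d k) = (\<Sum>k\<in>UNIV. \<mu> k * c k) - (\<Sum>k\<in>UNIV. \<mu> k * (if k \<in> I then 1 else 0))"
    by (simp add: d_def right_diff_distrib sum_subtractf)
  also have "(\<Sum>k\<in>UNIV. \<mu> k * (if k \<in> I then 1 else 0)) = sum \<mu> I"
    by (simp add: sum.inter_restrict[symmetric] if_distrib cong: if_cong)
  also have "(\<Sum>k\<in>UNIV. \<mu> k * c k) = trace_on P B"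
    using trace_on_eigenbasis[OF P b \<open>linear B\<close> ev] by (simp add: c_def)
  finally show ?thesis using pos[OF I(1)] by simp
qed

text \<open>The plane spanned by the eigenvectors in \<open>I\<close> realises exactly the
  eigenvalue sum over \<open>I\<close>. With the Ky Fan principle this translates between sums of
  eigenvalues and traces on planes in both directions.\<close>

lemma orth_proj_eigenspaces:
  assumes b: "orthonormal_family b"
  shows "orth_proj (card I) (\<lambda>x. \<Sum>k\<in>I. (b k \<bullet> x) *\<^sub>R b k)"
    and "\<And>B. linear B \<Longrightarrow> (\<And>k. B (b k) = \<mu> k *\<^sub>R b k) \<Longrightarrow>
      trace_on (\<lambda>x. \<Sum>k\<in>I. (b k \<bullet> x) *\<^sub>R b k) B = sum \<mu> I"
proof -
  let ?P = "\<lambda>x. \<Sum>k\<in>I. (b k \<bullet> x) *\<^sub>R b k"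
  have lin: "linear ?P"
    by (rule linearI) (simp_all add: inner_add_right scaleR_add_left sum.distrib scaleR_sum_right)
  have Pb: "?P (b j) = (if j \<in> I then b j else 0)" for j
  proof -
    have "?P (b j) = (\<Sum>k\<in>I. if k = j then b j else 0)"
      using b by (intro sum.cong) (auto simp: orthonormal_family_def)
    then show ?thesis by simp
  qed
  have "?P (?P x) = ?P x" for x
    using linear_sum[OF lin, of "\<lambda>k. (b k \<bullet> x) *\<^sub>R b k" I] linear_cmul[OF lin] Pb
    by (simp cong: sum.cong)
  moreover have "?P x \<bullet> y = x \<bullet> ?P y" for x y
    by (simp add: inner_sum_left inner_sum_right inner_commute mult.commute)
  moreover have "(\<Sum>i\<in>Basis. ?P i \<bullet> i) = real (card I)"
  proof -
    have "(\<Sum>i\<in>Basis. ?P i \<bullet> i) = (\<Sum>k\<in>I. \<Sum>i\<in>Basis. (b k \<bullet> i) * (b k \<bullet> i))"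
      by (subst sum.swap) (simp add: inner_sum_left)
    also have "\<dots> = (\<Sum>k\<in>I. b k \<bullet> b k)" by (simp add: euclidean_inner[symmetric])
    finally show ?thesis using b by (simp add: orthonormal_family_def)
  qed
  ultimately show P: "orth_proj (card I) ?P" using lin by (simp add: orth_proj_def)
  show "trace_on ?P B = sum \<mu> I" if "linear B" "\<And>k. B (b k) = \<mu> k *\<^sub>R b k" for B
  proof -
    have "trace_on ?P B = (\<Sum>k\<in>UNIV. \<mu> k * (?P (b k) \<bullet> ?P (b k)))"
      by (rule trace_on_eigenbasis[OF P b that])
    also have "\<dots> = (\<Sum>k\<in>UNIV. if k \<in> I then \<mu> k else 0)"
      using b unfolding Pb by (intro sum.cong) (auto simp: orthonormal_family_def)
    finally show ?thesis by (simp add: sum.inter_restrict[symmetric])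
  qed
qed

text \<open>Self-adjointness and \<open>P f = 0\<close> make \<open>f\<close> orthogonal to the
  range of \<open>P\<close>. The cross terms of the trace recombine into \<open>P f\<close> and
  vanish.\<close>

lemma orth_proj_add_line:
  assumes P: "orth_proj p P" and f: "f \<bullet> f = 1" "P f = 0" and B: "linear B"
  shows "orth_proj (Suc p) (\<lambda>x. P x + (f \<bullet> x) *\<^sub>R f)"
    and "trace_on (\<lambda>x. P x + (f \<bullet> x) *\<^sub>R f) B = trace_on P B + f \<bullet> B f"
proof -
  have lP: "linear P" and sa: "\<And>x y. P x \<bullet> y = x \<bullet> P y" using P by (auto simp: orth_proj_def)
  have tr: "(\<Sum>i\<in>Basis. P i \<bullet> i) = real p" using P unfolding orth_proj_def by blast
  have fP: "f \<bullet> P x = 0" for x using sa[of f x] f by simp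
  let ?Q = "\<lambda>x. P x + (f \<bullet> x) *\<^sub>R f"
  have "linear ?Q"
    by (rule linearI) (simp_all add: linear_add[OF lP] linear_cmul[OF lP] inner_add_right algebra_simps)
  moreover have "?Q (?Q x) = ?Q x" for x
    using P f fP by (simp add: linear_add[OF lP] linear_cmul[OF lP] orth_proj_def inner_add_right)
  moreover have "?Q x \<bullet> y = x \<bullet> ?Q y" for x y
    by (simp add: sa inner_add_left inner_add_right) (simp add: inner_commute)
  moreover have "(\<Sum>i\<in>Basis. ?Q i \<bullet> i) = real (Suc p)"
    using tr f(1) by (simp add: inner_add_left sum.distrib euclidean_inner[symmetric])
  ultimately show "orth_proj (Suc p) ?Q" by (simp add: orth_proj_def)
  have "trace_on ?Q B = (\<Sum>i\<in>Basis. P i \<bullet> B (P i) + (f \<bullet> i) * (P i \<bullet> B f) + (f \<bullet> i) * (f \<bullet> B (P i))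
      + (f \<bullet> i) * (f \<bullet> i) * (f \<bullet> B f))"
    by (simp add: trace_on_def linear_add[OF B] linear_cmul[OF B] inner_add_left inner_add_right algebra_simps)
  also have "\<dots> = trace_on P B + (\<Sum>i\<in>Basis. (f \<bullet> i) *\<^sub>R P i) \<bullet> B f + f \<bullet> B (\<Sum>i\<in>Basis. (f \<bullet> i) *\<^sub>R P i)
      + (f \<bullet> f) * (f \<bullet> B f)"
    by (simp add: sum.distrib trace_on_def inner_sum_left inner_sum_right linear_sum[OF B] linear_cmul[OF B]
        sum_distrib_right[symmetric] euclidean_inner[symmetric])
  also have "(\<Sum>i\<in>Basis. (f \<bullet> i) *\<^sub>R P i) = P (\<Sum>i\<in>Basis. (f \<bullet> i) *\<^sub>R i)"
    by (simp add: linear_sum[OF lP] linear_cmul[OF lP])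
  also have "(\<Sum>i\<in>Basis. (f \<bullet> i) *\<^sub>R i) = f" by (simp add: euclidean_representation)
  finally show "trace_on ?Q B = trace_on P B + f \<bullet> B f"
    using f linear_0[OF B] by simp
qed

lemma orth_proj_remove_line:
  assumes Q: "orth_proj (Suc p) Q" and x: "x \<bullet> x = 1" "Q x = x" and B: "linear B"
  shows "orth_proj p (\<lambda>y. Q y - (x \<bullet> y) *\<^sub>R x)"
    and "trace_on Q B = trace_on (\<lambda>y. Q y - (x \<bullet> y) *\<^sub>R x) B + x \<bullet> B x"
proof -
  have lQ: "linear Q" and sa: "\<And>x y. Q x \<bullet> y = x \<bullet> Q y" using Q by (auto simp: orth_proj_def)
  have tr: "(\<Sum>i\<in>Basis. Q i \<bullet> i) = real (Suc p)" using Q unfolding orth_proj_def by blast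
  have xQ: "x \<bullet> Q y = x \<bullet> y" for y using sa[of x y] x by simp
  let ?P = "\<lambda>y. Q y - (x \<bullet> y) *\<^sub>R x"
  have "linear ?P"
    by (rule linearI) (simp_all add: linear_add[OF lQ] linear_cmul[OF lQ] inner_add_right algebra_simps)
  moreover have "?P (?P y) = ?P y" for y
    using Q x xQ by (simp add: linear_diff[OF lQ] linear_cmul[OF lQ] orth_proj_def inner_diff_right)
  moreover have "?P y \<bullet> z = y \<bullet> ?P z" for y z
    by (simp add: sa inner_diff_left inner_diff_right) (simp add: inner_commute)
  moreover have "(\<Sum>i\<in>Basis. ?P i \<bullet> i) = real p"
    using tr x(1) by (simp add: inner_diff_left sum_subtractf euclidean_inner[symmetric])
  ultimately show *: "orth_proj p ?P" by (simp add: orth_proj_def)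
  have "?P x = 0" using x by simp
  from orth_proj_add_line(2)[OF * x(1) this B]
  show "trace_on Q B = trace_on ?P B + x \<bullet> B x" by simp
qed

text \<open>Adjoin to the range of \<open>P\<close> the unit vector \<open>f\<close> along
  \<open>e - P e\<close>; the enlarged space contains \<open>e\<close>. On it the form
  \<open>M = \<tau> - B\<close> lies between \<open>0\<close> and \<open>p \<tau>\<close>. In the
  splitting of \<open>e\<close>, the short part \<open>P e\<close> accounts for at most
  \<open>\<tau>\<close> of the value \<open>M e \<ge> \<tau> + N\<close>, so the rest must come from
  \<open>M f\<close>, which is precisely the trace on \<open>P\<close>.\<close>

lemma trace_on_near_orthogonal:
  assumes B: "linear B" and sym: "\<And>x y. B x \<bullet> y = x \<bullet> B y"
    and pos: "\<And>P. orth_proj p P \<Longrightarrow> 0 < trace_on P B"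
    and P: "orth_proj p P" and p: "1 \<le> p"
    and e: "e \<bullet> e = 1" "e \<bullet> B e \<le> - N"
    and small: "P e \<bullet> P e \<le> 1 / (2 * real p)" and N: "0 < N"
  shows "N / 2 \<le> trace_on P B"
proof -
  have lP: "linear P" and sa: "\<And>x y. P x \<bullet> y = x \<bullet> P y" and id: "\<And>x. P (P x) = P x"
    using P by (auto simp: orth_proj_def)
  have "1 / (2 * real p) \<le> 1 / 2" using p by (simp add: field_simps)
  with small have half: "P e \<bullet> P e \<le> 1 / 2" by linarith
  define h where "h = e - P e"
  have Ph: "P h = 0" by (simp add: h_def linear_diff[OF lP] id)
  have hh: "h \<bullet> h = 1 - P e \<bullet> P e"
    using sa[of e "P e"] e by (simp add: h_def id inner_diff inner_commute)
  define r where "r = norm h"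
  have r2: "r\<^sup>2 = h \<bullet> h" by (simp add: r_def power2_norm_eq_inner)
  then have r: "0 < r" "r\<^sup>2 \<le> 1" using hh half by (auto simp: r_def)
  define f where "f = (1 / r) *\<^sub>R h"
  have f: "f \<bullet> f = 1" "P f = 0" "h = r *\<^sub>R f"
    using r(1) r2 by (auto simp: f_def linear_cmul[OF lP] Ph power2_eq_square field_simps)
  define Q where "Q x = P x + (f \<bullet> x) *\<^sub>R f" for x
  have Q: "orth_proj (Suc p) Q" and trQ: "trace_on Q B = trace_on P B + f \<bullet> B f"
    using orth_proj_add_line[OF P f(1,2) B] unfolding Q_def[abs_def] .
  have lQ: "linear Q" using Q by (simp add: orth_proj_def)
  \<comment> \<open>every unit vector of the range of \<open>Q\<close> leaves a \<open>p\<close>-plane of positive trace, so \<open>\<tau> - B\<close> is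
    positive there; its trace \<open>p \<tau>\<close> bounds it from above\<close>
  define \<tau> where "\<tau> = trace_on Q B"
  define M where "M x = \<tau> * (x \<bullet> x) - x \<bullet> B x" for x
  have unit: "x \<bullet> B x < \<tau>" if "x \<bullet> x = 1" "Q x = x" for x
    using orth_proj_remove_line[OF Q that B] pos by (simp add: \<tau>_def)
  have M0: "0 \<le> M x" if "Q x = x" for x
  proof (cases "x = 0")
    case False
    let ?x = "(1 / norm x) *\<^sub>R x"
    have "?x \<bullet> B ?x < \<tau>"
      by (rule unit) (use False that in \<open>auto simp: linear_cmul[OF lQ] dot_square_norm power2_eq_square\<close>)
    then have "x \<bullet> B x < \<tau> * (norm x * norm x)"
      using False by (simp add: linear_cmul[OF B] field_simps)
    then show ?thesis
      by (simp add: M_def power2_norm_eq_inner[symmetric] power2_eq_square)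
  qed (simp add: M_def)
  have Qid: "Q (Q x) = Q x" and Qsa: "Q x \<bullet> y = x \<bullet> Q y" for x y using Q by (auto simp: orth_proj_def)
  have trM: "(\<Sum>i\<in>Basis. M (R i)) = \<tau> * real q - trace_on R B" if "orth_proj q R" for q R
    using orth_proj_sum_norm[OF that]
    by (simp add: M_def sum_subtractf trace_on_def sum_distrib_left[symmetric])
  have \<tau>0: "0 \<le> \<tau>"
  proof -
    have "0 \<le> (\<Sum>i\<in>Basis. M (Q i))" by (intro sum_nonneg M0 Qid)
    also have "\<dots> = \<tau> * real p" using trM[OF Q] by (simp add: \<tau>_def algebra_simps)
    finally show ?thesis using p by (simp add: zero_le_mult_iff)
  qed
  have Mle1: "M x \<le> real p * \<tau>" if x: "x \<bullet> x = 1" "Q x = x" for x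
  proof -
    let ?R = "\<lambda>y. Q y - (x \<bullet> y) *\<^sub>R x"
    have R: "orth_proj p ?R" and tr: "\<tau> = trace_on ?R B + x \<bullet> B x"
      using orth_proj_remove_line[OF Q x B] by (auto simp: \<tau>_def)
    have "Q (?R y) = ?R y" for y using x by (simp add: linear_diff[OF lQ] linear_cmul[OF lQ] Qid)
    then have "0 \<le> (\<Sum>i\<in>Basis. M (?R i))" by (intro sum_nonneg M0)
    also have "\<dots> = \<tau> * real p - trace_on ?R B" by (rule trM[OF R])
    finally show ?thesis using tr x by (simp add: M_def mult.commute)
  qed
  have Mle: "M x \<le> real p * \<tau> * (x \<bullet> x)" if "Q x = x" for x
  proof (cases "x = 0")
    case False
    let ?x = "(1 / norm x) *\<^sub>R x"
    have "M ?x \<le> real p * \<tau>"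
      by (rule Mle1) (use False that in \<open>auto simp: linear_cmul[OF lQ] dot_square_norm power2_eq_square\<close>)
    moreover have "M ?x = M x / (norm x)\<^sup>2"
      by (simp add: M_def linear_cmul[OF B] power2_eq_square diff_divide_distrib)
    ultimately have "M x \<le> real p * \<tau> * (norm x)\<^sup>2" using False by (simp add: field_simps)
    then show ?thesis by (simp add: power2_norm_eq_inner)
  qed (simp add: M_def)
  have QPe: "Q (P e) = P e"
    using sa[of f "P e"] f by (simp add: Q_def id)
  have Qf: "Q f = f" using f by (simp add: Q_def)
  \<comment> \<open>Parallelogram law. For \<open>a = r f\<close> and \<open>b = P e\<close> it
    gives \<open>M e \<le> 2 M (r f) + 2 M (P e)\<close>, because \<open>r f - P e\<close> also lies
    in the range of \<open>Q\<close>, where \<open>M\<close> is nonnegative.\<close>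
  have par: "M (a + b) + M (a - b) = 2 * M a + 2 * M b" for a b
    by (simp add: M_def linear_add[OF B] linear_diff[OF B] inner_add_left inner_add_right
        inner_diff_left inner_diff_right algebra_simps)
  have eh: "e = r *\<^sub>R f + P e" using f(3) by (metis diff_add_cancel h_def)
  have "0 \<le> M (r *\<^sub>R f - P e)" by (rule M0) (simp add: linear_diff[OF lQ] linear_cmul[OF lQ] QPe Qf)
  with par[of "r *\<^sub>R f" "P e"] eh have "M e \<le> 2 * M (r *\<^sub>R f) + 2 * M (P e)" by simp
  moreover have "M (r *\<^sub>R f) = r\<^sup>2 * M f"
    by (simp add: M_def linear_cmul[OF B] power2_eq_square algebra_simps)
  moreover have "r\<^sup>2 * M f \<le> M f"
    using r M0[OF Qf] mult_right_mono[of "r\<^sup>2" 1 "M f"] by simp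
  moreover have "M (P e) \<le> \<tau> / 2"
  proof -
    have "M (P e) \<le> real p * \<tau> * (P e \<bullet> P e)" by (rule Mle[OF QPe])
    also have "\<dots> \<le> real p * \<tau> * (1 / (2 * real p))"
      using small \<tau>0 by (intro mult_left_mono) auto
    also have "\<dots> = \<tau> / 2" using p by simp
    finally show ?thesis .
  qed
  moreover have "M e \<ge> \<tau> + N" using e by (simp add: M_def)
  ultimately have "N / 2 \<le> M f" by linarith
  also have "M f = trace_on P B" using trQ f by (simp add: M_def \<tau>_def)
  finally show ?thesis .
qed

text \<open>A dichotomy on the angle between \<open>e\<close> and the plane. If \<open>P e\<close>
  is short, the trace of \<open>B\<close> alone is at least \<open>N / 2\<close>; if not, the
  rank-one term contributes more than \<open>N / (2 p)\<close> on top of a positive trace. The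
  perturbation costs \<open>E p\<close>, at most half of \<open>N / (2 p)\<close>.\<close>

lemma trace_on_perturbed:
  assumes B: "linear B" "\<And>x y. B x \<bullet> y = x \<bullet> B y" and D: "linear D"
    and pos: "\<And>P. orth_proj p P \<Longrightarrow> 0 < trace_on P B"
    and P: "orth_proj p P" and p: "1 \<le> p"
    and e: "e \<bullet> e = 1" "e \<bullet> B e \<le> - N" and N: "0 < N"
    and ge: "\<And>x. x \<bullet> B x + N * (e \<bullet> x)\<^sup>2 - E * (x \<bullet> x) \<le> x \<bullet> D x"
    and E: "E \<le> N / (4 * (real p)\<^sup>2)"
  shows "N / (4 * real p) \<le> trace_on P D"
proof -
  have sa: "\<And>x y. P x \<bullet> y = x \<bullet> P y" using P by (auto simp: orth_proj_def)
  have "N / (2 * real p) \<le> trace_on P B + N * (P e \<bullet> P e)"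
  proof (cases "P e \<bullet> P e \<le> 1 / (2 * real p)")
    case True
    from trace_on_near_orthogonal[OF B pos P p e this N]
    have "N / 2 \<le> trace_on P B" .
    moreover have "N / (2 * real p) \<le> N / 2" using p N by (simp add: field_simps)
    moreover have "0 \<le> N * (P e \<bullet> P e)" using N by simp
    ultimately show ?thesis by linarith
  next
    case False
    then have "N * (1 / (2 * real p)) \<le> N * (P e \<bullet> P e)" using N by (intro mult_left_mono) auto
    then show ?thesis using pos[OF P] by simp
  qed
  moreover have "trace_on P B + N * (P e \<bullet> P e) - E * real p \<le> trace_on P D"
  proof -
    have "(\<Sum>i\<in>Basis. (e \<bullet> P i)\<^sup>2) = P e \<bullet> P e"
      by (subst (2) euclidean_inner) (simp add: sa power2_eq_square)
    then have "trace_on P B + N * (P e \<bullet> P e) - E * real p =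
        (\<Sum>i\<in>Basis. P i \<bullet> B (P i) + N * (e \<bullet> P i)\<^sup>2 - E * (P i \<bullet> P i))"
      using orth_proj_sum_norm[OF P]
      by (simp add: trace_on_def sum.distrib sum_subtractf sum_distrib_left[symmetric])
    also have "\<dots> \<le> trace_on P D" unfolding trace_on_def by (intro sum_mono ge)
    finally show ?thesis .
  qed
  moreover have "E * real p \<le> N / (4 * real p)"
  proof -
    have "E * real p \<le> N / (4 * (real p)\<^sup>2) * real p" using E by (intro mult_right_mono) auto
    then show ?thesis using p by (simp add: power2_eq_square)
  qed
  moreover have "N / (2 * real p) - N / (4 * real p) = N / (4 * real p)" by (simp add: field_simps)
  ultimately show ?thesis by linarith
qed

section \<open>Eigenvalues with respect to a metric\<close>

text \<open>Along the line through \<open>v\<close> in direction \<open>y\<close> the form is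
  \<open>2 t a + t\<^sup>2 c\<close> with \<open>a = y \<bullet> B v\<close>. A parabola without
  constant term that never becomes negative has no linear term.\<close>

lemma psd_zero_imp_kernel:
  assumes B: "linear B" and sym: "\<And>x y. B x \<bullet> y = x \<bullet> B y"
    and nonneg: "\<And>t. 0 \<le> (v + t *\<^sub>R y) \<bullet> B (v + t *\<^sub>R y)"
    and zero: "v \<bullet> B v = (0::real)"
  shows "y \<bullet> B v = 0"
proof (rule ccontr)
  assume ne: "y \<bullet> B v \<noteq> 0"
  define a where "a = y \<bullet> B v"
  define c where "c = y \<bullet> B y"
  have q: "0 \<le> 2 * t * a + t\<^sup>2 * c" for t
  proof -
    have "v \<bullet> B y = a" using sym[of v y] by (simp add: a_def inner_commute)
    then show ?thesis
      using nonneg[of t] zero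
      by (simp add: linear_add[OF B] linear_cmul[OF B] inner_add_left inner_add_right
          a_def c_def power2_eq_square algebra_simps)
  qed
  define d where "d = 1 + \<bar>c\<bar>"
  have d: "0 < d" "c \<le> d" by (auto simp: d_def)
  \<comment> \<open>The vertex of the parabola in which \<open>c\<close> is replaced by the positive
    upper bound \<open>d\<close>; there it is strictly negative unless \<open>a = 0\<close>.\<close>
  define t where "t = - a / d"
  have "2 * t * a + t\<^sup>2 * c \<le> 2 * t * a + t\<^sup>2 * d"
    using d by (intro add_left_mono mult_left_mono) auto
  also have "\<dots> = - (a\<^sup>2 / d)"
    using d by (simp add: t_def power2_eq_square field_simps)
  also have "\<dots> < 0" using ne d by (simp add: a_def)
  finally show False using q[of t] by simp
qed

text \<open>Maximise the quadratic form on the unit sphere of the orthogonal complement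
  \<open>T\<close> of \<open>S\<close>. With the maximum \<open>m\<close>, the form of
  \<open>M = m - B\<close> is nonnegative on \<open>T\<close> and vanishes at the maximiser, which
  therefore lies in the kernel of \<open>M\<close>.\<close>

lemma exists_eigenvector_orthogonal:
  fixes B :: "real ^ 'n::finite \<Rightarrow> real ^ 'n"
  assumes B: "linear B" and sym: "\<And>x y. B x \<bullet> y = x \<bullet> B y"
    and S: "card S < CARD('n)" "finite S"
    and ev: "\<And>s. s \<in> S \<Longrightarrow> \<exists>m. B s = m *\<^sub>R s"
  obtains v m where "v \<bullet> v = 1" "B v = m *\<^sub>R v" "\<And>s. s \<in> S \<Longrightarrow> s \<bullet> v = 0"
proof -
  define T where "T = {x. \<forall>s\<in>S. s \<bullet> x = 0}"
  define K where "K = sphere 0 1 \<inter> T"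
  have "span S \<noteq> UNIV"
    using S dim_le_card'[of S] by (metis dim_UNIV dim_span not_le DIM_cart DIM_real mult_1_right)
  then obtain a where a: "a \<noteq> 0" "\<And>x. x \<in> span S \<Longrightarrow> a \<bullet> x = 0"
    using span_not_UNIV_orthogonal by blast
  have "(1 / norm a) *\<^sub>R a \<in> K"
    using a by (auto simp: K_def T_def span_base inner_commute)
  then have ne: "K \<noteq> {}" by blast
  have "closed T"
  proof -
    have "T = (\<Inter>s\<in>S. {x. s \<bullet> x = 0})" by (auto simp: T_def)
    then show ?thesis by (auto intro!: closed_INT closed_hyperplane)
  qed
  then have "compact K" by (simp add: K_def compact_Int_closed)
  moreover have "continuous_on K (\<lambda>x. x \<bullet> B x)"
    using B by (intro continuous_intros linear_continuous_on linear_linear[THEN iffD2]) (auto simp: linear_conv_bounded_linear)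
  ultimately obtain v where v: "v \<in> K" "\<And>x. x \<in> K \<Longrightarrow> x \<bullet> B x \<le> v \<bullet> B v"
    using continuous_attains_sup[OF _ ne] by blast
  define m where "m = v \<bullet> B v"
  define M where "M x = m *\<^sub>R x - B x" for x
  have M: "linear M"
    by (rule linearI) (simp_all add: M_def linear_add[OF B] linear_cmul[OF B] algebra_simps)
  have Ms: "M x \<bullet> y = x \<bullet> M y" for x y
    by (simp add: M_def inner_diff_left inner_diff_right sym)
  have vv: "v \<bullet> v = 1" using v by (simp add: K_def norm_eq_1)
  have vT: "v \<in> T" using v by (simp add: K_def)
  have nonneg: "0 \<le> x \<bullet> M x" if "x \<in> T" for x
  proof (cases "x = 0")
    case False
    let ?x = "(1 / norm x) *\<^sub>R x"
    have "?x \<in> K" using False that by (simp add: K_def T_def)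
    then have "?x \<bullet> B ?x \<le> m" unfolding m_def by (rule v(2))
    then have "x \<bullet> B x \<le> m * (norm x * norm x)"
      using False by (simp add: linear_cmul[OF B] field_simps)
    then show ?thesis
      by (simp add: M_def inner_diff_right dot_square_norm power2_eq_square)
  qed simp
  \<comment> \<open>Since \<open>S\<close> consists of eigenvectors, \<open>T\<close> is invariant.
    This lets \<open>M v\<close> itself be the test direction and yields
    \<open>M v \<bullet> M v = 0\<close>.\<close>
  have MvT: "M v \<in> T"
  proof -
    have "s \<bullet> M v = 0" if sS: "s \<in> S" for s
    proof -
      obtain k where "B s = k *\<^sub>R s" using ev[OF sS] by blast
      then have "s \<bullet> B v = k * (s \<bullet> v)" using sym[of s v] by simp
      then show ?thesis using vT that by (simp add: M_def T_def inner_diff_right)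
    qed
    then show ?thesis by (simp add: T_def)
  qed
  have "M v \<bullet> M v = 0"
  proof (rule psd_zero_imp_kernel[OF M Ms])
    show "0 \<le> (v + t *\<^sub>R M v) \<bullet> M (v + t *\<^sub>R M v)" for t
      by (rule nonneg) (use vT MvT in \<open>auto simp: T_def inner_add_right\<close>)
    show "v \<bullet> M v = 0" using vv by (simp add: M_def m_def inner_diff_right)
  qed
  then have "B v = m *\<^sub>R v" by (simp add: M_def)
  then show ?thesis using that vv vT by (auto simp: T_def)
qed

theorem symmetric_orthonormal_eigenbasis:
  fixes B :: "real ^ 'n::finite \<Rightarrow> real ^ 'n"
  assumes B: "linear B" and sym: "\<And>x y. B x \<bullet> y = x \<bullet> B y"
  obtains b l where "orthonormal_family b" "\<And>k. B (b k) = l k *\<^sub>R b k"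
proof -
  let ?ok = "\<lambda>S. finite S \<and> pairwise orthogonal S \<and> (\<forall>s\<in>S. s \<bullet> s = 1 \<and> (\<exists>m. B s = m *\<^sub>R s))"
  have "k \<le> CARD('n) \<Longrightarrow> \<exists>S. ?ok S \<and> card S = k" for k
  proof (induction k)
    case 0
    then show ?case by (intro exI[of _ "{}"]) (simp add: pairwise_def)
  next
    case (Suc k)
    then obtain S where S: "?ok S" "card S = k" by auto
    then obtain v m where v: "v \<bullet> v = 1" "B v = m *\<^sub>R v" "\<And>s. s \<in> S \<Longrightarrow> s \<bullet> v = 0"
      using exists_eigenvector_orthogonal[OF B sym, of S] Suc.prems by (metis Suc_le_lessD)
    have "v \<notin> S" using v by auto
    then show ?case using S v
      by (intro exI[of _ "insert v S"]) (auto simp: pairwise_insert orthogonal_def[of v] orthogonal_def[of _ v] inner_commute)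
  qed
  then obtain S where S: "?ok S" "card S = CARD('n)" by blast
  then obtain b where b: "bij_betw b (UNIV :: 'n set) S"
    using finite_same_card_bij[of "UNIV :: 'n set" S] by auto
  have bS: "b i \<in> S" for i using b by (auto simp: bij_betw_def)
  have "b i \<bullet> b j = (if i = j then 1 else 0)" for i j
  proof (cases "i = j")
    case False
    then have "b i \<noteq> b j" using b by (auto simp: bij_betw_def inj_on_def)
    then show ?thesis using S(1) bS False by (auto simp: pairwise_def orthogonal_def)
  qed (use S(1) bS in auto)
  then have "orthonormal_family b" by (simp add: orthonormal_family_def)
  moreover have "\<exists>l. \<forall>k. B (b k) = l k *\<^sub>R b k" using S(1) bS by (intro choice) blast
  ultimately show ?thesis using that by blast
qed

section \<open>Characteristic polynomials in orthonormal frames\<close>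

lemma prod_linear_factors_eq_imp_permutes:
  fixes l m :: "'n::finite \<Rightarrow> real"
  assumes "\<And>t. (\<Prod>i\<in>UNIV. t - l i) = (\<Prod>i\<in>UNIV. t - m i)"
  obtains \<pi> where "\<pi> permutes UNIV" "\<And>i. l i = m (\<pi> i)"
proof -
  have "(\<Prod>i\<in>UNIV. [:- l i, 1:]) = (\<Prod>i\<in>UNIV. [:- m i, 1:])"
    unfolding poly_eq_poly_eq_iff[symmetric] by (rule ext) (use assms in \<open>simp add: poly_prod\<close>)
  then have "proots (\<Prod>i\<in>UNIV. [:- l i, 1:]) = proots (\<Prod>i\<in>UNIV. [:- m i, 1:])" by simp
  then have "image_mset l (mset_set UNIV) = image_mset m (mset_set UNIV)"
    by (subst (asm) (1 2) proots_prod) (auto simp: sum_unfold_sum_mset)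
  then obtain \<pi> where "\<pi> permutes UNIV" "\<forall>i\<in>UNIV. l i = m (\<pi> i)"
    using image_mset_eq_implies_permutes[of UNIV l m] by auto
  then show ?thesis using that by blast
qed


text \<open>The two shifted matrices are conjugate by \<open>X\<close>, because
  \<open>(t - X Y) X = X (t - Y X)\<close>. It moves the frame \<open>V\<close> from one side of
  \<open>T\<close> to the other.\<close>

lemma det_shift_commute:
  fixes X Y :: "real ^ 'n::finite ^ 'n"
  assumes "invertible X"
  shows "det (t *\<^sub>R mat 1 - X ** Y) = det (t *\<^sub>R mat 1 - Y ** X)"
proof -
  have "(t *\<^sub>R mat 1 - X ** Y) ** X = X ** (t *\<^sub>R mat 1 - Y ** X)"
    by (simp add: matrix_eq matrix_vector_mul_assoc[symmetric] matrix_vector_mult_diff_rdistrib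
        matrix_vector_mult_diff_distrib scaleR_matrix_vector_assoc[symmetric] matrix_vector_mult_scaleR)
  then have "det (t *\<^sub>R mat 1 - X ** Y) * det X = det X * det (t *\<^sub>R mat 1 - Y ** X)"
    by (metis det_mul)
  then show ?thesis using assms by (simp add: invertible_det_nz)
qed

lemma det_shift_eigenbasis:
  fixes B :: "real ^ 'n::finite ^ 'n"
  assumes b: "orthonormal_family b" and ev: "\<And>k. B *v b k = l k *\<^sub>R b k"
  shows "det (t *\<^sub>R mat 1 - B) = (\<Prod>i\<in>UNIV. t - l i)"
proof -
  let ?Q = "(\<chi> i j. b j $ i) :: real ^ 'n ^ 'n"
  have Q: "transpose ?Q ** ?Q = mat 1"
    using b
    by (simp add: orthonormal_family_def matrix_matrix_mult_def transpose_def mat_def vec_eq_iff inner_vec_def)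
  then have inv: "invertible ?Q" unfolding invertible_left_inverse by (rule exI)
  let ?D = "(\<chi> i j. if i = j then t - l j else 0) :: real ^ 'n ^ 'n"
  have "((t *\<^sub>R mat 1 - B) ** ?Q) $ i $ j = (?Q ** ?D) $ i $ j" for i j
  proof -
    have "((t *\<^sub>R mat 1 - B) ** ?Q) $ i $ j = ((t *\<^sub>R mat 1 - B) *v b j) $ i"
      by (simp add: matrix_matrix_mult_def matrix_vector_mult_def)
    also have "\<dots> = (t - l j) * b j $ i"
      by (simp add: matrix_vector_mult_diff_rdistrib scaleR_matrix_vector_assoc[symmetric] ev left_diff_distrib)
    also have "\<dots> = (\<Sum>k\<in>UNIV. if k = j then (t - l j) * b j $ i else 0)" by simp
    also have "\<dots> = (\<Sum>k\<in>UNIV. b k $ i * (if k = j then t - l j else 0))"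
      by (rule sum.cong) auto
    also have "\<dots> = (?Q ** ?D) $ i $ j" by (simp add: matrix_matrix_mult_def)
    finally show ?thesis .
  qed
  then have "(t *\<^sub>R mat 1 - B) ** ?Q = ?Q ** ?D" by (simp add: vec_eq_iff)
  from arg_cong[OF this, of det]
  have "det (t *\<^sub>R mat 1 - B) * det ?Q = det ?Q * det ?D" by (simp only: det_mul)
  then have "det (t *\<^sub>R mat 1 - B) = det ?D" using inv by (simp add: invertible_det_nz)
  also have "\<dots> = (\<Prod>i\<in>UNIV. t - l i)" using det_diagonal[of ?D] by simp
  finally show ?thesis .
qed

lemma matrix_inv_unique:
  fixes G H :: "real ^ 'n::finite ^ 'n"
  assumes "H ** G = mat 1"
  shows "matrix_inv G = H"
proof -
  have "G ** H = mat 1 \<and> H ** G = mat 1"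
    using assms matrix_left_right_inverse[of H G] by simp
  then have "G ** matrix_inv G = mat 1"
    unfolding matrix_inv_def by (rule someI2) simp
  then have "H ** (G ** matrix_inv G) = H" by simp
  then show ?thesis by (simp add: matrix_mul_assoc assms)
qed

lemma matrix_inv_frame:
  fixes G V :: "real ^ 'n::finite ^ 'n"
  assumes "transpose V ** G ** V = mat 1"
  shows "invertible V" "matrix_inv G = V ** transpose V"
proof -
  show "invertible V" using assms by (metis invertible_left_inverse)
  have "V ** (transpose V ** G) = mat 1"
    using assms matrix_left_right_inverse[of "transpose V ** G" V] by simp
  then have "(V ** transpose V) ** G = mat 1" by (simp add: matrix_mul_assoc)
  then show "matrix_inv G = V ** transpose V" by (rule matrix_inv_unique)
qed

lemma linear_matrix_symmetric:
  fixes B :: "real ^ 'n::finite ^ 'n"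
  assumes "transpose B = B"
  shows "(B *v x) \<bullet> y = x \<bullet> (B *v y)"
  using assms by (metis dot_lmul_matrix inner_commute transpose_matrix_vector)

text \<open>As \<open>G\<^sup>-\<^sup>1 = V V\<^sup>T\<close>, the matrix
  \<open>G\<^sup>-\<^sup>1 T\<close> has the characteristic polynomial of the symmetric matrix
  \<open>V\<^sup>T T V\<close>. The list \<open>eigenvalues G T\<close> is a choice, determined by
  that polynomial only up to order, so the eigenbasis is permuted to match it.\<close>

lemma eigenvalues_eigenbasis:
  fixes G T V :: "real ^ 'n::finite ^ 'n"
  assumes V: "transpose V ** G ** V = mat 1" and T: "transpose T = T"
  obtains b where "orthonormal_family b"
    "\<And>k. (transpose V ** T ** V) *v b k = eigenvalues G T $ k *\<^sub>R b k"
proof -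
  let ?B = "transpose V ** T ** V"
  have "transpose ?B = ?B"
    by (simp add: matrix_transpose_mul T matrix_mul_assoc)
  then have sym: "(?B *v x) \<bullet> y = x \<bullet> (?B *v y)" for x y
    by (rule linear_matrix_symmetric)
  obtain b l where b: "orthonormal_family b" "\<And>k. ?B *v b k = l k *\<^sub>R b k"
    using symmetric_orthonormal_eigenbasis[OF matrix_vector_mul_linear[of ?B] sym] by blast
  have "det (t *\<^sub>R mat 1 - matrix_inv G ** T) = (\<Prod>i\<in>UNIV. t - l i)" for t
    using det_shift_commute[OF matrix_inv_frame(1)[OF V], of t "transpose V ** T"]
      det_shift_eigenbasis[OF b, of t] matrix_inv_frame(2)[OF V]
    by (simp add: matrix_mul_assoc)
  then have "\<forall>t. det (t *\<^sub>R mat 1 - matrix_inv G ** T) = (\<Prod>i\<in>UNIV. t - (\<chi> i. l i) $ i)"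
    by simp
  then have "\<forall>t. det (t *\<^sub>R mat 1 - matrix_inv G ** T) = (\<Prod>i\<in>UNIV. t - eigenvalues G T $ i)"
    unfolding eigenvalues_def by (rule someI)
  then have "(\<Prod>i\<in>UNIV. t - eigenvalues G T $ i) = (\<Prod>i\<in>UNIV. t - l i)" for t
    using \<open>\<And>t. det (t *\<^sub>R mat 1 - matrix_inv G ** T) = (\<Prod>i\<in>UNIV. t - l i)\<close> by metis
  then obtain \<pi> where \<pi>: "\<pi> permutes UNIV" "\<And>i. eigenvalues G T $ i = l (\<pi> i)"
    using prod_linear_factors_eq_imp_permutes[of "\<lambda>i. eigenvalues G T $ i" l] by blast
  show ?thesis
  proof
    show "orthonormal_family (b \<circ> \<pi>)"
      using b(1) permutes_inj[OF \<pi>(1)] by (simp add: orthonormal_family_def inj_eq)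
    show "?B *v (b \<circ> \<pi>) k = eigenvalues G T $ k *\<^sub>R (b \<circ> \<pi>) k" for k
      using b(2) \<pi>(2) by simp
  qed
qed

text \<open>\<open>F_op\<close> is a geometric mean: its exponent is the reciprocal of the number of
  factors, so a common lower bound of the factors passes to the mean.\<close>

lemma F_op_lower_bound:
  fixes l :: "real ^ 'n::finite"
  assumes "1 \<le> p" "p \<le> CARD('n)" "0 \<le> a"
    and le: "\<And>I. card I = p \<Longrightarrow> a \<le> (\<Sum>i\<in>I. l $ i)"
  shows "a \<le> F_op p l"
proof -
  let ?S = "{I :: 'n set. card I = p}" and ?N = "CARD('n) choose p"
  have N: "card ?S = ?N" using n_subsets[of "UNIV :: 'n set" p] by simp
  have pos: "0 < ?N" using assms by simp
  have "a ^ ?N = (\<Prod>I\<in>?S. a)" by (simp add: N)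
  also have "\<dots> \<le> (\<Prod>I\<in>?S. \<Sum>i\<in>I. l $ i)" using le assms by (intro prod_mono) auto
  finally have "(a ^ ?N) powr (1 / real ?N) \<le> F_op p l"
    unfolding F_op_def using assms by (intro powr_mono2) auto
  moreover have "(a ^ ?N) powr (1 / real ?N) = a"
  proof (cases "a = 0")
    case True
    then show ?thesis using pos by (simp add: power_0_left)
  next
    case False
    then show ?thesis using assms pos
      by (simp add: powr_powr flip: powr_realpow)
  qed
  ultimately show ?thesis by simp
qed

text \<open>The matrices \<open>V\<^sup>T S V\<close> and \<open>W\<^sup>T T W\<close> represent \<open>S\<close> and \<open>T\<close> in orthonormal frames for the
  metrics \<open>G\<close> and \<open>H\<close>.\<close>

lemma F_op_lower_bound_perturbed:
  fixes G H S T V W :: "real ^ 'n::finite ^ 'n"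
  assumes p: "1 \<le> p" "p \<le> CARD('n)"
    and V: "transpose V ** G ** V = mat 1" and S: "transpose S = S"
    and W: "transpose W ** H ** W = mat 1" and T: "transpose T = T"
    and cone: "eigenvalues G S \<in> pcone p"
    and e: "e \<bullet> e = 1" "(V *v e) \<bullet> (S *v (V *v e)) \<le> - N" and N: "0 < N"
    and ge: "\<And>x. (V *v x) \<bullet> (S *v (V *v x)) + N * (e \<bullet> x)\<^sup>2 - E * (x \<bullet> x)
                 \<le> (W *v x) \<bullet> (T *v (W *v x))"
    and E: "E \<le> N / (4 * (real p)\<^sup>2)"
  shows "N / (4 * real p) \<le> F_op p (eigenvalues H T)"
proof -
  let ?B = "transpose V ** S ** V" and ?D = "transpose W ** T ** W"
  have form: "x \<bullet> ((transpose X ** Y ** X) *v z) = (X *v x) \<bullet> (Y *v (X *v z))"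
    for X Y :: "real ^ 'n ^ 'n" and x z
    by (simp only: matrix_vector_mul_assoc[symmetric] dot_lmul_matrix[symmetric] vector_transpose_matrix)
  have "transpose ?B = ?B" by (simp add: matrix_transpose_mul S matrix_mul_assoc)
  then have symB: "(?B *v x) \<bullet> y = x \<bullet> (?B *v y)" for x y by (rule linear_matrix_symmetric)
  obtain b where b: "orthonormal_family b" "\<And>k. ?B *v b k = eigenvalues G S $ k *\<^sub>R b k"
    using eigenvalues_eigenbasis[OF V S] by blast
  obtain d where d: "orthonormal_family d" "\<And>k. ?D *v d k = eigenvalues H T $ k *\<^sub>R d k"
    using eigenvalues_eigenbasis[OF W T] by blast
  \<comment> \<open>The cone condition is restated as positivity on every plane. In this form it can
    be tested on planes spanned by eigenvectors of \<open>?D\<close>, which bear no relation to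
    those of \<open>?B\<close>.\<close>
  have pos: "0 < trace_on P ((*v) ?B)" if "orth_proj p P" for P
    by (rule ky_fan_trace_on_pos[OF that b(1) matrix_vector_mul_linear b(2) p])
      (use cone in \<open>auto simp: pcone_def\<close>)
  have e2: "e \<bullet> (?B *v e) \<le> - N" unfolding form by (rule e(2))
  have ge': "x \<bullet> (?B *v x) + N * (e \<bullet> x)\<^sup>2 - E * (x \<bullet> x) \<le> x \<bullet> (?D *v x)" for x
    unfolding form by (rule ge)
  show ?thesis
  proof (rule F_op_lower_bound[OF p])
    show "0 \<le> N / (4 * real p)" using N by simp
    fix I :: "'n set" assume I: "card I = p"
    let ?P = "\<lambda>x. \<Sum>k\<in>I. (d k \<bullet> x) *\<^sub>R d k"
    have P: "orth_proj p ?P" using orth_proj_eigenspaces(1)[OF d(1), of I] I by simp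
    have "N / (4 * real p) \<le> trace_on ?P ((*v) ?D)"
      by (rule trace_on_perturbed[OF matrix_vector_mul_linear symB matrix_vector_mul_linear pos P p(1) e(1) e2 N ge' E])
    also have "\<dots> = (\<Sum>k\<in>I. eigenvalues H T $ k)"
      by (rule orth_proj_eigenspaces(2)[OF d(1) matrix_vector_mul_linear d(2)])
    finally show "N / (4 * real p) \<le> (\<Sum>k\<in>I. eigenvalues H T $ k)" .
  qed
qed

section \<open>Doubling of variables\<close>

text \<open>If \<open>c\<close> were positive, \<open>h'\<close> would exceed
  \<open>h' 0 = 0\<close> immediately to the right of the origin and \<open>h\<close> would increase
  there, against maximality.\<close>

lemma second_derivative_at_local_max:
  fixes h :: "real \<Rightarrow> real"
  assumes d: "0 < d" and h: "\<And>s. \<bar>s\<bar> < d \<Longrightarrow> (h has_real_derivative h' s) (at s)"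
    and h': "(h' has_real_derivative c) (at 0)"
    and max: "\<And>s. \<bar>s\<bar> < d \<Longrightarrow> h s \<le> h 0"
  shows "h' 0 = 0" "c \<le> 0"
proof -
  show 0: "h' 0 = 0"
    using DERIV_local_max[OF h[of 0] d] max d by simp
  show "c \<le> 0"
  proof (rule ccontr)
    assume "\<not> c \<le> 0"
    then obtain e where e: "0 < e" "\<And>s. 0 < s \<Longrightarrow> s < e \<Longrightarrow> h' 0 < h' s"
      using DERIV_pos_inc_right[OF h'] by auto
    define s where "s = min e d / 2"
    have s: "0 < s" "s < e" "s < d" using e d by (auto simp: s_def)
    have "h 0 < h s"
    proof (rule DERIV_pos_imp_increasing_open[OF s(1)])
      show "\<exists>y. (h has_real_derivative y) (at r) \<and> 0 < y" if "0 < r" "r < s" for r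
        using h[of r] e(2)[of r] 0 that s by (intro exI[of _ "h' r"]) auto
      show "continuous_on {0..s} h"
      proof (rule DERIV_continuous_on)
        show "(h has_real_derivative h' r) (at r within {0..s})" if "r \<in> {0..s}" for r
          by (rule has_field_derivative_at_within, rule h) (use that s in auto)
      qed
    qed
    with max[of s] s show False by simp
  qed
qed

text \<open>The mixed second difference of \<open>u\<close> is symmetric in \<open>v\<close> and
  \<open>w\<close>. It equals \<open>t\<^sup>2 * (H w \<bullet> v)\<close> up to
  \<open>\<epsilon> t\<^sup>2\<close> times a constant, and likewise with the roles exchanged;
  comparing the two for every \<open>\<epsilon>\<close> identifies the coefficients.\<close>

lemma second_derivative_symmetric:
  fixes u :: "'a::real_inner \<Rightarrow> real"
  assumes d: "0 < d" and u: "\<And>y. y \<in> ball x d \<Longrightarrow> (u has_derivative (\<lambda>v. p y \<bullet> v)) (at y)"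
    and p: "(p has_derivative H) (at x)"
  shows "H v \<bullet> w = v \<bullet> H w"
proof -
  interpret H: bounded_linear H using p by (rule has_derivative_bounded_linear)
  have approx: "\<exists>r>0. \<forall>t. 0 < t \<and> t < r \<longrightarrow>
      \<bar>u (x + t *\<^sub>R v + t *\<^sub>R w) - u (x + t *\<^sub>R v) - u (x + t *\<^sub>R w) + u x - t\<^sup>2 * (H w \<bullet> v)\<bar>
        \<le> t\<^sup>2 * (\<epsilon> * (2 * norm v + norm w) * norm v)"
    if \<epsilon>: "0 < \<epsilon>" for \<epsilon> v w
  proof -
    obtain r where r: "0 < r" "\<And>y. norm (y - x) < r \<Longrightarrow> norm (p y - p x - H (y - x)) \<le> \<epsilon> * norm (y - x)"
      using p \<epsilon> unfolding has_derivative_at_alt by blast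
    define R where "R = min r d / (norm v + norm w + 1)"
    have den: "0 < norm v + norm w + 1" by (simp add: add_nonneg_pos)
    have R: "0 < R" using r d den by (simp add: R_def)
    show ?thesis
    proof (intro exI[of _ R] conjI R allI impI)
      fix t assume t: "0 < t \<and> t < R"
      have small: "norm (s *\<^sub>R v + t' *\<^sub>R w) < min r d" if "0 \<le> s" "s \<le> t" "0 \<le> t'" "t' \<le> t" for s t'
      proof -
        have "norm (s *\<^sub>R v + t' *\<^sub>R w) \<le> s * norm v + t' * norm w"
          using norm_triangle_ineq[of "s *\<^sub>R v" "t' *\<^sub>R w"] that by simp
        also have "\<dots> \<le> t * norm v + t * norm w"
          using that by (intro add_mono mult_right_mono) auto
        also have "\<dots> < t * (norm v + norm w + 1)" using t by (simp add: algebra_simps)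
        also have "\<dots> \<le> R * (norm v + norm w + 1)" using t den by (intro mult_right_mono) auto
        also have "\<dots> = min r d" using den by (simp add: R_def)
        finally show ?thesis .
      qed
      \<comment> \<open>The second difference is \<open>g t - g 0\<close>. A single mean value point
        turns it into a difference of two gradients, both close to the linearisation of
        \<open>p\<close> at \<open>x\<close>.\<close>
      define g where "g s = u (x + s *\<^sub>R v + t *\<^sub>R w) - u (x + s *\<^sub>R v)" for s
      have dg: "(g has_real_derivative (p (x + s *\<^sub>R v + t *\<^sub>R w) - p (x + s *\<^sub>R v)) \<bullet> v) (at s)"
        if "0 \<le> s" "s \<le> t" for s
      proof -
        have line: "((\<lambda>s. u (x + s *\<^sub>R v + q)) has_real_derivative p (x + s *\<^sub>R v + q) \<bullet> v) (at s)"
          if "x + s *\<^sub>R v + q \<in> ball x d" for q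
        proof -
          have "((\<lambda>s. x + s *\<^sub>R v + q) has_derivative (\<lambda>h. h *\<^sub>R v)) (at s)"
            by (auto intro!: derivative_eq_intros)
          from has_derivative_compose[OF this u[OF that]] show ?thesis
            by (simp add: has_field_derivative_def mult_commute_abs)
        qed
        have "x + s *\<^sub>R v + t *\<^sub>R w \<in> ball x d" "x + s *\<^sub>R v + 0 \<in> ball x d"
          using small[of s t] small[of s 0] that t by (auto simp: dist_norm norm_minus_commute algebra_simps)
        from DERIV_diff[OF line[OF this(1)] line[OF this(2)]] show ?thesis
          by (simp add: g_def[abs_def] inner_diff_left)
      qed
      obtain s where s: "0 < s" "s < t" "g t - g 0 = (t - 0) * ((p (x + s *\<^sub>R v + t *\<^sub>R w) - p (x + s *\<^sub>R v)) \<bullet> v)"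
        using MVT2[of 0 t g "\<lambda>s. (p (x + s *\<^sub>R v + t *\<^sub>R w) - p (x + s *\<^sub>R v)) \<bullet> v"] dg t by auto
      let ?a = "p (x + s *\<^sub>R v + t *\<^sub>R w) - p x - H (s *\<^sub>R v + t *\<^sub>R w)"
      let ?b = "p (x + s *\<^sub>R v) - p x - H (s *\<^sub>R v)"
      have "norm ?a \<le> \<epsilon> * norm (s *\<^sub>R v + t *\<^sub>R w)"
        using r(2)[of "x + s *\<^sub>R v + t *\<^sub>R w"] small[of s t] s t by (simp add: algebra_simps)
      also have "\<dots> \<le> \<epsilon> * (t * norm v + t * norm w)"
        using norm_triangle_ineq[of "s *\<^sub>R v" "t *\<^sub>R w"] mult_right_mono[of s t "norm v"] s t \<epsilon>
        by (intro mult_left_mono) auto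
      finally have a: "norm ?a \<le> \<epsilon> * (t * norm v + t * norm w)" .
      have "norm ?b \<le> \<epsilon> * norm (s *\<^sub>R v)"
        using r(2)[of "x + s *\<^sub>R v"] small[of s 0] s t by simp
      also have "\<dots> \<le> \<epsilon> * (t * norm v)"
        using mult_right_mono[of s t "norm v"] s t \<epsilon> by (intro mult_left_mono) auto
      finally have b: "norm ?b \<le> \<epsilon> * (t * norm v)" .
      have "u (x + t *\<^sub>R v + t *\<^sub>R w) - u (x + t *\<^sub>R v) - u (x + t *\<^sub>R w) + u x - t\<^sup>2 * (H w \<bullet> v)
          = t * ((?a - ?b) \<bullet> v)"
        using s(3) by (simp add: g_def H.add H.scaleR inner_diff_left inner_add_left power2_eq_square algebra_simps)
      then have "\<bar>u (x + t *\<^sub>R v + t *\<^sub>R w) - u (x + t *\<^sub>R v) - u (x + t *\<^sub>R w) + u x - t\<^sup>2 * (H w \<bullet> v)\<bar>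
          = t * \<bar>(?a - ?b) \<bullet> v\<bar>"
        using t by (simp add: abs_mult)
      also have "\<dots> \<le> t * ((norm ?a + norm ?b) * norm v)"
      proof (rule mult_left_mono)
        have "\<bar>(?a - ?b) \<bullet> v\<bar> \<le> norm (?a - ?b) * norm v" by (rule Cauchy_Schwarz_ineq2)
        also have "\<dots> \<le> (norm ?a + norm ?b) * norm v"
          by (intro mult_right_mono norm_triangle_ineq4) auto
        finally show "\<bar>(?a - ?b) \<bullet> v\<bar> \<le> (norm ?a + norm ?b) * norm v" .
      qed (use t in auto)
      also have "\<dots> \<le> t * ((\<epsilon> * (t * norm v + t * norm w) + \<epsilon> * (t * norm v)) * norm v)"
        using a b t by (intro mult_left_mono mult_right_mono add_mono) auto
      also have "\<dots> = t\<^sup>2 * (\<epsilon> * (2 * norm v + norm w) * norm v)"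
        by (simp add: power2_eq_square algebra_simps)
      finally show "\<bar>u (x + t *\<^sub>R v + t *\<^sub>R w) - u (x + t *\<^sub>R v) - u (x + t *\<^sub>R w) + u x - t\<^sup>2 * (H w \<bullet> v)\<bar>
        \<le> t\<^sup>2 * (\<epsilon> * (2 * norm v + norm w) * norm v)" .
    qed
  qed
  have bound: "\<bar>H w \<bullet> v - H v \<bullet> w\<bar> \<le> \<epsilon> * ((2 * norm v + norm w) * norm v + (2 * norm w + norm v) * norm w)"
    if \<epsilon>: "0 < \<epsilon>" for \<epsilon>
  proof -
    from approx[OF \<epsilon>, of v w] obtain r1 where r1: "0 < r1" "\<And>t. 0 < t \<Longrightarrow> t < r1 \<Longrightarrow>
      \<bar>u (x + t *\<^sub>R v + t *\<^sub>R w) - u (x + t *\<^sub>R v) - u (x + t *\<^sub>R w) + u x - t\<^sup>2 * (H w \<bullet> v)\<bar>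
        \<le> t\<^sup>2 * (\<epsilon> * (2 * norm v + norm w) * norm v)" by auto
    from approx[OF \<epsilon>, of w v] obtain r2 where r2: "0 < r2" "\<And>t. 0 < t \<Longrightarrow> t < r2 \<Longrightarrow>
      \<bar>u (x + t *\<^sub>R w + t *\<^sub>R v) - u (x + t *\<^sub>R w) - u (x + t *\<^sub>R v) + u x - t\<^sup>2 * (H v \<bullet> w)\<bar>
        \<le> t\<^sup>2 * (\<epsilon> * (2 * norm w + norm v) * norm w)" by auto
    define t where "t = min r1 r2 / 2"
    have t: "0 < t" "t < r1" "t < r2" using r1 r2 by (auto simp: t_def)
    have swap: "u (x + t *\<^sub>R w + t *\<^sub>R v) = u (x + t *\<^sub>R v + t *\<^sub>R w)" by (simp add: algebra_simps)
    have "\<bar>a - b\<bar> \<le> c + c'" if "\<bar>e - a\<bar> \<le> c" "\<bar>e' - b\<bar> \<le> c'" "e = e'" for a b c c' e e' :: real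
      using that by linarith
    from this[OF r1(2)[OF t(1,2)] r2(2)[OF t(1,3)]]
    have "\<bar>t\<^sup>2 * (H w \<bullet> v) - t\<^sup>2 * (H v \<bullet> w)\<bar> \<le>
      t\<^sup>2 * (\<epsilon> * (2 * norm v + norm w) * norm v) + t\<^sup>2 * (\<epsilon> * (2 * norm w + norm v) * norm w)"
      by (simp add: swap)
    also have "t\<^sup>2 * (H w \<bullet> v) - t\<^sup>2 * (H v \<bullet> w) = t\<^sup>2 * (H w \<bullet> v - H v \<bullet> w)" by (simp add: algebra_simps)
    also have "\<bar>t\<^sup>2 * (H w \<bullet> v - H v \<bullet> w)\<bar> = t\<^sup>2 * \<bar>H w \<bullet> v - H v \<bullet> w\<bar>"
      by (simp add: abs_mult)
    also have "t\<^sup>2 * (\<epsilon> * (2 * norm v + norm w) * norm v) + t\<^sup>2 * (\<epsilon> * (2 * norm w + norm v) * norm w)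
      = t\<^sup>2 * (\<epsilon> * ((2 * norm v + norm w) * norm v + (2 * norm w + norm v) * norm w))"
      by (simp add: algebra_simps)
    finally have "t\<^sup>2 * \<bar>H w \<bullet> v - H v \<bullet> w\<bar> \<le>
      t\<^sup>2 * (\<epsilon> * ((2 * norm v + norm w) * norm v + (2 * norm w + norm v) * norm w))" .
    then show ?thesis using t by simp
  qed
  define c where "c = (2 * norm v + norm w) * norm v + (2 * norm w + norm v) * norm w"
  have c: "0 \<le> c" by (simp add: c_def)
  have "\<bar>H w \<bullet> v - H v \<bullet> w\<bar> \<le> 0"
  proof (rule field_le_epsilon)
    fix e :: real assume e: "0 < e"
    have "\<bar>H w \<bullet> v - H v \<bullet> w\<bar> \<le> e / (c + 1) * c"
      using bound[of "e / (c + 1)"] e c unfolding c_def[symmetric] by (simp add: add_nonneg_pos)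
    also have "\<dots> \<le> e" using e c by (simp add: field_simps)
    finally show "\<bar>H w \<bullet> v - H v \<bullet> w\<bar> \<le> 0 + e" by simp
  qed
  then show ?thesis by (simp add: inner_commute)
qed

lemma DERIV_along_line:
  assumes "(u has_derivative (\<lambda>v. p \<bullet> v)) (at (x + s *\<^sub>R \<xi>))"
  shows "((\<lambda>s. u (x + s *\<^sub>R \<xi>)) has_real_derivative p \<bullet> \<xi>) (at s)"
proof -
  have "((\<lambda>s. x + s *\<^sub>R \<xi>) has_derivative (\<lambda>h. h *\<^sub>R \<xi>)) (at s)"
    by (auto intro!: derivative_eq_intros)
  from has_derivative_compose[OF this assms] show ?thesis
    by (simp add: has_field_derivative_def mult_commute_abs)
qed

text \<open>Restricting the doubled functional to the lines \<open>x + s \<xi>\<close> and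
  \<open>y + s \<eta>\<close> leaves a maximum in one variable. Since \<open>x \<noteq> y\<close>,
  the distance \<open>sqrt (q s)\<close> is smooth near \<open>s = 0\<close>; its second derivative
  produces the factor \<open>1 / t\<close>, but only on the part of \<open>\<xi> - \<eta>\<close>
  orthogonal to \<open>e\<close>.\<close>

lemma doubling_critical_point:
  fixes u :: "'a::real_inner \<Rightarrow> real"
  assumes d: "0 < d" and xy: "x \<noteq> y"
    and u: "\<And>z. z \<in> ball x d \<union> ball y d \<Longrightarrow> (u has_derivative (\<lambda>v. p z \<bullet> v)) (at z)"
    and px: "(p has_derivative Hx) (at x)" and py: "(p has_derivative Hy) (at y)"
    and max: "\<And>x' y'. x' \<in> ball x d \<Longrightarrow> y' \<in> ball y d \<Longrightarrow>
      u x' - u y' - L * norm (x' - y') + a * (norm (x' - y'))\<^sup>2 - k * (norm (x' - y0))\<^sup>2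
      \<le> u x - u y - L * norm (x - y) + a * (norm (x - y))\<^sup>2 - k * (norm (x - y0))\<^sup>2"
  defines "t \<equiv> norm (x - y)"
  defines "e \<equiv> (1 / t) *\<^sub>R (x - y)"
  shows "p x \<bullet> \<xi> - p y \<bullet> \<eta> = (L - 2 * a * t) * (e \<bullet> (\<xi> - \<eta>)) + 2 * k * ((x - y0) \<bullet> \<xi>)"
    and "\<xi> \<bullet> Hx \<xi> - \<eta> \<bullet> Hy \<eta> \<le>
      L * ((\<xi> - \<eta>) \<bullet> (\<xi> - \<eta>) - (e \<bullet> (\<xi> - \<eta>))\<^sup>2) / t - 2 * a * ((\<xi> - \<eta>) \<bullet> (\<xi> - \<eta>)) + 2 * k * (\<xi> \<bullet> \<xi>)"
proof -
  define \<delta> where "\<delta> = \<xi> - \<eta>"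
  define z where "z = x - y"
  have t: "0 < t" "z \<bullet> z = t * t" using xy by (auto simp: t_def z_def dot_square_norm power2_eq_square)
  define q where "q s = z \<bullet> z + 2 * s * (z \<bullet> \<delta>) + s\<^sup>2 * (\<delta> \<bullet> \<delta>)" for s :: real
  have q: "q s = (norm ((x + s *\<^sub>R \<xi>) - (y + s *\<^sub>R \<eta>)))\<^sup>2" for s
  proof -
    have "(x + s *\<^sub>R \<xi>) - (y + s *\<^sub>R \<eta>) = z + s *\<^sub>R \<delta>" by (simp add: z_def \<delta>_def algebra_simps)
    then show ?thesis unfolding power2_norm_eq_inner q_def
      by (simp add: inner_add_left inner_add_right inner_commute power2_eq_square algebra_simps)
  qed
  define m where "m = 1 + norm \<xi> + norm \<eta>"
  have m: "0 < m" "norm \<xi> < m" "norm \<eta> < m"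
    using norm_ge_zero[of \<xi>] norm_ge_zero[of \<eta>] unfolding m_def by linarith+
  \<comment> \<open>The first bound keeps both lines inside the balls of radius \<open>d\<close>,
    the second keeps the two moving points apart.\<close>
  define r where "r = min (d / m) (t / (2 * m))"
  have r: "0 < r" using d t m by (simp add: r_def)
  have rm: "s * norm \<xi> < d \<and> s * norm \<eta> < d \<and> s * (norm \<xi> + norm \<eta>) < t" if "0 \<le> s" "s < r" for s
  proof -
    have "s * m < d" "s * (2 * m) < t"
      using that m by (auto simp: r_def field_simps)
    moreover have "s * norm \<xi> \<le> s * m" "s * norm \<eta> \<le> s * m"
      using that m by (auto intro: mult_left_mono)
    moreover have "s * (norm \<xi> + norm \<eta>) \<le> s * (2 * m)"
      using that m by (intro mult_left_mono) auto
    ultimately show ?thesis by linarith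
  qed
  have near: "x + s *\<^sub>R \<xi> \<in> ball x d" "y + s *\<^sub>R \<eta> \<in> ball y d" "0 < q s" if "\<bar>s\<bar> < r" for s
  proof -
    show "x + s *\<^sub>R \<xi> \<in> ball x d" "y + s *\<^sub>R \<eta> \<in> ball y d"
      using rm[of "\<bar>s\<bar>"] that by (auto simp: dist_norm)
    have "t = norm (x - y)" by (simp add: t_def)
    also have "\<dots> \<le> norm ((x + s *\<^sub>R \<xi>) - (y + s *\<^sub>R \<eta>)) + norm (s *\<^sub>R \<xi> - s *\<^sub>R \<eta>)"
      using norm_triangle_ineq4[of "(x + s *\<^sub>R \<xi>) - (y + s *\<^sub>R \<eta>)" "s *\<^sub>R \<xi> - s *\<^sub>R \<eta>"]
      by (simp add: algebra_simps)
    also have "norm (s *\<^sub>R \<xi> - s *\<^sub>R \<eta>) \<le> \<bar>s\<bar> * (norm \<xi> + norm \<eta>)"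
      using norm_triangle_ineq4[of "s *\<^sub>R \<xi>" "s *\<^sub>R \<eta>"] by (simp add: algebra_simps)
    finally have "0 < norm ((x + s *\<^sub>R \<xi>) - (y + s *\<^sub>R \<eta>))"
      using rm[of "\<bar>s\<bar>"] that by linarith
    then show "0 < q s" by (simp add: q)
  qed
  define h where "h s = u (x + s *\<^sub>R \<xi>) - u (y + s *\<^sub>R \<eta>) - L * sqrt (q s) + a * q s
      - k * (norm (x + s *\<^sub>R \<xi> - y0))\<^sup>2" for s
  define w where "w = x - y0"
  have wq: "(norm (x + s *\<^sub>R \<xi> - y0))\<^sup>2 = w \<bullet> w + 2 * s * (w \<bullet> \<xi>) + s\<^sup>2 * (\<xi> \<bullet> \<xi>)" for s
  proof -
    have "x + s *\<^sub>R \<xi> - y0 = w + s *\<^sub>R \<xi>" by (simp add: w_def)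
    then show ?thesis unfolding power2_norm_eq_inner
      by (simp add: inner_add_left inner_add_right inner_commute power2_eq_square algebra_simps)
  qed
  define h' where "h' s = p (x + s *\<^sub>R \<xi>) \<bullet> \<xi> - p (y + s *\<^sub>R \<eta>) \<bullet> \<eta>
      - L * ((z \<bullet> \<delta> + s * (\<delta> \<bullet> \<delta>)) / sqrt (q s)) + 2 * a * (z \<bullet> \<delta> + s * (\<delta> \<bullet> \<delta>))
      - 2 * k * (w \<bullet> \<xi> + s * (\<xi> \<bullet> \<xi>))" for s
  have dq: "(q has_real_derivative 2 * (z \<bullet> \<delta> + s * (\<delta> \<bullet> \<delta>))) (at s)" for s
    unfolding q_def[abs_def] by (auto intro!: derivative_eq_intros simp: algebra_simps)
  have dh: "(h has_real_derivative h' s) (at s)" if "\<bar>s\<bar> < r" for s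
  proof -
    have 1: "((\<lambda>s. u (x + s *\<^sub>R \<xi>)) has_real_derivative p (x + s *\<^sub>R \<xi>) \<bullet> \<xi>) (at s)"
      "((\<lambda>s. u (y + s *\<^sub>R \<eta>)) has_real_derivative p (y + s *\<^sub>R \<eta>) \<bullet> \<eta>) (at s)"
      by (rule DERIV_along_line, rule u, use near(1,2)[OF that] in blast)+
    have 2: "((\<lambda>s. sqrt (q s)) has_real_derivative (z \<bullet> \<delta> + s * (\<delta> \<bullet> \<delta>)) / sqrt (q s)) (at s)"
      by (rule DERIV_cong[OF DERIV_chain2[OF DERIV_real_sqrt[OF near(3)[OF that]] dq]])
        (use near(3)[OF that] in \<open>simp add: field_simps\<close>)
    have 3: "((\<lambda>s. w \<bullet> w + 2 * s * (w \<bullet> \<xi>) + s\<^sup>2 * (\<xi> \<bullet> \<xi>)) has_real_derivative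
        2 * (w \<bullet> \<xi> + s * (\<xi> \<bullet> \<xi>))) (at s)"
      by (auto intro!: derivative_eq_intros simp: algebra_simps)
    show ?thesis
      unfolding h_def[abs_def] h'_def wq
      by (rule DERIV_cong[OF DERIV_diff[OF DERIV_add[OF DERIV_diff[OF DERIV_diff[OF 1(1) 1(2)]
              DERIV_cmult[OF 2]] DERIV_cmult[OF dq]] DERIV_cmult[OF 3]]]) (simp add: algebra_simps)
  qed
  have q0: "q 0 = t * t" "sqrt (q 0) = t" using t by (simp_all add: q_def)
  have dh': "(h' has_real_derivative Hx \<xi> \<bullet> \<xi> - Hy \<eta> \<bullet> \<eta>
      - L * ((\<delta> \<bullet> \<delta>) / t - (z \<bullet> \<delta>)\<^sup>2 / t ^ 3) + 2 * a * (\<delta> \<bullet> \<delta>) - 2 * k * (\<xi> \<bullet> \<xi>)) (at 0)"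
  proof -
    have line: "((\<lambda>s. p (b + s *\<^sub>R \<zeta>) \<bullet> \<zeta>) has_real_derivative H \<zeta> \<bullet> \<zeta>) (at 0)"
      if "(p has_derivative H) (at b)" for b H \<zeta>
    proof -
      interpret H: bounded_linear H using that by (rule has_derivative_bounded_linear)
      have "((\<lambda>s. b + s *\<^sub>R \<zeta>) has_derivative (\<lambda>h. h *\<^sub>R \<zeta>)) (at 0)"
        by (auto intro!: derivative_eq_intros)
      then have "((\<lambda>s. p (b + s *\<^sub>R \<zeta>)) has_derivative (\<lambda>h. H (h *\<^sub>R \<zeta>))) (at 0)"
        by (rule has_derivative_compose) (simp add: that)
      from has_derivative_inner_left[OF this, of \<zeta>] show ?thesis
        by (simp add: has_field_derivative_def H.scaleR mult_commute_abs)
    qed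
    have 2: "((\<lambda>s. sqrt (q s)) has_real_derivative (z \<bullet> \<delta>) / t) (at 0)"
      by (rule DERIV_cong[OF DERIV_chain2[OF DERIV_real_sqrt[OF near(3)] dq]])
        (use r t q0 in \<open>auto simp: field_simps\<close>)
    have 4: "((\<lambda>s. c + s * b) has_real_derivative b) (at 0)" for b c :: real
      by (auto intro!: derivative_eq_intros)
    have 3: "((\<lambda>s. (z \<bullet> \<delta> + s * (\<delta> \<bullet> \<delta>)) / sqrt (q s)) has_real_derivative
        (\<delta> \<bullet> \<delta>) / t - (z \<bullet> \<delta>)\<^sup>2 / t ^ 3) (at 0)"
      by (rule DERIV_cong[OF DERIV_divide[OF 4 2]])
        (use t in \<open>simp_all add: q0 power2_eq_square power3_eq_cube field_simps\<close>)
    show ?thesis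
      unfolding h'_def[abs_def]
      by (rule DERIV_cong[OF DERIV_diff[OF DERIV_add[OF DERIV_diff[OF DERIV_diff[OF line[OF px] line[OF py]]
              DERIV_cmult[OF 3]] DERIV_cmult[OF 4]] DERIV_cmult[OF 4]]]) simp
  qed
  have hmax: "h s \<le> h 0" if "\<bar>s\<bar> < r" for s
  proof -
    have "h s = u (x + s *\<^sub>R \<xi>) - u (y + s *\<^sub>R \<eta>) - L * norm ((x + s *\<^sub>R \<xi>) - (y + s *\<^sub>R \<eta>))
      + a * (norm ((x + s *\<^sub>R \<xi>) - (y + s *\<^sub>R \<eta>)))\<^sup>2 - k * (norm (x + s *\<^sub>R \<xi> - y0))\<^sup>2" for s
      by (simp add: h_def q)
    then show ?thesis using max[OF near(1,2)[OF that]] by simp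
  qed
  note crit = second_derivative_at_local_max[OF r dh dh' hmax]
  have ze: "z = t *\<^sub>R e" using t by (simp add: e_def z_def)
  have zd: "z \<bullet> \<delta> = t * (e \<bullet> \<delta>)" by (simp add: ze)
  from crit(1) show "p x \<bullet> \<xi> - p y \<bullet> \<eta> = (L - 2 * a * t) * (e \<bullet> (\<xi> - \<eta>)) + 2 * k * ((x - y0) \<bullet> \<xi>)"
    using t by (simp add: h'_def q0 zd \<delta>_def[symmetric] w_def[symmetric] algebra_simps)
  have "(\<delta> \<bullet> \<delta>) / t - (z \<bullet> \<delta>)\<^sup>2 / t ^ 3 = (\<delta> \<bullet> \<delta> - (e \<bullet> \<delta>)\<^sup>2) / t"
    using t by (simp add: zd power2_eq_square power3_eq_cube field_simps)
  with crit(2) show "\<xi> \<bullet> Hx \<xi> - \<eta> \<bullet> Hy \<eta> \<le>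
      L * ((\<xi> - \<eta>) \<bullet> (\<xi> - \<eta>) - (e \<bullet> (\<xi> - \<eta>))\<^sup>2) / t - 2 * a * ((\<xi> - \<eta>) \<bullet> (\<xi> - \<eta>)) + 2 * k * (\<xi> \<bullet> \<xi>)"
    by (simp add: \<delta>_def[symmetric] inner_commute)
qed

text \<open>The functional is maximised over the compact set \<open>S\<close>, and the constants are
  arranged so that none of the constraints defining \<open>S\<close> is active at the maximum. The
  pair is then a local maximum in all directions, and the critical point conditions apply.\<close>

lemma doubling_contact:
  fixes u :: "'a::euclidean_space \<Rightarrow> real"
  assumes \<rho>: "0 < \<rho>" and K: "0 < K" and L: "64 * K / \<rho> \<le> L"
    and u: "\<And>z. z \<in> ball y0 \<rho> \<Longrightarrow> (u has_derivative (\<lambda>v. p z \<bullet> v)) (at z)"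
    and p: "\<And>z. z \<in> ball y0 \<rho> \<Longrightarrow> (p has_derivative H z) (at z)"
    and bd: "\<And>z. z \<in> ball y0 \<rho> \<Longrightarrow> \<bar>u z\<bar> \<le> K"
    and big: "L < norm (p y0)"
  obtains x y e t where "x \<in> ball y0 \<rho>" "y \<in> ball y0 \<rho>" "0 < t" "t \<le> 3 * K / L"
    "x - y = t *\<^sub>R e" "e \<bullet> e = 1"
    "L / 4 \<le> norm (p x)" "norm (p x) \<le> 2 * L" "L / 4 \<le> norm (p y)" "norm (p y) \<le> 2 * L"
    "\<And>\<xi> \<eta>. \<xi> \<bullet> H x \<xi> - \<eta> \<bullet> H y \<eta> \<le>
      L * ((\<xi> - \<eta>) \<bullet> (\<xi> - \<eta>) - (e \<bullet> (\<xi> - \<eta>))\<^sup>2) / t - L\<^sup>2 / (6 * K) * ((\<xi> - \<eta>) \<bullet> (\<xi> - \<eta>))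
      + 64 * K / \<rho>\<^sup>2 * (\<xi> \<bullet> \<xi>)"
proof -
  have L0: "0 < L" using \<rho> K L by (smt (verit) divide_pos_pos)
  define a where "a = L\<^sup>2 / (12 * K)"
  define k where "k = 32 * K / \<rho>\<^sup>2"
  define b where "b = 3 * K / L"
  have a0: "0 < a" and k0: "0 < k" and b0: "0 < b" using L0 K \<rho> by (auto simp: a_def k_def b_def)
  have ab: "a * b = L / 4" using L0 K by (simp add: a_def b_def power2_eq_square field_simps)
  have b\<rho>: "b \<le> 3 * \<rho> / 64"
    using L L0 K \<rho> by (simp add: b_def field_simps)
  define \<Phi> where "\<Phi> x y = u x - u y - L * norm (x - y) + a * (norm (x - y))\<^sup>2 - k * (norm (x - y0))\<^sup>2" for x y
  define S where "S = (cball y0 (\<rho> / 2) \<times> cball y0 (\<rho> / 2)) \<inter> {z. norm (fst z - snd z) \<le> b}"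
  have "closed {z :: 'a \<times> 'a. norm (fst z - snd z) \<le> b}"
    by (intro closed_Collect_le continuous_intros)
  then have "compact S" unfolding S_def by (intro compact_Int_closed compact_Times compact_cball)
  have contu: "continuous_on (ball y0 \<rho>) u"
    using u by (intro has_derivative_continuous_on) (auto intro: has_derivative_at_withinI)
  have sub: "x \<in> ball y0 \<rho>" "y \<in> ball y0 \<rho>" if "(x, y) \<in> S" for x y
    using that \<rho> by (auto simp: S_def)
  have "continuous_on S (\<lambda>z. \<Phi> (fst z) (snd z))"
    unfolding \<Phi>_def
    by (intro continuous_intros continuous_on_compose2[OF contu]) (use sub in force)+
  moreover have "(y0, y0) \<in> S" using \<rho> b0 by (simp add: S_def)
  ultimately obtain z where z: "z \<in> S" "\<And>z'. z' \<in> S \<Longrightarrow> \<Phi> (fst z') (snd z') \<le> \<Phi> (fst z) (snd z)"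
    using continuous_attains_sup[OF \<open>compact S\<close>] by blast
  define x y where "x = fst z" and "y = snd z"
  have xyS: "(x, y) \<in> S" using z by (simp add: x_def y_def)
  have max: "\<Phi> x' y' \<le> \<Phi> x y" if "(x', y') \<in> S" for x' y'
    using z(2)[OF that] by (simp add: x_def y_def)
  have pos: "0 < \<Phi> x y"
  proof (rule ccontr)
    assume "\<not> 0 < \<Phi> x y"
    then have np: "\<Phi> x' y' \<le> 0" if "(x', y') \<in> S" for x' y' using max[OF that] by simp
    \<comment> \<open>The direction of steepest descent at \<open>y0\<close>. As the slope
      \<open>norm (p y0)\<close> exceeds \<open>L\<close>, the pair \<open>(y0, y0 + s w)\<close>
      has a positive value for small \<open>s\<close>; the penalty vanishes at \<open>y0\<close> and
      the quadratic term only helps.\<close>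
    define w where "w = (- 1 / norm (p y0)) *\<^sub>R p y0"
    have nz: "norm (p y0) > 0" using big L0 by linarith
    have w: "norm w = 1" "p y0 \<bullet> w = - norm (p y0)"
      using nz by (simp_all add: w_def dot_square_norm power2_eq_square)
    define h where "h s = u y0 - u (y0 + s *\<^sub>R w) - L * s" for s
    have "((\<lambda>s. u (y0 + s *\<^sub>R w)) has_real_derivative p y0 \<bullet> w) (at 0)"
      using DERIV_along_line[of u "p y0" y0 0 w] u[of y0] \<rho> by simp
    then have "(h has_real_derivative norm (p y0) - L) (at 0)"
      unfolding h_def[abs_def] by (auto intro!: derivative_eq_intros simp: w)
    from DERIV_pos_inc_right[OF this] big
    obtain d where d: "0 < d" "\<And>s. 0 < s \<Longrightarrow> s < d \<Longrightarrow> h 0 < h s" by auto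
    define s where "s = min d (min b (\<rho> / 2)) / 2"
    have s: "0 < s" "s < d" "s \<le> b" "s \<le> \<rho> / 2" using d b0 \<rho> by (auto simp: s_def)
    have "\<Phi> y0 (y0 + s *\<^sub>R w) \<le> 0"
      by (rule np) (use s w \<rho> in \<open>auto simp: S_def dist_norm\<close>)
    moreover have "\<Phi> y0 (y0 + s *\<^sub>R w) = h s + a * s\<^sup>2" using s w by (simp add: \<Phi>_def h_def)
    moreover have "0 \<le> a * s\<^sup>2" using a0 by simp
    ultimately have "h s \<le> 0" by linarith
    moreover have "0 < h s" using d(2)[of s] s by (simp add: h_def)
    ultimately show False by simp
  qed
  define t where "t = norm (x - y)"
  have tb: "0 \<le> t" "t \<le> b" using xyS by (simp_all add: t_def S_def)
  have xb: "x \<in> ball y0 \<rho>" and yb: "y \<in> ball y0 \<rho>" using sub[OF xyS] .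
  have u2: "u x - u y \<le> 2 * K" using bd[OF xb] bd[OF yb] by linarith
  have \<Phi>t: "\<Phi> x y = u x - u y - L * t + a * t\<^sup>2 - k * (norm (x - y0))\<^sup>2" by (simp add: \<Phi>_def t_def)
  have at: "a * t\<^sup>2 \<le> L / 4 * t"
  proof -
    have "a * t\<^sup>2 \<le> a * (b * t)" using a0 tb by (intro mult_left_mono) (auto simp: power2_eq_square mult_right_mono)
    also have "\<dots> = L / 4 * t" by (simp only: mult.assoc[symmetric] ab)
    finally show ?thesis .
  qed
  have "x \<noteq> y"
  proof
    assume "x = y"
    then have "\<Phi> x y \<le> 0" using k0 by (simp add: \<Phi>_def)
    then show False using pos by simp
  qed
  then have t0: "0 < t" by (simp add: t_def)
  \<comment> \<open>At \<open>t = b\<close> the sum \<open>- L t + a t\<^sup>2\<close> is at most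
    \<open>- 9 K / 4\<close>, which a difference of values of \<open>u\<close> of at most
    \<open>2 K\<close> cannot compensate.\<close>
  have "t < b"
  proof (rule ccontr)
    assume "\<not> t < b"
    then have "t = b" using tb by simp
    then have "L * t = 3 * K" using L0 by (simp add: b_def)
    moreover have "0 \<le> k * (norm (x - y0))\<^sup>2" using k0 by simp
    ultimately show False using pos \<Phi>t at u2 K by simp
  qed
  have xr: "norm (x - y0) < \<rho> / 4"
  proof (rule ccontr)
    assume "\<not> norm (x - y0) < \<rho> / 4"
    then have "(\<rho> / 4)\<^sup>2 \<le> (norm (x - y0))\<^sup>2" using \<rho> by (intro power_mono) auto
    then have "k * (\<rho> / 4)\<^sup>2 \<le> k * (norm (x - y0))\<^sup>2" using k0 by (intro mult_left_mono) auto
    moreover have "k * (\<rho> / 4)\<^sup>2 = 2 * K" using \<rho> by (simp add: k_def power2_eq_square)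
    moreover have "0 \<le> L * t" using L0 t0 by simp
    ultimately show False using pos \<Phi>t at u2 by simp
  qed
  have yr: "norm (y - y0) < \<rho> / 2"
    using norm_triangle_ineq4[of "x - y0" "x - y"] xr \<open>t < b\<close> b\<rho> \<rho> by (simp add: t_def)
  \<comment> \<open>The room left in the three constraints of \<open>S\<close>. The gap
    \<open>b - t\<close> is halved because both points may move.\<close>
  define d where "d = min (\<rho> / 4) (min (\<rho> / 2 - norm (y - y0)) ((b - t) / 2))"
  have d: "0 < d" "d \<le> \<rho> / 4" "d \<le> \<rho> / 2 - norm (y - y0)" "d \<le> (b - t) / 2"
    using \<rho> yr \<open>t < b\<close> by (auto simp: d_def min_def)
  have inS: "(x', y') \<in> S" if "x' \<in> ball x d" "y' \<in> ball y d" for x' y'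
  proof -
    have "norm (x' - x) < d" "norm (y' - y) < d" using that by (simp_all add: dist_norm norm_minus_commute)
    moreover have "norm (x' - y0) \<le> norm (x' - x) + norm (x - y0)"
      using norm_triangle_ineq[of "x' - x" "x - y0"] by simp
    moreover have "norm (y' - y0) \<le> norm (y' - y) + norm (y - y0)"
      using norm_triangle_ineq[of "y' - y" "y - y0"] by simp
    moreover have "norm (x' - y') \<le> norm (x' - x) + t + norm (y' - y)"
      using norm_triangle_ineq[of "x' - x" "(x - y) - (y' - y)"] norm_triangle_ineq4[of "x - y" "y' - y"]
      by (simp add: t_def)
    ultimately have "norm (x' - y0) \<le> \<rho> / 2 \<and> norm (y' - y0) \<le> \<rho> / 2 \<and> norm (x' - y') \<le> b"
      using d xr by argo
    then show ?thesis by (simp add: S_def dist_norm norm_minus_commute)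
  qed
  have uu: "(u has_derivative (\<lambda>v. p z \<bullet> v)) (at z)" if "z \<in> ball x d \<union> ball y d" for z
  proof (rule u)
    have "x \<in> ball x d" "y \<in> ball y d" using d(1) by simp_all
    then have "(z, y) \<in> S \<or> (x, z) \<in> S" using that inS by blast
    then show "z \<in> ball y0 \<rho>" using sub by blast
  qed
  have mm: "u x' - u y' - L * norm (x' - y') + a * (norm (x' - y'))\<^sup>2 - k * (norm (x' - y0))\<^sup>2
      \<le> u x - u y - L * norm (x - y) + a * (norm (x - y))\<^sup>2 - k * (norm (x - y0))\<^sup>2"
    if "x' \<in> ball x d" "y' \<in> ball y d" for x' y'
    using max[OF inS[OF that]] by (simp only: \<Phi>_def)
  note crit = doubling_critical_point[OF d(1) \<open>x \<noteq> y\<close> uu p[OF xb] p[OF yb] mm, folded t_def]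
  define e where "e = (1 / t) *\<^sub>R (x - y)"
  have xye: "x - y = t *\<^sub>R e" and ee: "e \<bullet> e = 1"
    using t0 \<open>x \<noteq> y\<close> by (auto simp: e_def t_def dot_square_norm power2_eq_square)
  then have ne: "norm e = 1" by (simp add: norm_eq_1)
  \<comment> \<open>Slope of the profile at \<open>t\<close>. Varying \<open>y\<close> alone gives
    \<open>p y = c e\<close> exactly, since the penalty involves only \<open>x\<close>; varying
    \<open>x\<close> alone adds the gradient of the penalty, of norm at most
    \<open>L / 4\<close>.\<close>
  define c where "c = L - 2 * a * t"
  have c: "L / 2 \<le> c" "c \<le> L"
    using mult_left_mono[OF tb(2), of a] a0 t0 ab by (auto simp: c_def)
  have "p x \<bullet> \<xi> = (c *\<^sub>R e + (2 * k) *\<^sub>R (x - y0)) \<bullet> \<xi>" for \<xi>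
    using crit(1)[of \<xi> 0] by (simp add: c_def e_def inner_add_left)
  then have px: "p x = c *\<^sub>R e + (2 * k) *\<^sub>R (x - y0)" by (metis vector_eq_rdot)
  have "p y \<bullet> \<eta> = (c *\<^sub>R e) \<bullet> \<eta>" for \<eta>
    using crit(1)[of 0 \<eta>] by (simp add: c_def e_def)
  then have py: "p y = c *\<^sub>R e" by (metis vector_eq_rdot)
  have small: "norm ((2 * k) *\<^sub>R (x - y0)) \<le> L / 4"
  proof -
    have "norm ((2 * k) *\<^sub>R (x - y0)) \<le> 2 * k * (\<rho> / 4)" using k0 xr by simp
    also have "\<dots> = (64 * K / \<rho>) / 4" using \<rho> by (simp add: k_def power2_eq_square)
    also have "\<dots> \<le> L / 4" using L by simp
    finally show ?thesis .
  qed
  have nce: "norm (c *\<^sub>R e) = c" using ne c L0 by simp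
  have "norm (p x) \<le> c + L / 4"
    using norm_triangle_ineq[of "c *\<^sub>R e" "(2 * k) *\<^sub>R (x - y0)"] nce small by (simp add: px)
  moreover have "c - L / 4 \<le> norm (p x)"
    using norm_diff_ineq[of "c *\<^sub>R e" "(2 * k) *\<^sub>R (x - y0)"] nce small by (simp only: px)
  moreover have "norm (p y) = c" by (simp only: py nce)
  moreover have "2 * a = L\<^sup>2 / (6 * K)" "2 * k = 64 * K / \<rho>\<^sup>2" by (simp_all add: a_def k_def)
  ultimately show ?thesis
    using that[OF xb yb t0 _ xye ee] tb(2) c crit(2)[folded e_def] L0 by (simp add: b_def)
qed

section \<open>Interior estimate in a coordinate ball\<close>

lemma frame_iff:
  fixes V G :: "real ^ 'n::finite ^ 'n"
  shows "transpose V ** G ** V = mat 1 \<longleftrightarrow> (\<forall>x y. (V *v x) \<bullet> (G *v (V *v y)) = x \<bullet> y)"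
proof -
  have form: "(V *v x) \<bullet> (G *v (V *v y)) = x \<bullet> ((transpose V ** G ** V) *v y)" for x y
    by (simp only: matrix_vector_mul_assoc[symmetric] dot_lmul_matrix[symmetric] vector_transpose_matrix)
  show ?thesis unfolding form
  proof
    assume *: "\<forall>x y. x \<bullet> ((transpose V ** G ** V) *v y) = x \<bullet> y"
    have "(transpose V ** G ** V) *v y = mat 1 *v y" for y
      using * by (metis matrix_vector_mul_lid vector_eq_ldot)
    then show "transpose V ** G ** V = mat 1" by (simp add: matrix_eq)
  qed simp
qed

text \<open>Only diagonal terms survive in the double sum. With all \<open>d i = 1\<close> this says
  that the vectors \<open>v\<close> form a \<open>G\<close>-orthonormal frame; general
  \<open>d\<close> covers a second form that is merely diagonal in the same frame.\<close>

lemma orthonormal_form_imp_frame: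
  fixes v :: "'n::finite \<Rightarrow> real ^ 'n" and G :: "real ^ 'n ^ 'n"
  assumes "\<And>i j. v i \<bullet> (G *v v j) = (if i = j then d j else 0)"
  shows "(\<Sum>i\<in>UNIV. x $ i *\<^sub>R v i) \<bullet> (G *v (\<Sum>j\<in>UNIV. y $ j *\<^sub>R v j)) = (\<Sum>i\<in>UNIV. d i * x $ i * y $ i)"
proof -
  have "G *v (\<Sum>j\<in>UNIV. y $ j *\<^sub>R v j) = (\<Sum>j\<in>UNIV. y $ j *\<^sub>R (G *v v j))"
    by (simp add: linear_sum[OF matrix_vector_mul_linear] matrix_vector_mult_scaleR)
  then have "(\<Sum>i\<in>UNIV. x $ i *\<^sub>R v i) \<bullet> (G *v (\<Sum>j\<in>UNIV. y $ j *\<^sub>R v j))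
      = (\<Sum>i\<in>UNIV. \<Sum>j\<in>UNIV. x $ i * (y $ j * (v i \<bullet> (G *v v j))))"
    by (simp add: inner_sum_left inner_sum_right sum_distrib_left mult_ac) (rule sum.swap)
  also have "\<dots> = (\<Sum>i\<in>UNIV. \<Sum>j\<in>UNIV. if i = j then d i * x $ i * y $ i else 0)"
    by (intro sum.cong) (auto simp: assms)
  finally show ?thesis by simp
qed

text \<open>Diagonalise \<open>G\<close> and \<open>H\<close> simultaneously: a
  \<open>G\<close>-orthonormal frame \<open>v\<close> that is also \<open>H\<close>-orthogonal
  becomes \<open>H\<close>-orthonormal after scaling each vector by \<open>1 / sqrt (d k)\<close>.
  The two frames thus differ by a diagonal scaling alone. Since \<open>d k\<close> is within
  \<open>m\<^sup>2 t\<close> of 1 and \<open>d k \<ge> 1 / m\<^sup>2\<close>, the scaling is within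
  \<open>m\<^sup>3 t\<close> of 1; the last factor \<open>m\<close> bounds \<open>V\<close>.\<close>

lemma exists_close_frames:
  fixes G H :: "real ^ 'n::finite ^ 'n"
  assumes G: "transpose G = G" "\<And>x. x \<bullet> x \<le> m * (x \<bullet> (G *v x))" "\<And>x. x \<bullet> (G *v x) \<le> m * (x \<bullet> x)"
    and H: "transpose H = H" "\<And>x. x \<bullet> x \<le> m * (x \<bullet> (H *v x))"
    and GH: "\<And>x. \<bar>x \<bullet> (H *v x) - x \<bullet> (G *v x)\<bar> \<le> m * t * (x \<bullet> x)"
    and m: "1 \<le> m" and t: "0 \<le> t"
  obtains V W :: "real ^ 'n ^ 'n" where "transpose V ** G ** V = mat 1" "transpose W ** H ** W = mat 1"
    "\<And>x. norm (V *v x - W *v x) \<le> m ^ 4 * t * norm x"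
proof -
  have symG: "(G *v x) \<bullet> y = x \<bullet> (G *v y)" and symH: "(H *v x) \<bullet> y = x \<bullet> (H *v y)" for x y
    by (rule linear_matrix_symmetric, fact)+
  obtain b l where b: "orthonormal_family b" "\<And>k. G *v b k = l k *\<^sub>R b k"
    using symmetric_orthonormal_eigenbasis[OF matrix_vector_mul_linear symG] by blast
  have bb: "b i \<bullet> b j = (if i = j then 1 else 0)" for i j using b(1) by (simp add: orthonormal_family_def)
  have l: "0 < l k" for k
  proof -
    have "1 \<le> m * l k" using G(2)[of "b k"] b(2)[of k] bb[of k k] by simp
    then show ?thesis using m by (metis less_le_trans zero_less_mult_pos zero_less_one)
  qed
  define v0 where "v0 k = (1 / sqrt (l k)) *\<^sub>R b k" for k
  have v0: "v0 i \<bullet> (G *v v0 j) = (if i = j then 1 else 0)" for i j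
    using l[of i] l[of j] by (auto simp: v0_def matrix_vector_mult_scaleR b(2) bb)
  define V0 where "V0 = (\<chi> i j. v0 j $ i)"
  have V0: "V0 *v x = (\<Sum>i\<in>UNIV. x $ i *\<^sub>R v0 i)" for x
    by (simp add: V0_def matrix_vector_mult_def vec_eq_iff mult.commute)
  have V0G: "(V0 *v x) \<bullet> (G *v (V0 *v y)) = x \<bullet> y" for x y
    unfolding V0 orthonormal_form_imp_frame[OF v0] by (simp add: inner_vec_def)
  \<comment> \<open>The form of \<open>H\<close> in a first \<open>G\<close>-orthonormal frame.
    Rotating that frame by an eigenbasis of \<open>?M\<close> keeps it \<open>G\<close>-orthonormal
    and makes it \<open>H\<close>-orthogonal.\<close>
  let ?M = "transpose V0 ** H ** V0"
  have M: "x \<bullet> (?M *v y) = (V0 *v x) \<bullet> (H *v (V0 *v y))" for x y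
    by (simp only: matrix_vector_mul_assoc[symmetric] dot_lmul_matrix[symmetric] vector_transpose_matrix)
  have "transpose ?M = ?M" by (simp add: matrix_transpose_mul H(1) matrix_mul_assoc)
  then have symM: "(?M *v x) \<bullet> y = x \<bullet> (?M *v y)" for x y by (rule linear_matrix_symmetric)
  obtain c d where c: "orthonormal_family c" "\<And>k. ?M *v c k = d k *\<^sub>R c k"
    using symmetric_orthonormal_eigenbasis[OF matrix_vector_mul_linear symM] by blast
  have cc: "c i \<bullet> c j = (if i = j then 1 else 0)" for i j using c(1) by (simp add: orthonormal_family_def)
  define v where "v k = V0 *v c k" for k
  have vG: "v i \<bullet> (G *v v j) = (if i = j then 1 else 0)" for i j
    by (simp add: v_def V0G cc)
  have vH: "v i \<bullet> (H *v v j) = (if i = j then d j else 0)" for i j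
    by (simp add: v_def M[symmetric] c(2) cc)
  have vv: "v k \<bullet> v k \<le> m" "1 \<le> m * (v k \<bullet> v k)" for k
    using G(2)[of "v k"] G(3)[of "v k"] vG[of k k] by simp_all
  have d1: "1 \<le> m\<^sup>2 * d k" for k
  proof -
    have "1 \<le> m * (v k \<bullet> v k)" by (rule vv)
    also have "\<dots> \<le> m * (m * d k)" using H(2)[of "v k"] vH[of k k] m by (intro mult_left_mono) auto
    finally show ?thesis by (simp add: power2_eq_square mult.assoc)
  qed
  have d0: "0 < d k" for k
    using d1[of k] m by (metis less_le_trans power_one_right zero_less_mult_pos zero_less_one zero_less_power)
  have d2: "\<bar>d k - 1\<bar> \<le> m\<^sup>2 * t" for k
  proof -
    have "\<bar>d k - 1\<bar> \<le> m * t * (v k \<bullet> v k)" using GH[of "v k"] vG[of k k] vH[of k k] by simp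
    also have "\<dots> \<le> m * t * m" using vv m t by (intro mult_left_mono) auto
    finally show ?thesis by (simp add: power2_eq_square mult_ac)
  qed
  define s where "s k = 1 / sqrt (d k)" for k
  have s: "\<bar>1 - s k\<bar> \<le> m ^ 3 * t" for k
  proof -
    have sd: "0 < sqrt (d k)" using d0 by simp
    have "1 \<le> (m * sqrt (d k))\<^sup>2" using d1[of k] d0[of k] by (simp add: power_mult_distrib)
    then have ms: "1 \<le> m * sqrt (d k)" 
      using m sd power2_le_imp_le[of 1 "m * sqrt (d k)"] by simp
    have "\<bar>d k - 1\<bar> = \<bar>sqrt (d k) - 1\<bar> * (sqrt (d k) + 1)"
    proof -
      have "d k - 1 = (sqrt (d k) - 1) * (sqrt (d k) + 1)"
        using d0[of k] by (simp add: algebra_simps)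
      then show ?thesis using sd by (simp add: abs_mult)
    qed
    moreover have "\<bar>sqrt (d k) - 1\<bar> * 1 \<le> \<bar>sqrt (d k) - 1\<bar> * (sqrt (d k) + 1)"
      using sd by (intro mult_left_mono) auto
    ultimately have 1: "\<bar>sqrt (d k) - 1\<bar> \<le> m\<^sup>2 * t" using d2[of k] by simp
    have "1 - s k = (sqrt (d k) - 1) / sqrt (d k)" using sd by (simp add: s_def field_simps)
    then have "\<bar>1 - s k\<bar> = \<bar>sqrt (d k) - 1\<bar> / sqrt (d k)" using sd by simp
    also have "\<dots> \<le> \<bar>sqrt (d k) - 1\<bar> * m"
      using mult_left_mono[OF ms, of "\<bar>sqrt (d k) - 1\<bar>"] sd by (simp add: field_simps)
    also have "\<dots> \<le> m\<^sup>2 * t * m" using 1 m by (intro mult_right_mono) auto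
    finally show ?thesis by (simp add: power2_eq_square power3_eq_cube mult_ac)
  qed
  define V where "V = (\<chi> i j. v j $ i)"
  have V: "V *v x = (\<Sum>i\<in>UNIV. x $ i *\<^sub>R v i)" for x
    by (simp add: V_def matrix_vector_mult_def vec_eq_iff mult.commute)
  have VG: "(V *v x) \<bullet> (G *v (V *v y)) = x \<bullet> y" for x y
    unfolding V orthonormal_form_imp_frame[OF vG] by (simp add: inner_vec_def)
  define D where "D x = (\<chi> i. s i * x $ i)" for x :: "real ^ 'n"
  define W where "W = (\<chi> i j. s j * v j $ i)"
  have W: "W *v x = V *v D x" for x
    unfolding V by (simp add: W_def D_def matrix_vector_mult_def vec_eq_iff mult_ac)
  have WH: "(W *v x) \<bullet> (H *v (W *v y)) = x \<bullet> y" for x y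
  proof -
    have "(W *v x) \<bullet> (H *v (W *v y)) = (\<Sum>i\<in>UNIV. d i * D x $ i * D y $ i)"
      unfolding W V orthonormal_form_imp_frame[OF vH] ..
    also have "\<dots> = (\<Sum>i\<in>UNIV. x $ i * y $ i)"
    proof (intro sum.cong refl)
      fix i
      have "d i * s i * s i = 1" using d0[of i] by (simp add: s_def)
      moreover have "d i * D x $ i * D y $ i = (d i * s i * s i) * (x $ i * y $ i)" by (simp add: D_def mult_ac)
      ultimately show "d i * D x $ i * D y $ i = x $ i * y $ i" by simp
    qed
    finally show ?thesis by (simp add: inner_vec_def)
  qed
  have VW: "norm (V *v x - W *v x) \<le> m ^ 4 * t * norm x" for x
  proof -
    let ?z = "x - D x"
    have eq: "V *v x - W *v x = V *v ?z" by (simp add: W matrix_vector_mult_diff_distrib)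
    have "(norm (V *v ?z))\<^sup>2 \<le> m * (?z \<bullet> ?z)"
      using G(2)[of "V *v ?z"] VG[of ?z ?z] by (simp add: power2_norm_eq_inner)
    also have "?z \<bullet> ?z = (\<Sum>i\<in>UNIV. (1 - s i)\<^sup>2 * (x $ i)\<^sup>2)"
      by (simp add: inner_vec_def D_def power2_eq_square algebra_simps)
    also have "\<dots> \<le> (\<Sum>i\<in>UNIV. (m ^ 3 * t)\<^sup>2 * (x $ i)\<^sup>2)"
    proof (intro sum_mono mult_right_mono)
      show "(1 - s i)\<^sup>2 \<le> (m ^ 3 * t)\<^sup>2" for i
        using s[of i] m t by (intro abs_le_square_iff[THEN iffD1]) simp
    qed simp
    also have "\<dots> = (m ^ 3 * t)\<^sup>2 * (norm x)\<^sup>2"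
      unfolding power2_norm_eq_inner inner_vec_def by (simp add: sum_distrib_left power2_eq_square)
    finally have "(norm (V *v ?z))\<^sup>2 \<le> m * ((m ^ 3 * t)\<^sup>2 * (norm x)\<^sup>2)"
      using m by (simp add: mult_left_mono)
    also have "\<dots> \<le> m\<^sup>2 * ((m ^ 3 * t)\<^sup>2 * (norm x)\<^sup>2)"
      using m by (intro mult_right_mono) (auto simp: power2_eq_square)
    also have "\<dots> = (m ^ 4 * t * norm x)\<^sup>2" by (simp add: power2_eq_square eval_nat_numeral mult_ac)
    finally show ?thesis unfolding eq by (rule power2_le_imp_le) (use m t in auto)
  qed
  show ?thesis by (rule that[of V W]) (auto simp only: frame_iff VG WH VW)
qed

text \<open>Failure of the bound supplies contact points, at which the second-order condition is
  transcribed into frames \<open>V\<close> at \<open>x\<close> and \<open>W\<close> at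
  \<open>y\<close>. \<open>LE\<close> makes the errors small enough for the perturbed lower bound on
  \<open>F_op\<close>, and \<open>LF\<close> makes that bound incompatible with \<open>F\<close> at
  \<open>y\<close>.\<close>

lemma interior_gradient_bound:
  fixes u :: "real ^ 'n::finite \<Rightarrow> real" and G T S H :: "real ^ 'n \<Rightarrow> real ^ 'n ^ 'n"
  assumes pn: "1 \<le> p" "p \<le> CARD('n)"
    and \<rho>: "0 < \<rho>" and K: "0 < K" and m: "1 \<le> m" and c: "0 \<le> c"
    and u: "\<And>z. z \<in> ball y0 \<rho> \<Longrightarrow> (u has_derivative (\<lambda>v. Du z \<bullet> v)) (at z)"
    and Du: "\<And>z. z \<in> ball y0 \<rho> \<Longrightarrow> (Du has_derivative (\<lambda>v. H z *v v)) (at z)"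
    and bd: "\<And>z. z \<in> ball y0 \<rho> \<Longrightarrow> \<bar>u z\<bar> \<le> K"
    and Gsym: "\<And>z. z \<in> ball y0 \<rho> \<Longrightarrow> transpose (G z) = G z"
    and Glow: "\<And>z x. z \<in> ball y0 \<rho> \<Longrightarrow> x \<bullet> x \<le> m * (x \<bullet> (G z *v x))"
    and Gup: "\<And>z x. z \<in> ball y0 \<rho> \<Longrightarrow> x \<bullet> (G z *v x) \<le> m * (x \<bullet> x)"
    and Glip: "\<And>y z x. y \<in> ball y0 \<rho> \<Longrightarrow> z \<in> ball y0 \<rho> \<Longrightarrow>
      \<bar>x \<bullet> (G y *v x) - x \<bullet> (G z *v x)\<bar> \<le> m * norm (y - z) * (x \<bullet> x)"
    and Tsym: "\<And>z. z \<in> ball y0 \<rho> \<Longrightarrow> transpose (T z) = T z"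
    and T: "\<And>z. z \<in> ball y0 \<rho> \<Longrightarrow> T z = H z + S z"
    and S: "\<And>z x. z \<in> ball y0 \<rho> \<Longrightarrow> R \<le> norm (Du z) \<Longrightarrow>
      \<bar>x \<bullet> (S z *v x)\<bar> \<le> c * norm (Du z) powr \<gamma> * (x \<bullet> x)"
    and cone: "\<And>z. z \<in> ball y0 \<rho> \<Longrightarrow> eigenvalues (G z) (T z) \<in> pcone p"
    and F: "\<And>z. z \<in> ball y0 \<rho> \<Longrightarrow> R \<le> norm (Du z) \<Longrightarrow>
      F_op p (eigenvalues (G z) (T z)) \<le> c * norm (Du z) powr \<gamma>"
    and \<gamma>: "0 \<le> \<gamma>" and L: "64 * K / \<rho> \<le> L" and LR: "4 * R \<le> L"
    and LE: "5 * K * m ^ 8 + 64 * m * K / \<rho>\<^sup>2 + 2 * c * m * (2 * L) powr \<gamma>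
      \<le> L\<^sup>2 / (12 * K * m) / (4 * (real p)\<^sup>2)"
    and LF: "c * (2 * L) powr \<gamma> < L\<^sup>2 / (12 * K * m) / (4 * real p)"
  shows "norm (Du y0) \<le> L"
proof (rule ccontr)
  assume "\<not> norm (Du y0) \<le> L"
  then have big: "L < norm (Du y0)" by simp
  have L0: "0 < L" using \<rho> K L by (smt (verit) divide_pos_pos)
  obtain x y e t where x: "x \<in> ball y0 \<rho>" and y: "y \<in> ball y0 \<rho>" and t: "0 < t" "t \<le> 3 * K / L"
    and e: "x - y = t *\<^sub>R e" "e \<bullet> e = 1"
    and Dx: "L / 4 \<le> norm (Du x)" "norm (Du x) \<le> 2 * L"
    and Dy: "L / 4 \<le> norm (Du y)" "norm (Du y) \<le> 2 * L"
    and mp: "\<And>\<xi> \<eta>. \<xi> \<bullet> (H x *v \<xi>) - \<eta> \<bullet> (H y *v \<eta>) \<le>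
      L * ((\<xi> - \<eta>) \<bullet> (\<xi> - \<eta>) - (e \<bullet> (\<xi> - \<eta>))\<^sup>2) / t - L\<^sup>2 / (6 * K) * ((\<xi> - \<eta>) \<bullet> (\<xi> - \<eta>))
      + 64 * K / \<rho>\<^sup>2 * (\<xi> \<bullet> \<xi>)"
    by (rule doubling_contact[OF \<rho> K L u Du bd big]) blast+
  have nxy: "norm (y - x) = t"
    using e t by (metis abs_of_pos mult.right_neutral norm_eq_1 norm_minus_commute norm_scaleR)
  obtain V W0 :: "real ^ 'n ^ 'n" where V: "transpose V ** G x ** V = mat 1" and W0: "transpose W0 ** G y ** W0 = mat 1"
    and close: "\<And>z. norm (V *v z - W0 *v z) \<le> m ^ 4 * t * norm z"
    by (rule exists_close_frames[OF Gsym[OF x] Glow[OF x] Gup[OF x] Gsym[OF y] Glow[OF y]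
        Glip[OF y x, unfolded nxy] m less_imp_le[OF t(1)]]) blast
  have VG: "(V *v z) \<bullet> (G x *v (V *v w)) = z \<bullet> w" for z w using V unfolding frame_iff by blast
  have W0G: "(W0 *v z) \<bullet> (G y *v (W0 *v w)) = z \<bullet> w" for z w using W0 unfolding frame_iff by blast
  have Vn: "(V *v z) \<bullet> (V *v z) \<le> m * (z \<bullet> z)" for z using Glow[OF x, of "V *v z"] VG by simp
  \<comment> \<open>The unit vector \<open>f\<close> obtained from \<open>z0\<close> represents the
    direction of \<open>e\<close> in frame coordinates. The scale \<open>s\<close> between the two
    lengths satisfies \<open>1 / m \<le> s\<^sup>2 \<le> m\<close>.\<close>
  obtain z0 where z0: "V *v z0 = e"
    using matrix_inv_frame(1)[OF V] by (metis invertible_def matrix_vector_mul_assoc matrix_vector_mul_lid)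
  have z0n: "0 < norm z0" "(norm z0)\<^sup>2 \<le> m"
    using z0 e(2) VG[of z0 z0] Gup[OF x, of e] by (auto simp: power2_norm_eq_inner)
  define s where "s = 1 / norm z0"
  define f where "f = s *\<^sub>R z0"
  have s: "0 < s" "1 \<le> m * s\<^sup>2" using z0n by (auto simp: s_def power2_eq_square field_simps)
  have ff: "f \<bullet> f = 1" using z0n by (simp add: f_def s_def dot_square_norm power2_eq_square)
  have Vf: "V *v f = s *\<^sub>R e" by (simp add: f_def z0 matrix_vector_mult_scaleR)
  have s2m: "s\<^sup>2 \<le> m" using Vn[of f] ff e by (simp add: Vf power2_eq_square)
  \<comment> \<open>reflecting the frame at \<open>y\<close> makes \<open>\<xi> - \<eta>\<close> parallel to \<open>e\<close> up to the error \<open>\<omega>\<close>\<close>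
  define O' where "O' z = z - (2 * (f \<bullet> z)) *\<^sub>R f" for z
  have OO: "O' z \<bullet> O' w = z \<bullet> w" for z w
    by (simp add: O'_def inner_diff_left inner_diff_right ff inner_commute algebra_simps)
  define W where "W = W0 ** (\<chi> i j. (if i = j then 1 else 0) - 2 * f $ i * f $ j)"
  have W: "W *v z = W0 *v O' z" for z
  proof -
    have "((\<chi> i j. (if i = j then 1 else 0) - 2 * f $ i * f $ j) *v z) $ i = O' z $ i" for i
    proof -
      have "((\<chi> i j. (if i = j then 1 else 0) - 2 * f $ i * f $ j) *v z) $ i
          = (\<Sum>j\<in>UNIV. (if j = i then z $ i else 0) - 2 * f $ i * (f $ j * z $ j))"
        unfolding matrix_vector_mult_def by (auto simp: left_diff_distrib intro!: sum.cong)
      also have "\<dots> = O' z $ i"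
        by (simp add: sum_subtractf O'_def inner_vec_def sum_distrib_left mult_ac)
      finally show ?thesis .
    qed
    then have "(\<chi> i j. (if i = j then 1 else 0) - 2 * f $ i * f $ j) *v z = O' z"
      unfolding vec_eq_iff by blast
    then show ?thesis by (simp add: W_def matrix_vector_mul_assoc[symmetric])
  qed
  have WG: "transpose W ** G y ** W = mat 1" by (simp add: frame_iff W W0G OO)
  have Wn: "(W *v z) \<bullet> (W *v z) \<le> m * (z \<bullet> z)" for z
    using Glow[OF y, of "W *v z"] by (simp add: W W0G OO)
  \<comment> \<open>Half of what the concavity guarantees:
    \<open>L\<^sup>2 / (6 K) * s\<^sup>2 \<ge> 2 N\<close>. In \<open>e2\<close> the other half
    absorbs the errors.\<close>
  define N where "N = L\<^sup>2 / (12 * K * m)"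
  have N: "0 < N" using L0 K m by (simp add: N_def)
  \<comment> \<open>In \<open>5 K m\<^sup>8\<close>, the share 3 comes from the singular term and
    the share 2 from the part of the concavity lost to the frame mismatch. The next term is the
    penalty, and the last one collects \<open>S\<close> at \<open>x\<close> and at
    \<open>y\<close>.\<close>
  define E where "E = 5 * K * m ^ 8 + 64 * m * K / \<rho>\<^sup>2 + 2 * c * m * (2 * L) powr \<gamma>"
  have E: "E \<le> N / (4 * (real p)\<^sup>2)" using LE by (simp add: E_def N_def)
  have EN: "E \<le> N"
  proof -
    have "1 \<le> (real p)\<^sup>2" using pn by simp
    then have "1 \<le> 4 * (real p)\<^sup>2" by linarith
    then have "N / (4 * (real p)\<^sup>2) \<le> N / 1" by (rule divide_left_mono) (use N pn in auto)
    then show ?thesis using E by simp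
  qed
  have Sb: "\<bar>v \<bullet> (S z *v v)\<bar> \<le> c * m * (2 * L) powr \<gamma> * (w \<bullet> w)"
    if "z \<in> ball y0 \<rho>" "L / 4 \<le> norm (Du z)" "norm (Du z) \<le> 2 * L" "v \<bullet> v \<le> m * (w \<bullet> w)" for z v w
  proof -
    have "\<bar>v \<bullet> (S z *v v)\<bar> \<le> c * norm (Du z) powr \<gamma> * (v \<bullet> v)"
      by (rule S) (use that LR in auto)
    also have "\<dots> \<le> c * (2 * L) powr \<gamma> * (m * (w \<bullet> w))"
      using that c \<gamma> by (intro mult_mono powr_mono2) auto
    finally show ?thesis by (simp add: mult_ac)
  qed
  have q\<rho>: "0 \<le> 64 * K / \<rho>\<^sup>2" using K by simp
  have e2: "(V *v f) \<bullet> (T x *v (V *v f)) \<le> - N"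
  proof -
    \<comment> \<open>With \<open>\<eta> = 0\<close> and \<open>\<xi> = s e\<close>, the difference
      is parallel to \<open>e\<close>, so the term with \<open>1 / t\<close> vanishes and the
      concavity acts alone.\<close>
    have "(V *v f) \<bullet> (H x *v (V *v f)) \<le> - (L\<^sup>2 / (6 * K)) * s\<^sup>2 + 64 * K / \<rho>\<^sup>2 * s\<^sup>2"
      using mp[of "V *v f" 0] e(2) by (simp add: Vf power2_eq_square)
    also have "64 * K / \<rho>\<^sup>2 * s\<^sup>2 \<le> 64 * K / \<rho>\<^sup>2 * m" using s2m q\<rho> by (rule mult_left_mono)
    also have "- (L\<^sup>2 / (6 * K)) * s\<^sup>2 \<le> - 2 * N"
    proof -
      have "2 * N = L\<^sup>2 / (6 * K) * (1 / m)" using K m by (simp add: N_def)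
      also have "\<dots> \<le> L\<^sup>2 / (6 * K) * s\<^sup>2"
        using s m K by (intro mult_left_mono) (auto simp: field_simps)
      finally show ?thesis by simp
    qed
    finally have "(V *v f) \<bullet> (H x *v (V *v f)) \<le> - 2 * N + 64 * m * K / \<rho>\<^sup>2" by (simp add: mult_ac)
    moreover have "(V *v f) \<bullet> (S x *v (V *v f)) \<le> c * m * (2 * L) powr \<gamma>"
      using Sb[OF x Dx Vn[of f]] ff by simp
    moreover have "0 \<le> c * m * (2 * L) powr \<gamma>" "0 \<le> 5 * K * m ^ 8" using c m K by auto
    ultimately show ?thesis
      using EN by (simp add: T[OF x] matrix_vector_mult_add_rdistrib inner_add_right E_def)
  qed
  have ge: "(V *v z) \<bullet> (T x *v (V *v z)) + N * (f \<bullet> z)\<^sup>2 - E * (z \<bullet> z) \<le> (W *v z) \<bullet> (T y *v (W *v z))" for z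
  proof -
    define \<delta> where "\<delta> = V *v z - W *v z"
    define \<omega> where "\<omega> = V *v O' z - W0 *v O' z"
    have "V *v z = V *v O' z + (2 * (f \<bullet> z)) *\<^sub>R (V *v f)"
      by (simp add: O'_def matrix_vector_mult_diff_distrib matrix_vector_mult_scaleR)
    then have \<delta>: "\<delta> = (2 * s * (f \<bullet> z)) *\<^sub>R e + \<omega>"
      by (simp add: \<delta>_def \<omega>_def W Vf algebra_simps)
    have "norm \<omega> \<le> m ^ 4 * t * norm z"
      using close[of "O' z"] OO[of z z] by (simp add: \<omega>_def norm_eq_sqrt_inner)
    then have "(norm \<omega>)\<^sup>2 \<le> (m ^ 4 * t * norm z)\<^sup>2" by (rule power_mono) simp
    then have \<omega>: "\<omega> \<bullet> \<omega> \<le> m ^ 8 * t\<^sup>2 * (z \<bullet> z)"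
      by (simp add: power2_norm_eq_inner[symmetric] power_mult_distrib flip: power_mult)
    have e\<omega>: "(e \<bullet> \<omega>)\<^sup>2 \<le> \<omega> \<bullet> \<omega>" using Cauchy_Schwarz_ineq[of e \<omega>] e(2) by simp
    define A where "A = 2 * s * (f \<bullet> z)"
    \<comment> \<open>The component of \<open>\<delta>\<close> along \<open>e\<close> cancels, so
      the singular term sees only the frame mismatch \<open>\<omega>\<close>, of order
      \<open>t\<close>.\<close>
    have 1: "\<delta> \<bullet> \<delta> - (e \<bullet> \<delta>)\<^sup>2 = \<omega> \<bullet> \<omega> - (e \<bullet> \<omega>)\<^sup>2"
      unfolding \<delta> A_def[symmetric] using e(2)
      by (simp add: inner_add_left inner_add_right inner_commute power2_eq_square algebra_simps)
    \<comment> \<open>Young's inequality on the cross term, \<open>2 A (e \<bullet> \<omega>) \<ge>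
      - A\<^sup>2 / 2 - 2 (e \<bullet> \<omega>)\<^sup>2\<close>: half of the reflected component
      survives, which is still \<open>4 N (f \<bullet> z)\<^sup>2\<close> after multiplication by
      the concavity.\<close>
    have 2: "2 * s\<^sup>2 * (f \<bullet> z)\<^sup>2 - \<omega> \<bullet> \<omega> \<le> \<delta> \<bullet> \<delta>"
    proof -
      have "\<delta> \<bullet> \<delta> = A\<^sup>2 + 2 * A * (e \<bullet> \<omega>) + \<omega> \<bullet> \<omega>"
        unfolding \<delta> A_def[symmetric] using e(2)
        by (simp add: inner_add_left inner_add_right inner_commute power2_eq_square algebra_simps)
      moreover have "0 \<le> (A + 2 * (e \<bullet> \<omega>))\<^sup>2" by simp
      moreover have "A\<^sup>2 = 4 * s\<^sup>2 * (f \<bullet> z)\<^sup>2" by (simp add: A_def power_mult_distrib)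
      ultimately show ?thesis using e\<omega> by (simp add: power2_eq_square algebra_simps)
    qed
    have Lt: "L * t \<le> 3 * K" using t L0 by (simp add: field_simps)
    have 3: "L * (\<delta> \<bullet> \<delta> - (e \<bullet> \<delta>)\<^sup>2) / t \<le> 3 * K * m ^ 8 * (z \<bullet> z)"
    proof -
      have "L * (\<delta> \<bullet> \<delta> - (e \<bullet> \<delta>)\<^sup>2) / t \<le> L * (m ^ 8 * t\<^sup>2 * (z \<bullet> z)) / t"
        using \<omega> L0 t unfolding 1 by (intro divide_right_mono mult_left_mono) (auto intro: order_trans[rotated])
      also have "\<dots> = (L * t) * (m ^ 8 * (z \<bullet> z))" using t by (simp add: power2_eq_square)
      also have "\<dots> \<le> 3 * K * (m ^ 8 * (z \<bullet> z))" using Lt m by (intro mult_right_mono) auto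
      finally show ?thesis by (simp add: mult_ac)
    qed
    have 4: "- (L\<^sup>2 / (6 * K) * (\<delta> \<bullet> \<delta>)) \<le> - 4 * N * (f \<bullet> z)\<^sup>2 + 2 * K * m ^ 8 * (z \<bullet> z)"
    proof -
      have "4 * N * (f \<bullet> z)\<^sup>2 = L\<^sup>2 / (6 * K) * (2 * (1 / m) * (f \<bullet> z)\<^sup>2)"
        using K m by (simp add: N_def)
      also have "\<dots> \<le> L\<^sup>2 / (6 * K) * (2 * s\<^sup>2 * (f \<bullet> z)\<^sup>2)"
        using s m K by (intro mult_left_mono mult_right_mono) (auto simp: field_simps)
      also have "\<dots> \<le> L\<^sup>2 / (6 * K) * (\<delta> \<bullet> \<delta> + m ^ 8 * t\<^sup>2 * (z \<bullet> z))"
        using 2 \<omega> K by (intro mult_left_mono) auto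
      also have "\<dots> = L\<^sup>2 / (6 * K) * (\<delta> \<bullet> \<delta>) + (L * t)\<^sup>2 / (6 * K) * (m ^ 8 * (z \<bullet> z))"
        by (simp add: power_mult_distrib algebra_simps)
      also have "(L * t)\<^sup>2 / (6 * K) * (m ^ 8 * (z \<bullet> z)) \<le> 2 * K * (m ^ 8 * (z \<bullet> z))"
      proof (intro mult_right_mono)
        have "(L * t)\<^sup>2 \<le> (3 * K)\<^sup>2" using Lt L0 t by (intro power_mono) auto
        also have "\<dots> \<le> 2 * K * (6 * K)" using K by (simp add: power2_eq_square)
        finally show "(L * t)\<^sup>2 / (6 * K) \<le> 2 * K" using K by (simp add: divide_le_eq)
      qed (use m in auto)
      finally show ?thesis by (simp add: mult_ac)
    qed
    have 5: "64 * K / \<rho>\<^sup>2 * ((V *v z) \<bullet> (V *v z)) \<le> 64 * m * K / \<rho>\<^sup>2 * (z \<bullet> z)"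
      using mult_left_mono[OF Vn[of z] q\<rho>] by (simp add: mult_ac)
    have 6: "(V *v z) \<bullet> (H x *v (V *v z)) - (W *v z) \<bullet> (H y *v (W *v z))
      \<le> 3 * K * m ^ 8 * (z \<bullet> z) + (- 4 * N * (f \<bullet> z)\<^sup>2 + 2 * K * m ^ 8 * (z \<bullet> z)) + 64 * m * K / \<rho>\<^sup>2 * (z \<bullet> z)"
      using mp[of "V *v z" "W *v z", folded \<delta>_def] 3 4 5 by linarith
    have 7: "\<bar>(V *v z) \<bullet> (S x *v (V *v z))\<bar> \<le> c * m * (2 * L) powr \<gamma> * (z \<bullet> z)"
      "\<bar>(W *v z) \<bullet> (S y *v (W *v z))\<bar> \<le> c * m * (2 * L) powr \<gamma> * (z \<bullet> z)"
      using Sb[OF x Dx Vn[of z]] Sb[OF y Dy Wn[of z]] by auto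
    have Ez: "E * (z \<bullet> z) = 3 * K * m ^ 8 * (z \<bullet> z) + 2 * K * m ^ 8 * (z \<bullet> z) + 64 * m * K / \<rho>\<^sup>2 * (z \<bullet> z)
      + c * m * (2 * L) powr \<gamma> * (z \<bullet> z) + c * m * (2 * L) powr \<gamma> * (z \<bullet> z)"
      by (simp add: E_def algebra_simps)
    have "0 \<le> N * (f \<bullet> z)\<^sup>2" using N by simp
    moreover have "(V *v z) \<bullet> (T x *v (V *v z)) = (V *v z) \<bullet> (H x *v (V *v z)) + (V *v z) \<bullet> (S x *v (V *v z))"
      "(W *v z) \<bullet> (T y *v (W *v z)) = (W *v z) \<bullet> (H y *v (W *v z)) + (W *v z) \<bullet> (S y *v (W *v z))"
      by (simp_all add: T[OF x] T[OF y] matrix_vector_mult_add_rdistrib inner_add_right)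
    ultimately show ?thesis using 6 7 Ez by linarith
  qed
  have "N / (4 * real p) \<le> F_op p (eigenvalues (G y) (T y))"
    by (rule F_op_lower_bound_perturbed[OF pn V Tsym[OF x] WG Tsym[OF y] cone[OF x] ff e2 N ge E])
  also have "\<dots> \<le> c * norm (Du y) powr \<gamma>" by (rule F[OF y]) (use Dy LR in simp)
  also have "\<dots> \<le> c * (2 * L) powr \<gamma>" using Dy c \<gamma> by (intro mult_left_mono powr_mono2) auto
  finally show False using LF by (simp add: N_def)
qed

section \<open>Choice of the gradient threshold\<close>

lemma powr_growth_eventually_small:
  fixes c q \<gamma> :: real
  assumes "\<gamma> < 2" "0 < q"
  shows "\<forall>\<^sub>F L in at_top. c * (2 * L) powr \<gamma> < q * L\<^sup>2"
proof -
  have "((\<lambda>L. L powr (\<gamma> - 2)) \<longlongrightarrow> 0) at_top"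
    using assms by (intro tendsto_neg_powr filterlim_ident) auto
  then have "((\<lambda>L. c * 2 powr \<gamma> * L powr (\<gamma> - 2)) \<longlongrightarrow> c * 2 powr \<gamma> * 0) at_top"
    by (intro tendsto_mult tendsto_const)
  then have "\<forall>\<^sub>F L in at_top. c * 2 powr \<gamma> * L powr (\<gamma> - 2) < q"
    using assms(2) by (intro order_tendstoD) auto
  then show ?thesis
    using eventually_gt_at_top[of 0]
  proof eventually_elim
    case (elim L)
    then have "c * 2 powr \<gamma> * L powr (\<gamma> - 2) * L\<^sup>2 < q * L\<^sup>2" by (intro mult_strict_right_mono) auto
    moreover have "L powr (\<gamma> - 2) * L\<^sup>2 = L powr \<gamma>"
      using elim by (simp add: powr_diff powr_numeral)
    ultimately show ?case using elim by (simp add: powr_mult mult.assoc)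
  qed
qed

text \<open>All conditions hold for large \<open>L\<close>, and
  \<open>L = \<Lambda> / \<rho> \<ge> \<Lambda>\<close> because \<open>\<rho> \<le> 1\<close>. The
  term with \<open>1 / \<rho>\<^sup>2\<close> grows exactly like \<open>L\<^sup>2\<close>, so it is
  compared at \<open>\<Lambda>\<close> and then rescaled; this forces the dependence of
  \<open>L\<close> on \<open>1 / \<rho>\<close>.\<close>

lemma gradient_bound_threshold:
  fixes K m c R \<gamma> :: real and p :: nat
  assumes K: "0 < K" and m: "1 \<le> m" and p: "1 \<le> p" and \<gamma>: "\<gamma> < 2"
  obtains \<Lambda> where "0 < \<Lambda>"
    "\<And>\<rho> L. 0 < \<rho> \<Longrightarrow> \<rho> \<le> 1 \<Longrightarrow> L = \<Lambda> / \<rho> \<Longrightarrow> 64 * K / \<rho> \<le> L \<and> 4 * R \<le> L \<and>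
      5 * K * m ^ 8 + 64 * m * K / \<rho>\<^sup>2 + 2 * c * m * (2 * L) powr \<gamma> \<le> L\<^sup>2 / (12 * K * m) / (4 * (real p)\<^sup>2) \<and>
      c * (2 * L) powr \<gamma> < L\<^sup>2 / (12 * K * m) / (4 * real p)"
proof -
  \<comment> \<open>The division by 3 grants each of the three error terms a third of the right-hand
    side.\<close>
  define q where "q = 1 / (12 * K * m) / (4 * (real p)\<^sup>2) / 3"
  define q' where "q' = 1 / (12 * K * m) / (4 * real p)"
  have q: "0 < q" "0 < q'" using K m p by (auto simp: q_def q'_def)
  have "\<forall>\<^sub>F L in at_top. 4 * R \<le> L \<and> 5 * K * m ^ 8 / q \<le> L \<and> 64 * m * K / q \<le> L \<and> 1 \<le> L \<and> 64 * K \<le> L \<and>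
      2 * c * m * (2 * L) powr \<gamma> < q * L\<^sup>2 \<and> c * (2 * L) powr \<gamma> < q' * L\<^sup>2"
    by (intro eventually_conj eventually_ge_at_top powr_growth_eventually_small \<gamma> q)
  then obtain \<Lambda> where \<Lambda>: "\<And>L. \<Lambda> \<le> L \<Longrightarrow> 4 * R \<le> L \<and> 5 * K * m ^ 8 / q \<le> L \<and> 64 * m * K / q \<le> L \<and> 1 \<le> L \<and> 64 * K \<le> L \<and>
      2 * c * m * (2 * L) powr \<gamma> < q * L\<^sup>2 \<and> c * (2 * L) powr \<gamma> < q' * L\<^sup>2"
    unfolding eventually_at_top_linorder by blast
  show ?thesis
  proof
    show "0 < \<Lambda>" using \<Lambda>[of \<Lambda>] by simp
    fix \<rho> L :: real assume \<rho>: "0 < \<rho>" "\<rho> \<le> 1" and L: "L = \<Lambda> / \<rho>"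
    have \<Lambda>1: "1 \<le> \<Lambda>" using \<Lambda>[of \<Lambda>] by simp
    have "\<Lambda> \<le> L" using \<rho> \<Lambda>1 by (simp add: L le_divide_eq mult_left_le)
    note A = \<Lambda>[OF this]
    have "L \<le> L\<^sup>2" using A by (simp add: power2_eq_square)
    then have a: "5 * K * m ^ 8 \<le> q * L\<^sup>2" using A q by (smt (verit) divide_le_eq mult.commute)
    have "64 * m * K / q \<le> \<Lambda>\<^sup>2"
      using \<Lambda>[of \<Lambda>] self_le_power[of \<Lambda> 2] by simp
    then have "64 * m * K \<le> q * \<Lambda>\<^sup>2" using q by (simp add: divide_le_eq mult.commute)
    then have b: "64 * m * K / \<rho>\<^sup>2 \<le> q * L\<^sup>2"
      using \<rho> by (simp add: L power_divide divide_right_mono)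
    have d: "64 * K / \<rho> \<le> L" using \<Lambda>[of \<Lambda>] \<rho> by (simp add: L divide_right_mono)
    have "3 * (q * L\<^sup>2) = L\<^sup>2 / (12 * K * m) / (4 * (real p)\<^sup>2)" by (simp add: q_def)
    moreover have "q' * L\<^sup>2 = L\<^sup>2 / (12 * K * m) / (4 * real p)" by (simp add: q'_def)
    ultimately show "64 * K / \<rho> \<le> L \<and> 4 * R \<le> L \<and>
      5 * K * m ^ 8 + 64 * m * K / \<rho>\<^sup>2 + 2 * c * m * (2 * L) powr \<gamma> \<le> L\<^sup>2 / (12 * K * m) / (4 * (real p)\<^sup>2) \<and>
      c * (2 * L) powr \<gamma> < L\<^sup>2 / (12 * K * m) / (4 * real p)"
      using A a b d by linarith
  qed
qed

section \<open>Charts, metrics and geodesic balls\<close>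

lemma pdv_interior:
  fixes f :: "real ^ 'n::finite \<Rightarrow> real"
  assumes "y \<in> interior S" "(f has_derivative f') (at y)"
  shows "pdv S f y \<bullet> v = f' v"
proof -
  have "frechet_derivative f (at y within S) = f'"
    using frechet_derivative_at[OF assms(2)] at_within_interior[OF assms(1)] by simp
  then have "pdv S f y \<bullet> v = (\<Sum>i\<in>UNIV. f' (axis i 1) * v $ i)"
    by (simp add: pdv_def inner_vec_def)
  also have "\<dots> = f' (\<Sum>i\<in>UNIV. v $ i *\<^sub>R axis i 1)"
    using has_derivative_linear[OF assms(2)] by (simp add: linear_sum linear_cmul mult.commute)
  also have "(\<Sum>i\<in>UNIV. v $ i *\<^sub>R axis i 1) = v"
    using basis_expansion[of v] by (simp add: scalar_mult_eq_scaleR)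
  finally show ?thesis .
qed

lemma pdv_cong:
  assumes "y \<in> S" "\<And>w. w \<in> S \<Longrightarrow> f w = h w"
  shows "pdv S f y = pdv S h y"
proof -
  have "(f has_derivative f') (at y within S) \<longleftrightarrow> (h has_derivative f') (at y within S)" for f'
    using assms by (metis has_derivative_transform)
  then show ?thesis by (simp add: pdv_def frechet_derivative_def)
qed

text \<open>On an open subset of \<open>S\<close>, derivatives within \<open>S\<close> are full
  derivatives and \<open>f\<close> agrees locally with its \<open>C\<^sup>3\<close> extension. In
  the matrix, the row index \<open>j\<close> is the gradient component and the column index
  \<open>i\<close> the direction of differentiation.\<close>

lemma pdv_locally_C3:
  fixes f :: "real ^ 'n::finite \<Rightarrow> real"
  assumes \<Omega>: "open \<Omega>" "\<Omega> \<subseteq> S" and z: "z \<in> \<Omega>"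
    and C3: "\<And>z. z \<in> \<Omega> \<Longrightarrow> \<exists>U h. open U \<and> z \<in> U \<and> Ck_open 3 U h \<and> (\<forall>y\<in>U \<inter> \<Omega>. h y = f y)"
  shows "(f has_derivative (\<lambda>v. pdv S f z \<bullet> v)) (at z)"
    and "(pdv S f has_derivative (\<lambda>v. (\<chi> j i. pdv S (\<lambda>w. pdv S f w $ j) z $ i) *v v)) (at z)"
proof -
  have int: "w \<in> interior S" if "w \<in> \<Omega>" for w using \<Omega> that by (meson interior_maximal subsetD)
  obtain U h where U: "open U" "z \<in> U" "Ck_open 3 U h" "\<And>y. y \<in> U \<inter> \<Omega> \<Longrightarrow> h y = f y"
    using C3[OF z] by blast
  have h1: "h differentiable (at w)" if "w \<in> U" for w
    using U(3) that by (simp add: numeral_3_eq_3)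
  have h2: "(\<lambda>w. frechet_derivative h (at w) v) differentiable (at z)" for v
    using U(2,3) by (simp add: numeral_3_eq_3)
  have fd: "(f has_derivative frechet_derivative h (at w)) (at w)" if "w \<in> U \<inter> \<Omega>" for w
  proof (rule has_derivative_transform_within_open)
    show "(h has_derivative frechet_derivative h (at w)) (at w)"
      using h1 that by (simp add: frechet_derivative_works[symmetric])
    show "open (U \<inter> \<Omega>)" using U \<Omega> by blast
  qed (use that U(4) in auto)
  have pd: "pdv S f w \<bullet> v = frechet_derivative h (at w) v" if "w \<in> U \<inter> \<Omega>" for w v
    using pdv_interior[OF int fd] that by blast
  have zU: "z \<in> U \<inter> \<Omega>" using U z by simp
  show "(f has_derivative (\<lambda>v. pdv S f z \<bullet> v)) (at z)"
    using fd[OF zU] pd[OF zU] by simp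
  have comp: "((\<lambda>w. pdv S f w $ j) has_derivative (\<lambda>v. pdv S (\<lambda>w. pdv S f w $ j) z \<bullet> v)) (at z)" for j
  proof -
    have "((\<lambda>w. frechet_derivative h (at w) (axis j 1)) has_derivative
        frechet_derivative (\<lambda>w. frechet_derivative h (at w) (axis j 1)) (at z)) (at z)"
      using h2 by (simp add: frechet_derivative_works[symmetric])
    then have *: "((\<lambda>w. pdv S f w $ j) has_derivative
        frechet_derivative (\<lambda>w. frechet_derivative h (at w) (axis j 1)) (at z)) (at z)"
    proof (rule has_derivative_transform_within_open)
      show "open (U \<inter> \<Omega>)" using U \<Omega> by blast
      show "frechet_derivative h (at w) (axis j 1) = pdv S f w $ j" if "w \<in> U \<inter> \<Omega>" for w
        using pd[OF that, of "axis j 1"] by (simp add: inner_axis)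
    qed (rule zU)
    from pdv_interior[OF int[OF z] this] * show ?thesis by simp
  qed
  show "(pdv S f has_derivative (\<lambda>v. (\<chi> j i. pdv S (\<lambda>w. pdv S f w $ j) z $ i) *v v)) (at z)"
    unfolding has_derivative_componentwise_within[of "pdv S f"]
  proof
    fix b :: "real ^ 'n" assume "b \<in> Basis"
    then obtain j where "b = axis j 1" by (auto simp: Basis_vec_def)
    moreover have "((\<chi> j i. pdv S (\<lambda>w. pdv S f w $ j) z $ i) *v v) \<bullet> axis j 1
        = pdv S (\<lambda>w. pdv S f w $ j) z \<bullet> v" for v
      unfolding inner_axis by (simp add: matrix_vector_mult_def inner_vec_def)
    moreover have "pdv S f w \<bullet> axis j 1 = pdv S f w $ j" for w by (simp add: inner_axis)
    ultimately show "((\<lambda>w. pdv S f w \<bullet> b) has_derivative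
        (\<lambda>v. ((\<chi> j i. pdv S (\<lambda>w. pdv S f w $ j) z $ i) *v v) \<bullet> b)) (at z)"
      using comp[of j] by (simp only:)
  qed
qed

lemma quadratic_form_bound:
  fixes M :: "real ^ 'n::finite ^ 'n"
  assumes "\<And>i j. \<bar>M $ i $ j\<bar> \<le> b"
  shows "\<bar>x \<bullet> (M *v x)\<bar> \<le> (real CARD('n))\<^sup>2 * b * (x \<bullet> x)"
proof -
  have "\<bar>x \<bullet> (M *v x)\<bar> = \<bar>\<Sum>i\<in>UNIV. \<Sum>j\<in>UNIV. M $ i $ j * (x $ i * x $ j)\<bar>"
    by (simp add: inner_vec_def matrix_vector_mult_def sum_distrib_left mult_ac)
  also have "\<dots> \<le> (\<Sum>i\<in>UNIV. \<Sum>j\<in>UNIV. \<bar>M $ i $ j * (x $ i * x $ j)\<bar>)"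
    by (intro order_trans[OF sum_abs] sum_mono sum_abs)
  also have "\<dots> \<le> (\<Sum>i\<in>(UNIV :: 'n set). \<Sum>j\<in>(UNIV :: 'n set). b * (x \<bullet> x))"
  proof (intro sum_mono)
    fix i j :: 'n
    have "\<bar>x $ i * x $ j\<bar> \<le> norm x * norm x"
      unfolding abs_mult by (intro mult_mono component_le_norm_cart) auto
    then have "\<bar>x $ i * x $ j\<bar> \<le> x \<bullet> x" by (simp add: dot_square_norm power2_eq_square)
    then show "\<bar>M $ i $ j * (x $ i * x $ j)\<bar> \<le> b * (x \<bullet> x)"
      unfolding abs_mult[of "M $ i $ j"] using assms[of i j] by (intro mult_mono) auto
  qed
  finally show ?thesis by (simp add: power2_eq_square mult_ac)
qed

lemma matrix_inv_mult_pos_def: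
  fixes G :: "real ^ 'n::finite ^ 'n"
  assumes "\<And>v. v \<noteq> 0 \<Longrightarrow> 0 < v \<bullet> (G *v v)"
  shows "G *v (matrix_inv G *v q) = q" "G *v w = q \<Longrightarrow> matrix_inv G *v q = w"
proof -
  have "inj ((*v) G)"
  proof (rule injI)
    fix v w assume "G *v v = G *v w"
    then have "(v - w) \<bullet> (G *v (v - w)) = 0" by (simp add: matrix_vector_mult_diff_distrib)
    then show "v = w" using assms[of "v - w"] by fastforce
  qed
  then obtain H where H: "H ** G = mat 1" using matrix_left_invertible_injective by blast
  then have inv: "matrix_inv G = H" by (rule matrix_inv_unique)
  have "G ** H = mat 1" using H matrix_left_right_inverse by blast
  then show "G *v (matrix_inv G *v q) = q"
    by (simp only: inv matrix_vector_mul_assoc matrix_vector_mul_lid)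
  show "matrix_inv G *v q = w" if "G *v w = q"
    using H by (simp only: inv that[symmetric] matrix_vector_mul_assoc matrix_vector_mul_lid)
qed

text \<open>For \<open>w = G\<^sup>-\<^sup>1 q\<close> the squared conorm is
  \<open>q \<bullet> w = w \<bullet> G w\<close>. Cauchy-Schwarz gives the upper bounds; the lower
  bound expands the nonnegative value of the form at \<open>w - q / m\<close>, so it uses only the
  upper bound on \<open>G\<close>.\<close>

lemma matrix_inv_bounds:
  fixes G :: "real ^ 'n::finite ^ 'n"
  assumes sym: "transpose G = G" and m: "0 < m"
    and low: "\<And>x. x \<bullet> x \<le> m * (x \<bullet> (G *v x))" and up: "\<And>x. x \<bullet> (G *v x) \<le> m * (x \<bullet> x)"
  shows "norm (matrix_inv G *v q) \<le> m * norm q"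
    and "(conorm G q)\<^sup>2 \<le> m * (norm q)\<^sup>2" "(norm q)\<^sup>2 \<le> m * (conorm G q)\<^sup>2" "0 \<le> conorm G q"
proof -
  have pos: "0 < v \<bullet> (G *v v)" if "v \<noteq> 0" for v
  proof -
    have "0 < m * (v \<bullet> (G *v v))" using low[of v] that by (metis inner_gt_zero_iff less_le_trans)
    then show ?thesis using m by (simp add: zero_less_mult_iff)
  qed
  define w where "w = matrix_inv G *v q"
  have Gw: "G *v w = q" using matrix_inv_mult_pos_def(1)[OF pos] by (simp add: w_def)
  have cs: "q \<bullet> w \<le> norm q * norm w" by (rule norm_cauchy_schwarz)
  have wG: "w \<bullet> (G *v w) = q \<bullet> w" by (simp add: Gw inner_commute)
  have "norm w * norm w \<le> m * (norm q * norm w)"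
  proof -
    have "norm w * norm w \<le> m * (q \<bullet> w)" using low[of w] wG by (simp add: dot_square_norm power2_eq_square)
    also have "\<dots> \<le> m * (norm q * norm w)" using cs m by simp
    finally show ?thesis .
  qed
  then show nw: "norm (matrix_inv G *v q) \<le> m * norm q"
    unfolding w_def[symmetric] using m by (cases "norm w = 0") (auto simp: mult.assoc[symmetric])
  have nn: "0 \<le> q \<bullet> w"
  proof -
    have "0 \<le> w \<bullet> w" by simp
    also have "\<dots> \<le> m * (w \<bullet> (G *v w))" by (rule low)
    finally show ?thesis using m wG by (simp add: zero_le_mult_iff)
  qed
  have co: "(conorm G q)\<^sup>2 = q \<bullet> w" using nn by (simp add: conorm_def w_def)
  have "q \<bullet> w \<le> norm q * (m * norm q)"
    using order_trans[OF cs mult_left_mono[OF nw[folded w_def] norm_ge_zero]] .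
  then show "(conorm G q)\<^sup>2 \<le> m * (norm q)\<^sup>2" unfolding co by (simp add: power2_eq_square mult_ac)
  show "0 \<le> conorm G q" using nn by (simp add: conorm_def w_def)
  have "0 \<le> (w - (1 / m) *\<^sub>R q) \<bullet> (G *v (w - (1 / m) *\<^sub>R q))"
    using pos[of "w - (1 / m) *\<^sub>R q"] by (cases "w - (1 / m) *\<^sub>R q = 0") auto
  also have "\<dots> = q \<bullet> w - 2 / m * (q \<bullet> q) + 1 / m\<^sup>2 * (q \<bullet> (G *v q))"
  proof -
    have "w \<bullet> (G *v q) = q \<bullet> q" using linear_matrix_symmetric[OF sym, of w q] Gw by simp
    then show ?thesis
      using m by (simp add: matrix_vector_mult_diff_distrib matrix_vector_mult_scaleR inner_diff_left
          inner_diff_right Gw inner_commute power2_eq_square field_simps)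
  qed
  also have "\<dots> \<le> q \<bullet> w - 2 / m * (q \<bullet> q) + 1 / m\<^sup>2 * (m * (q \<bullet> q))"
    using up[of q] by (intro add_left_mono mult_left_mono) auto
  also have "\<dots> = q \<bullet> w - (q \<bullet> q) / m" using m by (simp add: power2_eq_square)
  finally show "(norm q)\<^sup>2 \<le> m * (conorm G q)\<^sup>2"
    using m unfolding co by (simp add: power2_norm_eq_inner divide_le_eq mult.commute)
qed

lemma christoffel_symmetric:
  assumes "y \<in> cimg c" "\<And>w. w \<in> cimg c \<Longrightarrow> transpose (g c w) = g c w"
  shows "christoffel g c y k i j = christoffel g c y k j i"
proof -
  have "g c w $ i $ j = g c w $ j $ i" if "w \<in> cimg c" for w
    using assms(2)[OF that] by (metis transpose_def vec_lambda_beta)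
  then have "pdv (cimg c) (\<lambda>w. g c w $ i $ j) y = pdv (cimg c) (\<lambda>w. g c w $ j $ i) y"
    by (rule pdv_cong[OF assms(1)])
  then show ?thesis by (simp add: christoffel_def add.commute)
qed

lemma cimg_subset_half_space:
  assumes "smooth_atlas \<A>" "c \<in> \<A>"
  shows "cimg c \<subseteq> half_space"
proof -
  have "openin (top_of_set half_space) (cimg c)" using assms by (simp add: smooth_atlas_def)
  then show ?thesis by (rule openin_imp_subset)
qed

lemma chart_inverse:
  assumes "smooth_atlas \<A>" "c \<in> \<A>"
  shows "x \<in> fst c \<Longrightarrow> cinv c (snd c x) = x" "y \<in> cimg c \<Longrightarrow> snd c (cinv c y) = y"
    "y \<in> cimg c \<Longrightarrow> cinv c y \<in> fst c" "x \<in> fst c \<Longrightarrow> snd c x \<in> cimg c"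
    "continuous_on (fst c) (snd c)" "continuous_on (cimg c) (cinv c)" "open (fst c)"
proof -
  have hom: "homeomorphism (fst c) (cimg c) (snd c) (cinv c)" and "open (fst c)"
    using assms by (auto simp: smooth_atlas_def)
  then show "x \<in> fst c \<Longrightarrow> cinv c (snd c x) = x" "y \<in> cimg c \<Longrightarrow> snd c (cinv c y) = y"
    "y \<in> cimg c \<Longrightarrow> cinv c y \<in> fst c" "x \<in> fst c \<Longrightarrow> snd c x \<in> cimg c"
    "continuous_on (fst c) (snd c)" "continuous_on (cimg c) (cinv c)" "open (fst c)"
    by (auto simp: homeomorphism_def)
qed

text \<open>Chart images are open only relative to the half-space; intersecting with the open
  half-space gives genuinely open sets, on which derivatives and invariance of domain are
  available.\<close>

lemma open_chart_image:
  fixes \<A> :: "('a::t2_space, 'n::finite) chart set"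
  assumes A: "smooth_atlas \<A>" "c \<in> \<A>" and V: "open V"
  shows "open (snd c ` (fst c \<inter> V) \<inter> {y. 0 < y $ (SOME i. True)})"
proof -
  have hom: "homeomorphism (fst c) (cimg c) (snd c) (cinv c)"
    and op: "openin (top_of_set half_space) (cimg c)"
    using A by (auto simp: smooth_atlas_def)
  have "openin (top_of_set (fst c)) (fst c \<inter> V)" using V by (simp add: openin_open_Int)
  then have "openin (top_of_set (cimg c)) (snd c ` (fst c \<inter> V))"
    using homeomorphism_imp_open_map[OF hom] by blast
  then have "openin (top_of_set half_space) (snd c ` (fst c \<inter> V))" using op openin_trans by blast
  then obtain W where W: "open W" "snd c ` (fst c \<inter> V) = half_space \<inter> W" by (auto simp: openin_open)
  have "snd c ` (fst c \<inter> V) \<inter> {y. 0 < y $ (SOME i. True)} = W \<inter> {y. 0 < y $ (SOME i. True)}"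
    unfolding W(2) half_space_def by auto
  moreover have "open {y :: real ^ 'n. 0 < y $ (SOME i. True)}"
    by (rule open_halfspace_component_gt_cart)
  ultimately show ?thesis using W(1) by auto
qed

text \<open>\<open>interior_pts\<close> asks for one chart with positive coordinate; here every
  chart is shown to agree. By invariance of domain the transition map sends an open set around the
  point to an open set contained in the half-space, hence in its interior.\<close>

lemma interior_pts_coordinate_pos:
  fixes \<A> :: "('a::t2_space, 'n::finite) chart set"
  assumes A: "smooth_atlas \<A>" and x: "x \<in> interior_pts \<A>" and d: "d \<in> \<A>" "x \<in> fst d"
  shows "0 < snd d x $ (SOME i. True)"
proof -
  obtain c where c: "c \<in> \<A>" "x \<in> fst c" "0 < snd c x $ (SOME i. True)"
    using x by (auto simp: interior_pts_def)
  note ci = chart_inverse[OF A c(1)] and di = chart_inverse[OF A d(1)]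
  let ?S = "snd c ` (fst c \<inter> fst d) \<inter> {y. 0 < y $ (SOME i. True)}"
  let ?\<phi> = "snd d \<circ> cinv c"
  have "open ?S" by (rule open_chart_image[OF A c(1) di(7)])
  moreover have "continuous_on ?S ?\<phi>"
  proof (rule continuous_on_compose)
    show "continuous_on ?S (cinv c)"
      by (rule continuous_on_subset[OF ci(6)]) (auto simp: cimg_def)
    show "continuous_on (cinv c ` ?S) (snd d)"
      by (rule continuous_on_subset[OF di(5)]) (use ci(1) in auto)
  qed
  moreover have "inj_on ?\<phi> ?S"
  proof (rule inj_onI)
    fix y z assume "y \<in> ?S" "z \<in> ?S" and eq: "?\<phi> y = ?\<phi> z"
    then obtain a b where ab: "a \<in> fst c \<inter> fst d" "b \<in> fst c \<inter> fst d" "y = snd c a" "z = snd c b" by blast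
    then have "snd d a = snd d b" using eq ci(1) by simp
    then have "a = b" using di(1) ab by (metis IntD2)
    then show "y = z" using ab by simp
  qed
  ultimately have "open (?\<phi> ` ?S)" by (intro invariance_of_domain)
  moreover have "snd d x \<in> ?\<phi> ` ?S"
    using c d ci(1) by (intro image_eqI[of _ _ "snd c x"]) auto
  moreover have "?\<phi> ` ?S \<subseteq> half_space"
    using cimg_subset_half_space[OF A d(1)] di(4) ci(1) by fastforce
  ultimately have "snd d x \<in> interior half_space" using interior_maximal by blast
  also have "half_space = {y :: real ^ 'n. axis (SOME i. True) 1 \<bullet> y \<ge> 0}"
    by (simp add: half_space_def inner_axis')
  also have "interior \<dots> = {y. axis (SOME i. True) 1 \<bullet> y > 0}"
    by (rule interior_halfspace_ge) (simp add: axis_eq_0_iff)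
  finally show ?thesis by (simp add: inner_axis')
qed

lemma riemannian_metric_pos:
  assumes "riemannian_metric \<A> g" "c \<in> \<A>" "y \<in> cimg c"
  shows "transpose (g c y) = g c y" "v \<noteq> 0 \<Longrightarrow> 0 < v \<bullet> (g c y *v v)"
  using assms by (auto simp: riemannian_metric_def)

text \<open>Positivity of \<open>G\<close> forces \<open>J\<close> to be injective, so
  \<open>J\<^sup>T\<close> can be cancelled from \<open>G w = J\<^sup>T q\<close>. This gives
  \<open>H (J w) = q\<close>: the raised covector transforms by \<open>J\<close>.\<close>

lemma conorm_congruence:
  fixes G H J :: "real ^ 'n::finite ^ 'n"
  assumes G: "\<And>v. v \<noteq> 0 \<Longrightarrow> 0 < v \<bullet> (G *v v)" and H: "\<And>v. v \<noteq> 0 \<Longrightarrow> 0 < v \<bullet> (H *v v)"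
    and J: "G = transpose J ** H ** J"
  shows "conorm G (transpose J *v q) = conorm H q"
proof -
  define w where "w = matrix_inv G *v (transpose J *v q)"
  have Gv: "G *v v = transpose J *v (H *v (J *v v))" for v
    unfolding J by (simp only: matrix_vector_mul_assoc[symmetric])
  have "inj ((*v) J)"
  proof (rule injI)
    fix v w assume "J *v v = J *v w"
    then have "J *v (v - w) = 0" by (simp add: matrix_vector_mult_diff_distrib)
    then have "(v - w) \<bullet> (G *v (v - w)) = 0" by (simp add: Gv)
    then show "v = w" using G[of "v - w"] by fastforce
  qed
  then have "invertible J" by (metis invertible_left_inverse matrix_left_invertible_injective)
  then have "invertible (transpose J)" by (rule transpose_invertible)
  then have inj: "inj ((*v) (transpose J))" by (rule inj_matrix_vector_mult)
  have "G *v w = transpose J *v q" unfolding w_def by (rule matrix_inv_mult_pos_def(1)[OF G])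
  then have "H *v (J *v w) = q" using inj by (simp only: Gv inj_eq)
  then have "matrix_inv H *v q = J *v w" by (intro matrix_inv_mult_pos_def(2) H)
  moreover have "(transpose J *v q) \<bullet> w = q \<bullet> (J *v w)"
    by (metis dot_lmul_matrix transpose_matrix_vector)
  ultimately show ?thesis unfolding conorm_def w_def[symmetric] by simp
qed

text \<open>The estimate is proved in one chart near each point but claimed in all of them. The
  chain rule for the transition map shows that gradients transform as covectors, and the conorm is
  invariant under that law.\<close>

lemma conorm_grad_chart_independent:
  fixes \<A> :: "('a::t2_space, 'n::finite) chart set"
  assumes A: "smooth_atlas \<A>" and g: "riemannian_metric \<A> g" and x: "x \<in> interior_pts \<A>"
    and c: "c \<in> \<A>" "x \<in> fst c" and d: "d \<in> \<A>" "x \<in> fst d"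
    and u: "((u \<circ> cinv d) has_derivative u') (at (snd d x))"
  shows "conorm (g c (snd c x)) (grad c u (snd c x)) = conorm (g d (snd d x)) (grad d u (snd d x))"
proof -
  note ci = chart_inverse[OF A c(1)] and di = chart_inverse[OF A d(1)]
  let ?y = "snd c x" and ?N = "snd c ` (fst c \<inter> fst d)" and ?\<phi> = "snd d \<circ> cinv c"
  let ?P = "{y :: real ^ 'n. 0 < y $ (SOME i. True)}"
  have yN: "?y \<in> ?N \<inter> ?P" using c d interior_pts_coordinate_pos[OF A x c] by auto
  have opN: "open (?N \<inter> ?P)" by (rule open_chart_image[OF A c(1) di(7)])
  then have intN: "?y \<in> interior ?N" using yN by (meson inf_le1 interior_maximal subsetD)
  moreover have "?N \<subseteq> cimg c" by (auto simp: cimg_def)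
  ultimately have intc: "?y \<in> interior (cimg c)" using interior_mono by blast
  have "snd d x \<in> snd d ` (fst d \<inter> UNIV) \<inter> ?P" using d interior_pts_coordinate_pos[OF A x d] by auto
  moreover have "open (snd d ` (fst d \<inter> UNIV) \<inter> ?P)" by (rule open_chart_image[OF A d(1) open_UNIV])
  moreover have "snd d ` (fst d \<inter> UNIV) \<inter> ?P \<subseteq> cimg d" by (auto simp: cimg_def)
  ultimately have intd: "snd d x \<in> interior (cimg d)" by (meson interior_maximal subsetD)
  have \<phi>y: "?\<phi> ?y = snd d x" using ci(1) c by simp
  have "smooth_on ?N ?\<phi>" using A c(1) d(1) by (simp add: smooth_atlas_def)
  from this[unfolded smooth_on_def, rule_format, OF IntD1[OF yN]]
  obtain U h where U: "open U" "?y \<in> U" "\<forall>k. Ck_open k U h" "\<And>y. y \<in> U \<inter> ?N \<Longrightarrow> h y = ?\<phi> y"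
    by blast
  have "h differentiable (at ?y)" using U(2) U(3)[rule_format, of "Suc 0"] by simp
  then have "(h has_derivative frechet_derivative h (at ?y)) (at ?y)"
    by (simp add: frechet_derivative_works[symmetric])
  then have d\<phi>: "(?\<phi> has_derivative frechet_derivative h (at ?y)) (at ?y)"
  proof (rule has_derivative_transform_within_open)
    show "open (U \<inter> (?N \<inter> ?P))" using U opN by blast
  qed (use U(2,4) yN in auto)
  define J where "J = transition_jacobian c d x"
  have "J = matrix (frechet_derivative h (at ?y))"
    using frechet_derivative_at[OF d\<phi>] at_within_interior[OF intN]
    by (simp add: J_def transition_jacobian_def jacobian_def)
  then have J: "frechet_derivative h (at ?y) v = J *v v" for v
    using has_derivative_linear[OF d\<phi>] by (simp add: matrix_works linear_conv_bounded_linear[symmetric])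
  have "((\<lambda>y. (u \<circ> cinv d) (?\<phi> y)) has_derivative (\<lambda>v. u' (J *v v))) (at ?y)"
    using has_derivative_compose[OF d\<phi>, of "u \<circ> cinv d" u'] u by (simp add: \<phi>y J del: o_apply)
  then have "((u \<circ> cinv c) has_derivative (\<lambda>v. u' (J *v v))) (at ?y)"
  proof (rule has_derivative_transform_within_open[OF _ opN yN])
    fix y assume "y \<in> ?N \<inter> ?P"
    then obtain a where "a \<in> fst c" "a \<in> fst d" "y = snd c a" by blast
    then show "(u \<circ> cinv d) (?\<phi> y) = (u \<circ> cinv c) y" using ci(1) di(1) by simp
  qed
  then have "grad c u ?y \<bullet> v = u' (J *v v)" for v
    unfolding grad_def by (rule pdv_interior[OF intc])
  moreover have "grad d u (snd d x) \<bullet> (J *v v) = u' (J *v v)" for v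
    unfolding grad_def by (rule pdv_interior[OF intd u])
  moreover have "(transpose J *v q) \<bullet> v = q \<bullet> (J *v v)" for q v
    by (metis dot_lmul_matrix transpose_matrix_vector)
  ultimately have "grad c u ?y \<bullet> v = (transpose J *v grad d u (snd d x)) \<bullet> v" for v by metis
  then have "grad c u ?y = transpose J *v grad d u (snd d x)" by (metis vector_eq_rdot)
  moreover have "g c ?y = transpose J ** g d (snd d x) ** J"
    using g c d unfolding riemannian_metric_def J_def Let_def by blast
  moreover have "?y \<in> cimg c" "snd d x \<in> cimg d" using ci(4) di(4) c d by auto
  ultimately show ?thesis
    using conorm_congruence[OF riemannian_metric_pos(2)[OF g c(1)] riemannian_metric_pos(2)[OF g d(1)]] by metis
qed

text \<open>The straight coordinate segment is an admissible competitor, of length at most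
  \<open>sqrt m\<close> times its Euclidean length. As \<open>m \<ge> 1\<close>, the cruder factor
  \<open>m\<close> avoids the root.\<close>

lemma geodesic_dist_le_coordinate_dist:
  assumes B: "convex B" "B \<subseteq> cimg c" and c: "c \<in> \<A>" and yz: "y \<in> B" "z \<in> B"
    and up: "\<And>w v. w \<in> B \<Longrightarrow> v \<bullet> (g c w *v v) \<le> m * (v \<bullet> v)" and m: "1 \<le> m"
  shows "geodesic_dist \<A> g (cinv c y) (cinv c z) \<le> ereal (m * norm (z - y))"
proof -
  define \<sigma> where "\<sigma> t = y + t *\<^sub>R (z - y)" for t :: real
  have \<sigma>B: "\<sigma> t \<in> B" if "t \<in> {0..1}" for t
    using B(1) yz that unfolding convex_alt by (simp add: \<sigma>_def algebra_simps)
  have d\<sigma>: "(\<sigma> has_vector_derivative (z - y)) (at t)" for t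
    unfolding \<sigma>_def[abs_def] by (auto intro!: derivative_eq_intros)
  let ?I = "integral {0..1} (\<lambda>t. vnorm (g c (\<sigma> t)) (vector_derivative \<sigma> (at t)))"
  have "joined_by \<A> g (cinv c y) (cinv c (\<sigma> 1)) (0 + ?I)"
  proof (rule joined_by.piece[OF joined_by.const c])
    show "\<sigma> C1_differentiable_on {0..1}"
      unfolding C1_differentiable_on_def
      using d\<sigma> by (intro exI[of _ "\<lambda>_. z - y"]) auto
    show "\<sigma> ` {0..1} \<subseteq> cimg c" using \<sigma>B B by blast
  qed (simp_all add: \<sigma>_def)
  then have j: "joined_by \<A> g (cinv c y) (cinv c z) ?I" by (simp add: \<sigma>_def)
  have le: "vnorm (g c (\<sigma> t)) (vector_derivative \<sigma> (at t)) \<le> m * norm (z - y)" if "t \<in> {0..1}" for t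
  proof -
    have "(z - y) \<bullet> (g c (\<sigma> t) *v (z - y)) \<le> m * ((z - y) \<bullet> (z - y))" by (rule up[OF \<sigma>B[OF that]])
    also have "\<dots> \<le> m * (m * ((z - y) \<bullet> (z - y)))"
      using m mult_right_mono[of 1 m "(z - y) \<bullet> (z - y)"] by (intro mult_left_mono) auto
    also have "\<dots> = (m * norm (z - y))\<^sup>2"
      by (simp add: power_mult_distrib power2_norm_eq_inner power2_eq_square mult_ac dot_square_norm)
    finally show ?thesis
      using m by (simp add: vnorm_def vector_derivative_at[OF d\<sigma>] real_le_lsqrt)
  qed
  have "?I \<le> m * norm (z - y)"
  proof (cases "(\<lambda>t. vnorm (g c (\<sigma> t)) (vector_derivative \<sigma> (at t))) integrable_on {0..1}")
    case True
    have "?I \<le> integral {0..1} (\<lambda>_::real. m * norm (z - y))"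
      by (rule Henstock_Kurzweil_Integration.integral_le[OF True]) (use le in auto)
    then show ?thesis by simp
  next
    case False
    \<comment> \<open>The integral of a non-integrable function is \<open>0\<close> by convention,
      so the bound also holds in this case and integrability need not be decided.\<close>
    then have "?I = 0" by (rule not_integrable_integral)
    then show ?thesis using m by simp
  qed
  moreover have "geodesic_dist \<A> g (cinv c y) (cinv c z) \<le> ereal ?I"
    unfolding geodesic_dist_def by (rule INF_lower) (use j in simp)
  ultimately show ?thesis by (meson ereal_less_eq(3) order_trans)
qed

text \<open>This is where the inclusion of the geodesic ball in the interior enters. Points of the
  coordinate ball lying in the half-space are closer than \<open>r\<close> to the centre, hence
  interior, hence have positive coordinate. A ball containing a point beyond the boundary would also
  contain a boundary point.\<close>

lemma coordinate_ball_in_interior: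
  fixes \<A> :: "('a::t2_space, 'n::finite) chart set"
  assumes A: "smooth_atlas \<A>" and c: "c \<in> \<A>" and x0: "x0 \<in> interior_pts \<A>" "x0 \<in> fst c"
    and sub: "ball (snd c x0) \<rho> \<inter> half_space \<subseteq> cimg c"
    and up: "\<And>w v. w \<in> ball (snd c x0) \<rho> \<inter> half_space \<Longrightarrow> v \<bullet> (g c w *v v) \<le> m * (v \<bullet> v)" and m: "1 \<le> m"
    and r: "m * \<rho> \<le> r" and gb: "geodesic_ball \<A> g x0 r \<subseteq> interior_pts \<A>"
    and z: "z \<in> ball (snd c x0) \<rho>"
  shows "z \<in> cimg c" "cinv c z \<in> interior_pts \<A>" "0 < z $ (SOME i. True)"
proof -
  let ?y = "snd c x0" and ?i = "SOME i :: 'n. True"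
  note ci = chart_inverse[OF A c]
  have y0: "0 < ?y $ ?i" by (rule interior_pts_coordinate_pos[OF A x0(1) c x0(2)])
  have cvx: "convex (ball ?y \<rho> \<inter> half_space)"
  proof (rule convex_Int[OF convex_ball])
    have eq: "half_space = {y :: real ^ 'n. axis ?i 1 \<bullet> y \<ge> 0}"
      by (simp add: half_space_def inner_axis')
    show "convex (half_space :: (real ^ 'n) set)" unfolding eq by (rule convex_halfspace_ge)
  qed
  have step: "w \<in> cimg c \<and> cinv c w \<in> interior_pts \<A> \<and> 0 < w $ ?i"
    if w: "w \<in> ball ?y \<rho>" "0 \<le> w $ ?i" for w
  proof -
    have wB: "w \<in> ball ?y \<rho> \<inter> half_space" using w by (simp add: half_space_def)
    have \<rho>: "0 < \<rho>" using w(1) by (metis ball_eq_empty empty_iff not_le)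
    have yB: "?y \<in> ball ?y \<rho> \<inter> half_space" using y0 \<rho> by (simp add: half_space_def)
    have "geodesic_dist \<A> g (cinv c ?y) (cinv c w) \<le> ereal (m * norm (w - ?y))"
      by (rule geodesic_dist_le_coordinate_dist[OF cvx sub c yB wB _ m]) (rule up)
    moreover have "m * norm (w - ?y) < m * \<rho>"
      using w(1) m by (simp add: dist_norm norm_minus_commute)
    ultimately have "geodesic_dist \<A> g x0 (cinv c w) < ereal r"
      using r ci(1)[OF x0(2)] by (metis ereal_less_eq(3) le_less_trans less_ereal.simps(1) less_le_trans)
    then have int: "cinv c w \<in> interior_pts \<A>" using gb by (auto simp: geodesic_ball_def)
    have wc: "w \<in> cimg c" using sub wB by blast
    then have "0 < snd c (cinv c w) $ ?i"
      using interior_pts_coordinate_pos[OF A int c] ci(3) by blast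
    then show ?thesis using wc int ci(2)[OF wc] by simp
  qed
  have "0 \<le> z $ ?i"
  proof (rule ccontr)
    assume neg: "\<not> 0 \<le> z $ ?i"
    \<comment> \<open>The parameter at which the segment from the centre to \<open>z\<close> meets
      the boundary hyperplane; the meeting point contradicts \<open>step\<close>.\<close>
    define t where "t = ?y $ ?i / (?y $ ?i - z $ ?i)"
    define w where "w = (1 - t) *\<^sub>R ?y + t *\<^sub>R z"
    have t: "0 \<le> t" "t \<le> 1" using y0 neg by (auto simp: t_def)
    have "?y \<in> ball ?y \<rho>" using z by (metis centre_in_ball ball_eq_empty empty_iff not_le)
    then have "w \<in> ball ?y \<rho>" using t z convex_ball[of ?y \<rho>] unfolding convex_alt w_def by blast
    moreover have "w $ ?i = 0" using y0 neg by (simp add: w_def t_def field_simps)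
    ultimately show False using step[of w] by simp
  qed
  with step[OF z] show "z \<in> cimg c" "cinv c z \<in> interior_pts \<A>" "0 < z $ ?i" by auto
qed

text \<open>Compactness of a closed half-ball bounds the metric and the derivative of a smooth local
  extension \<open>h\<close> of it; everything is merged into one constant \<open>m\<close>. The
  radius is written \<open>2 a\<close> so that balls of radius at most \<open>a\<close> about points
  of the ball of radius \<open>a\<close> are covered.\<close>

lemma local_metric_constants:
  fixes \<A> :: "('a::t2_space, 'n::finite) chart set"
  assumes A: "smooth_atlas \<A>" and g: "riemannian_metric \<A> g" and c: "c \<in> \<A>" "x \<in> fst c"
  obtains a m where "0 < a" "1 \<le> m" "ball (snd c x) (2 * a) \<inter> half_space \<subseteq> cimg c"
    "\<And>w v. w \<in> ball (snd c x) (2 * a) \<inter> half_space \<Longrightarrow> v \<bullet> v \<le> m * (v \<bullet> (g c w *v v))"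
    "\<And>w v. w \<in> ball (snd c x) (2 * a) \<inter> half_space \<Longrightarrow> v \<bullet> (g c w *v v) \<le> m * (v \<bullet> v)"
    "\<And>w z v. w \<in> ball (snd c x) (2 * a) \<inter> half_space \<Longrightarrow> z \<in> ball (snd c x) (2 * a) \<inter> half_space \<Longrightarrow>
      \<bar>v \<bullet> (g c w *v v) - v \<bullet> (g c z *v v)\<bar> \<le> m * norm (w - z) * (v \<bullet> v)"
    "\<And>w k i j. w \<in> ball (snd c x) (2 * a) \<Longrightarrow> w \<in> interior (cimg c) \<Longrightarrow> \<bar>christoffel g c w k i j\<bar> \<le> m"
proof -
  let ?y = "snd c x"
  have yc: "?y \<in> cimg c" using c by (simp add: cimg_def)
  have "smooth_on (cimg c) (g c)" using g c(1) by (simp add: riemannian_metric_def)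
  from this[unfolded smooth_on_def, rule_format, OF yc]
  obtain U h where U: "open U" "?y \<in> U" "\<forall>k. Ck_open k U h" "\<And>w. w \<in> U \<inter> cimg c \<Longrightarrow> h w = g c w"
    by blast
  have "openin (top_of_set half_space) (cimg c)" using A c(1) by (simp add: smooth_atlas_def)
  then obtain W where W: "open W" "cimg c = half_space \<inter> W" by (auto simp: openin_open)
  have "open (U \<inter> W)" "?y \<in> U \<inter> W" using U W yc by auto
  then obtain e where e: "0 < e" "cball ?y e \<subseteq> U \<inter> W" by (meson open_contains_cball)
  let ?B = "cball ?y e"
  have BU: "?B \<subseteq> U" and Bc: "?B \<inter> half_space \<subseteq> cimg c" using e(2) W(2) by auto
  have hg: "h w = g c w" if "w \<in> ?B \<inter> half_space" for w using U(4) BU Bc that by blast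
  let ?D = "\<lambda>w. frechet_derivative h (at w)"
  have Ck1: "\<forall>w\<in>U. h differentiable (at w)" "\<forall>v. continuous_on U (\<lambda>w. ?D w v)"
    using U(3)[rule_format, of "Suc 0"] by auto
  have hd: "(h has_derivative ?D w) (at w)" if "w \<in> U" for w
    using Ck1(1) that by (simp add: frechet_derivative_works[symmetric])
  \<comment> \<open>Continuity of the derivative is given direction by direction, so its operator
    bound is assembled from the values on the basis vectors.\<close>
  have "continuous_on ?B (\<lambda>w. \<Sum>i\<in>UNIV. norm (?D w (axis i 1)))"
    using Ck1(2) BU by (intro continuous_intros) (blast intro: continuous_on_subset)
  then have "bounded ((\<lambda>w. \<Sum>i\<in>UNIV. norm (?D w (axis i 1))) ` ?B)"
    by (intro compact_imp_bounded compact_continuous_image compact_cball)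
  then obtain b where b: "0 < b" "\<And>w. w \<in> ?B \<Longrightarrow> \<bar>\<Sum>i\<in>UNIV. norm (?D w (axis i 1))\<bar> \<le> b"
    by (auto simp: bounded_pos)
  have Db1: "norm (?D w (axis i 1)) \<le> b" if "w \<in> ?B" for w i
  proof -
    have "norm (?D w (axis i 1)) \<le> (\<Sum>i\<in>UNIV. norm (?D w (axis i 1)))"
      by (rule member_le_sum) auto
    then show ?thesis using b(2)[OF that] by linarith
  qed
  have Db: "norm (?D w v) \<le> b * norm v" if "w \<in> ?B" for w v
  proof -
    have lin: "linear (?D w)" using hd[of w] BU that has_derivative_linear by blast
    have "v = (\<Sum>i\<in>UNIV. v $ i *\<^sub>R axis i 1)"
      using basis_expansion[of v] by (simp add: scalar_mult_eq_scaleR)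
    then have "?D w v = ?D w (\<Sum>i\<in>UNIV. v $ i *\<^sub>R axis i 1)" by simp
    also have "\<dots> = (\<Sum>i\<in>UNIV. v $ i *\<^sub>R ?D w (axis i 1))"
      using lin by (simp add: linear_sum linear_cmul)
    also have "norm \<dots> \<le> (\<Sum>i\<in>UNIV. norm v * norm (?D w (axis i 1)))"
      by (intro order_trans[OF norm_sum] sum_mono) (auto intro: mult_right_mono component_le_norm_cart)
    also have "\<dots> = norm v * (\<Sum>i\<in>UNIV. norm (?D w (axis i 1)))" by (simp add: sum_distrib_left)
    also have "\<dots> \<le> norm v * b" using b(2)[OF that] by (intro mult_left_mono) auto
    finally show ?thesis by (simp add: mult.commute)
  qed
  have lip: "norm (h w - h z) \<le> b * norm (w - z)" if "w \<in> ?B" "z \<in> ?B" for w z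
  proof (rule differentiable_bound[OF convex_cball _ _ that])
    show "(h has_derivative ?D w) (at w within ?B)" if "w \<in> ?B" for w
      using hd BU that by (meson has_derivative_at_withinI subsetD)
    show "onorm (?D w) \<le> b" if "w \<in> ?B" for w
      using Db[OF that] b(1) by (intro onorm_bound) auto
  qed
  let ?n = "real CARD('n)"
  have lipq: "\<bar>v \<bullet> (g c w *v v) - v \<bullet> (g c z *v v)\<bar> \<le> ?n\<^sup>2 * b * norm (w - z) * (v \<bullet> v)"
    if wz: "w \<in> ?B \<inter> half_space" "z \<in> ?B \<inter> half_space" for w z v
  proof -
    have "\<bar>(h w - h z) $ i $ j\<bar> \<le> b * norm (w - z)" for i j
    proof -
      have "\<bar>(h w - h z) $ i $ j\<bar> \<le> norm ((h w - h z) $ i)" by (rule component_le_norm_cart)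
      also have "\<dots> \<le> norm (h w - h z)" by (rule Finite_Cartesian_Product.norm_nth_le)
      also have "\<dots> \<le> b * norm (w - z)" using lip wz by blast
      finally show ?thesis .
    qed
    from quadratic_form_bound[OF this, of v] show ?thesis
      using hg[OF wz(1)] hg[OF wz(2)]
      by (simp add: matrix_vector_mult_diff_rdistrib inner_diff_right mult_ac)
  qed
  let ?S = "(?B \<inter> half_space) \<times> sphere (0 :: real ^ 'n) 1"
  let ?q = "\<lambda>z. snd z \<bullet> (h (fst z) *v snd z)"
  have "closed (half_space :: (real ^ 'n) set)"
  proof -
    have eq: "half_space = {y :: real ^ 'n. axis (SOME i. True) 1 \<bullet> y \<ge> 0}"
      by (simp add: half_space_def inner_axis')
    show ?thesis unfolding eq by (rule closed_halfspace_ge)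
  qed
  then have cS: "compact ?S" by (intro compact_Times compact_Int_closed compact_cball) auto
  have conth: "continuous_on ?B h"
    using hd BU by (meson continuous_at_imp_continuous_on has_derivative_continuous subsetD)
  have contq: "continuous_on ?S ?q"
    unfolding inner_vec_def matrix_vector_mult_def
    by (intro continuous_intros continuous_on_compose2[OF conth]) (auto intro!: continuous_intros continuous_on_compose2[OF conth])
  have "axis undefined 1 \<in> sphere (0 :: real ^ 'n) 1" by simp
  moreover have "?y \<in> ?B \<inter> half_space" using e yc W(2) by auto
  ultimately have neS: "?S \<noteq> {}" by blast
  obtain z1 where z1: "z1 \<in> ?S" "\<And>z. z \<in> ?S \<Longrightarrow> ?q z1 \<le> ?q z"
    using continuous_attains_inf[OF cS neS contq] by blast
  obtain z2 where z2: "z2 \<in> ?S" "\<And>z. z \<in> ?S \<Longrightarrow> ?q z \<le> ?q z2"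
    using continuous_attains_sup[OF cS neS contq] by blast
  have "0 < ?q z1"
  proof -
    have "fst z1 \<in> ?B \<inter> half_space" "norm (snd z1) = 1" using z1(1) by auto
    moreover from this(2) have "snd z1 \<noteq> 0" by auto
    ultimately show ?thesis
      using riemannian_metric_pos(2)[OF g c(1), of "fst z1" "snd z1"] hg Bc by auto
  qed
  \<comment> \<open>Homogeneity extends the extreme values on the unit sphere to all
    vectors.\<close>
  have hom: "?q z1 * (v \<bullet> v) \<le> v \<bullet> (g c w *v v) \<and> v \<bullet> (g c w *v v) \<le> ?q z2 * (v \<bullet> v)"
    if w: "w \<in> ?B \<inter> half_space" for w v
  proof (cases "v = 0")
    case False
    let ?v = "(1 / norm v) *\<^sub>R v"
    have "(w, ?v) \<in> ?S" using w False by simp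
    from z1(2)[OF this] z2(2)[OF this]
    have "?q z1 \<le> ?v \<bullet> (g c w *v ?v) \<and> ?v \<bullet> (g c w *v ?v) \<le> ?q z2"
      using hg[OF w] by simp
    moreover have "?v \<bullet> (g c w *v ?v) = (v \<bullet> (g c w *v v)) / (norm v)\<^sup>2"
      by (simp add: matrix_vector_mult_scaleR power2_eq_square)
    moreover have "0 < (norm v)\<^sup>2" using False by simp
    ultimately show ?thesis
      by (simp add: pos_le_divide_eq pos_divide_le_eq power2_norm_eq_inner)
  qed simp
  define m0 where "m0 = max 1 (max (1 / ?q z1) (?q z2))"
  have m0: "1 \<le> m0" "1 / ?q z1 \<le> m0" "?q z2 \<le> m0" by (auto simp: m0_def)
  have low: "v \<bullet> v \<le> m0 * (v \<bullet> (g c w *v v))" and up: "v \<bullet> (g c w *v v) \<le> m0 * (v \<bullet> v)"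
    if w: "w \<in> ?B \<inter> half_space" for w v
  proof -
    have "v \<bullet> v = (1 / ?q z1) * (?q z1 * (v \<bullet> v))" using \<open>0 < ?q z1\<close> by simp
    also have "\<dots> \<le> (1 / ?q z1) * (v \<bullet> (g c w *v v))"
      using hom[OF w, of v] \<open>0 < ?q z1\<close> by (intro mult_left_mono) auto
    also have "\<dots> \<le> m0 * (v \<bullet> (g c w *v v))"
      using hom[OF w, of v] m0 \<open>0 < ?q z1\<close> by (intro mult_right_mono) (auto intro: order_trans[rotated])
    finally show "v \<bullet> v \<le> m0 * (v \<bullet> (g c w *v v))" .
    have "?q z2 * (v \<bullet> v) \<le> m0 * (v \<bullet> v)" using m0 by (intro mult_right_mono) auto
    then show "v \<bullet> (g c w *v v) \<le> m0 * (v \<bullet> v)" using hom[OF w, of v] by linarith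
  qed
  have chr: "\<bar>christoffel g c w k i j\<bar> \<le> ?n * (m0 * (3 * b))"
    if w: "w \<in> ?B" "w \<in> interior (cimg c)" for w k i j
  proof -
    have wc: "w \<in> cimg c" using w(2) interior_subset by blast
    then have wB: "w \<in> ?B \<inter> half_space" using w(1) W(2) by blast
    have pd: "\<bar>pdv (cimg c) (\<lambda>w. g c w $ r $ s) w $ t\<bar> \<le> b" for r s t
    proof -
      have "((\<lambda>w. h w $ r $ s) has_derivative (\<lambda>v. ?D w v $ r $ s)) (at w)"
        using hd[of w] BU w(1)
        by (intro bounded_linear.has_derivative[OF bounded_linear_vec_nth]) auto
      then have "((\<lambda>w. g c w $ r $ s) has_derivative (\<lambda>v. ?D w v $ r $ s)) (at w)"
      proof (rule has_derivative_transform_within_open)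
        show "open (U \<inter> interior (cimg c))" using U(1) by blast
        show "w \<in> U \<inter> interior (cimg c)" using BU w by blast
        show "h z $ r $ s = g c z $ r $ s" if "z \<in> U \<inter> interior (cimg c)" for z
          using U(4)[of z] that interior_subset[of "cimg c"] by auto
      qed
      from pdv_interior[OF w(2) this, of "axis t 1"]
      have "pdv (cimg c) (\<lambda>w. g c w $ r $ s) w $ t = ?D w (axis t 1) $ r $ s" by (simp add: inner_axis)
      moreover have "\<bar>?D w (axis t 1) $ r $ s\<bar> \<le> norm (?D w (axis t 1))"
        using component_le_norm_cart[of "?D w (axis t 1) $ r" s] Finite_Cartesian_Product.norm_nth_le[of "?D w (axis t 1)" r] by linarith
      ultimately show ?thesis using Db1[OF w(1), of t] by linarith
    qed
    have inv: "\<bar>matrix_inv (g c w) $ k $ l\<bar> \<le> m0" for l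
    proof -
      have "norm (matrix_inv (g c w) *v axis l 1) \<le> m0 * norm (axis l 1 :: real ^ 'n)"
        by (rule matrix_inv_bounds(1)[OF riemannian_metric_pos(1)[OF g c(1) wc] _ low[OF wB] up[OF wB]])
          (use m0 in simp)
      moreover have "matrix_inv (g c w) $ k $ l = (matrix_inv (g c w) *v axis l 1) $ k"
        by (simp add: matrix_vector_mult_basis column_def)
      ultimately show ?thesis
        using component_le_norm_cart[of "matrix_inv (g c w) *v axis l 1" k] by simp
    qed
    have "\<bar>christoffel g c w k i j\<bar> \<le> (\<Sum>l\<in>(UNIV :: 'n set). m0 * (3 * b))"
    proof -
      have "\<bar>christoffel g c w k i j\<bar> \<le> \<bar>\<Sum>l\<in>UNIV. matrix_inv (g c w) $ k $ l *
        (pdv (cimg c) (\<lambda>w. g c w $ j $ l) w $ i + pdv (cimg c) (\<lambda>w. g c w $ i $ l) w $ j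
         - pdv (cimg c) (\<lambda>w. g c w $ i $ j) w $ l)\<bar>"
        unfolding christoffel_def by simp
      also have "\<dots> \<le> (\<Sum>l\<in>(UNIV :: 'n set). m0 * (3 * b))"
      proof (rule order_trans[OF sum_abs sum_mono])
        fix l
        have "\<bar>pdv (cimg c) (\<lambda>w. g c w $ j $ l) w $ i + pdv (cimg c) (\<lambda>w. g c w $ i $ l) w $ j
         - pdv (cimg c) (\<lambda>w. g c w $ i $ j) w $ l\<bar> \<le> 3 * b"
          using pd[of j l i] pd[of i l j] pd[of i j l] by linarith
        then show "\<bar>matrix_inv (g c w) $ k $ l * (pdv (cimg c) (\<lambda>w. g c w $ j $ l) w $ i
          + pdv (cimg c) (\<lambda>w. g c w $ i $ l) w $ j - pdv (cimg c) (\<lambda>w. g c w $ i $ j) w $ l)\<bar> \<le> m0 * (3 * b)"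
          unfolding abs_mult using inv[of l] m0 by (intro mult_mono) auto
      qed
      finally show ?thesis .
    qed
    then show ?thesis by simp
  qed
  define m where "m = max m0 (max (?n\<^sup>2 * b) (?n * (m0 * (3 * b))))"
  have m: "m0 \<le> m" "?n\<^sup>2 * b \<le> m" "?n * (m0 * (3 * b)) \<le> m" by (auto simp: m_def)
  have sub: "ball ?y (2 * (e / 2)) \<subseteq> ?B" by auto
  show ?thesis
  proof (rule that[of "e / 2" m])
    show "0 < e / 2" "1 \<le> m" using e m0 m by auto
    show "ball ?y (2 * (e / 2)) \<inter> half_space \<subseteq> cimg c" using sub Bc by blast
    fix w assume w: "w \<in> ball ?y (2 * (e / 2)) \<inter> half_space"
    then have wB: "w \<in> ?B \<inter> half_space" using sub by blast
    show "v \<bullet> v \<le> m * (v \<bullet> (g c w *v v))" for v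
    proof -
      have "0 \<le> v \<bullet> (g c w *v v)"
        using hom[OF wB, of v] \<open>0 < ?q z1\<close> by (auto intro: order_trans[rotated])
      then have "m0 * (v \<bullet> (g c w *v v)) \<le> m * (v \<bullet> (g c w *v v))" using m by (intro mult_right_mono) auto
      then show ?thesis using low[OF wB, of v] by linarith
    qed
    show "v \<bullet> (g c w *v v) \<le> m * (v \<bullet> v)" for v
    proof -
      have "m0 * (v \<bullet> v) \<le> m * (v \<bullet> v)" using m by (intro mult_right_mono) auto
      then show ?thesis using up[OF wB, of v] by linarith
    qed
    fix z v assume "z \<in> ball ?y (2 * (e / 2)) \<inter> half_space"
    then have "z \<in> ?B \<inter> half_space" using sub by blast
    from lipq[OF wB this, of v]
    show "\<bar>v \<bullet> (g c w *v v) - v \<bullet> (g c z *v v)\<bar> \<le> m * norm (w - z) * (v \<bullet> v)"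
      by (rule order_trans) (use m(2) in \<open>intro mult_right_mono, auto\<close>)
  next
    fix w k i j assume "w \<in> ball ?y (2 * (e / 2))" "w \<in> interior (cimg c)"
    then show "\<bar>christoffel g c w k i j\<bar> \<le> m" using chr[of w k i j] m(3) sub by fastforce
  qed
qed

section \<open>Transfer to the manifold\<close>

lemma self_adjoint_imp_symmetric:
  fixes M :: "real ^ 'n::finite ^ 'n"
  assumes "\<And>v w. (M *v v) \<bullet> w = v \<bullet> (M *v w)"
  shows "transpose M = M"
proof -
  have "(transpose M *v v) \<bullet> w = (M *v v) \<bullet> w" for v w
    using assms by (metis dot_lmul_matrix transpose_matrix_vector)
  then have "transpose M *v v = M *v v" for v by (metis vector_eq_rdot)
  then show ?thesis unfolding matrix_eq by blast
qed

text \<open>The growth conditions are stated with the norm of \<open>g\<close>, the coordinate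
  estimate with the Euclidean one. For \<open>norm q \<ge> m R\<close> the covector lies in the
  regime of the conditions, and \<open>norm q \<ge> 1\<close> lets the constant 1 and the smaller
  exponent be absorbed into \<open>norm q powr \<gamma>'\<close>.\<close>

lemma growth_bound:
  fixes G :: "real ^ 'n::finite ^ 'n"
  assumes sym: "transpose G = G" and m: "1 \<le> m"
    and low: "\<And>x. x \<bullet> x \<le> m * (x \<bullet> (G *v x))" and up: "\<And>x. x \<bullet> (G *v x) \<le> m * (x \<bullet> x)"
    and q: "max (m * R) 1 \<le> norm q" and \<gamma>: "0 \<le> \<gamma>" "\<gamma> \<le> \<gamma>'"
  shows "R \<le> conorm G q" "1 + conorm G q powr \<gamma> \<le> 2 * m powr \<gamma>' * norm q powr \<gamma>'"
proof -
  have m0: "0 < m" using m by simp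
  note b = matrix_inv_bounds(2-4)[OF sym m0 low up, of q]
  have mm: "m * t \<le> m\<^sup>2 * t" if "0 \<le> t" for t
    using m that by (intro mult_right_mono) (auto simp: power2_eq_square)
  have "(norm q)\<^sup>2 \<le> (m * conorm G q)\<^sup>2"
    using b(2) mm[of "(conorm G q)\<^sup>2"] by (simp add: power_mult_distrib)
  then have "norm q \<le> m * conorm G q" using m b(3) by (intro power2_le_imp_le[of "norm q"]) auto
  then have "m * R \<le> m * conorm G q" using q by simp
  then show "R \<le> conorm G q" using m by simp
  have "(conorm G q)\<^sup>2 \<le> (m * norm q)\<^sup>2"
    using b(1) mm[of "(norm q)\<^sup>2"] by (simp add: power_mult_distrib)
  then have le: "conorm G q \<le> m * norm q" using m by (intro power2_le_imp_le[of "conorm G q"]) auto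
  have ge1: "1 \<le> m * norm q" using m q mult_mono[of 1 m 1 "norm q"] by simp
  have "conorm G q powr \<gamma> \<le> (m * norm q) powr \<gamma>" using le b(3) \<gamma> by (intro powr_mono2) auto
  also have "\<dots> \<le> (m * norm q) powr \<gamma>'" using ge1 \<gamma> by (intro powr_mono) auto
  finally have "conorm G q powr \<gamma> \<le> (m * norm q) powr \<gamma>'" .
  moreover have "1 \<le> (m * norm q) powr \<gamma>'" using ge1 \<gamma> by (intro ge_one_powr_ge_zero) auto
  moreover have "(m * norm q) powr \<gamma>' = m powr \<gamma>' * norm q powr \<gamma>'" using m by (simp add: powr_mult)
  ultimately show "1 + conorm G q powr \<gamma> \<le> 2 * m powr \<gamma>' * norm q powr \<gamma>'" by simp
qed

text \<open>Uniformity is the point: \<open>V\<close> and \<open>C\<close> are fixed before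
  \<open>u\<close>, \<open>x0\<close>, \<open>r\<close> and the chart \<open>d\<close>, depending on
  the solution only through \<open>K\<close>. This is what a compactness argument over base points
  requires.\<close>

lemma local_gradient_estimate:
  fixes \<A> :: "('a::t2_space, 'n::finite) chart set"
  assumes atlas: "smooth_atlas \<A>" and g: "riemannian_metric \<A> g"
    and p: "1 \<le> p" "p \<le> CARD('n)"
    and A: "smooth_symmetric_tensor_family \<A> A"
    and \<gamma>: "0 < \<gamma>" "\<gamma> < 2" and R: "0 < R" and K: "0 < K" and Om: "0 \<le> Om"
    and growth: "\<And>c x z q \<xi>. c \<in> \<A> \<Longrightarrow> x \<in> fst c \<Longrightarrow> R \<le> conorm (g c (snd c x)) q \<Longrightarrow> \<xi> \<noteq> 0 \<Longrightarrow> \<bar>z\<bar> \<le> K \<Longrightarrow>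
      \<bar>f c (snd c x) z q\<bar> \<le> Om * (1 + conorm (g c (snd c x)) q powr \<gamma>) \<and>
      \<bar>\<xi> \<bullet> (A c (snd c x) z q *v \<xi>)\<bar> / (vnorm (g c (snd c x)) \<xi> * vnorm (g c (snd c x)) \<xi>)
        \<le> Om * (1 + conorm (g c (snd c x)) q powr \<gamma>)"
    and c: "c \<in> \<A>" "x \<in> fst c"
  obtains V C where "open V" "x \<in> V" "0 < C"
    "\<And>u x0 r d. C3_interior \<A> u \<Longrightarrow> admissible_solution \<A> g p A f u \<Longrightarrow>
      (\<And>x. x \<in> interior_pts \<A> \<Longrightarrow> \<bar>u x\<bar> \<le> K) \<Longrightarrow> x0 \<in> V \<Longrightarrow> x0 \<in> interior_pts \<A> \<Longrightarrow>
      0 < r \<Longrightarrow> r < 1 \<Longrightarrow> geodesic_ball \<A> g x0 r \<subseteq> interior_pts \<A> \<Longrightarrow> d \<in> \<A> \<Longrightarrow> x0 \<in> fst d \<Longrightarrow>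
      conorm (g d (snd d x0)) (grad d u (snd d x0)) \<le> C / r"
proof -
  note ci = chart_inverse[OF atlas c(1)]
  let ?B = "\<lambda>a. ball (snd c x) (2 * a) \<inter> half_space"
  obtain a m where am: "0 < a" "1 \<le> m" "?B a \<subseteq> cimg c"
    and low: "\<And>w v. w \<in> ?B a \<Longrightarrow> v \<bullet> v \<le> m * (v \<bullet> (g c w *v v))"
    and up: "\<And>w v. w \<in> ?B a \<Longrightarrow> v \<bullet> (g c w *v v) \<le> m * (v \<bullet> v)"
    and lip: "\<And>w z v. w \<in> ?B a \<Longrightarrow> z \<in> ?B a \<Longrightarrow>
      \<bar>v \<bullet> (g c w *v v) - v \<bullet> (g c z *v v)\<bar> \<le> m * norm (w - z) * (v \<bullet> v)"
    and chr: "\<And>w k i j. w \<in> ball (snd c x) (2 * a) \<Longrightarrow> w \<in> interior (cimg c) \<Longrightarrow> \<bar>christoffel g c w k i j\<bar> \<le> m"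
    using local_metric_constants[OF atlas g c] by metis
  \<comment> \<open>The Christoffel part of the Hessian grows linearly in the gradient, so the error
    exponent must be at least 1; it remains below 2.\<close>
  define \<gamma>' where "\<gamma>' = max \<gamma> 1"
  have \<gamma>': "\<gamma> \<le> \<gamma>'" "1 \<le> \<gamma>'" "\<gamma>' < 2" using \<gamma> by (auto simp: \<gamma>'_def)
  define R' where "R' = max (m * R) 1"
  let ?n = "real CARD('n)"
  define X where "X = Om * (2 * m powr \<gamma>')"
  have X: "0 \<le> X" using Om by (simp add: X_def)
  \<comment> \<open>The first summand bounds the quadratic form of the Christoffel part, the second
    that of \<open>A\<close>.\<close>
  define cc where "cc = ?n\<^sup>2 * (?n * m) + X * m"
  have cc: "0 \<le> cc" "X \<le> cc"
  proof -
    have 0: "0 \<le> ?n\<^sup>2 * (?n * m)" using am by simp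
    moreover have "X * 1 \<le> X * m" using X am by (intro mult_left_mono) auto
    ultimately show "0 \<le> cc" "X \<le> cc" using X by (auto simp: cc_def)
  qed
  obtain \<Lambda> where \<Lambda>: "0 < \<Lambda>" and thr: "\<And>\<rho> L. 0 < \<rho> \<Longrightarrow> \<rho> \<le> 1 \<Longrightarrow> L = \<Lambda> / \<rho> \<Longrightarrow> 64 * K / \<rho> \<le> L \<and> 4 * R' \<le> L \<and>
      5 * K * m ^ 8 + 64 * m * K / \<rho>\<^sup>2 + 2 * cc * m * (2 * L) powr \<gamma>' \<le> L\<^sup>2 / (12 * K * m) / (4 * (real p)\<^sup>2) \<and>
      cc * (2 * L) powr \<gamma>' < L\<^sup>2 / (12 * K * m) / (4 * real p)"
    using gradient_bound_threshold[OF K am(2) p(1) \<gamma>'(3), of R' cc] by metis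
  \<comment> \<open>The coordinate radius will be \<open>\<rho> = \<epsilon> r\<close>:
    \<open>\<epsilon> \<le> a\<close> keeps it within the range of the local constants, and
    \<open>m \<epsilon> \<le> 1\<close> keeps the coordinate ball inside the geodesic ball.\<close>
  define \<epsilon> where "\<epsilon> = min a (1 / m)"
  have \<epsilon>m: "\<epsilon> \<le> 1 / m" "1 / m \<le> 1" using am by (auto simp: \<epsilon>_def)
  then have "\<epsilon> \<le> 1" by linarith
  moreover have "m * \<epsilon> \<le> 1" using \<epsilon>m am by (simp add: field_simps)
  ultimately have \<epsilon>: "0 < \<epsilon>" "\<epsilon> \<le> a" "m * \<epsilon> \<le> 1" "\<epsilon> \<le> 1"
    using am by (auto simp: \<epsilon>_def)
  define V where "V = fst c \<inter> snd c -` ball (snd c x) a"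
  show ?thesis
  \<comment> \<open>The coordinate bound is \<open>\<Lambda> / \<rho>\<close> with
    \<open>\<rho> = \<epsilon> r\<close>; the factor \<open>m\<close> passes from the Euclidean norm
    to the conorm.\<close>
  proof (rule that[of V "m * (\<Lambda> / \<epsilon>)"])
    show "open V" unfolding V_def by (intro continuous_open_preimage ci(5,7)) auto
    show "x \<in> V" using c am by (simp add: V_def)
    show "0 < m * (\<Lambda> / \<epsilon>)" using am \<epsilon> \<Lambda> by simp
    fix u x0 r d
    assume u: "C3_interior \<A> u" "admissible_solution \<A> g p A f u"
      and uK: "\<And>x. x \<in> interior_pts \<A> \<Longrightarrow> \<bar>u x\<bar> \<le> K"
      and x0: "x0 \<in> V" "x0 \<in> interior_pts \<A>" and r: "0 < r" "r < 1"
      and gb: "geodesic_ball \<A> g x0 r \<subseteq> interior_pts \<A>" and d: "d \<in> \<A>" "x0 \<in> fst d"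
    define y0 where "y0 = snd c x0"
    define \<rho> where "\<rho> = \<epsilon> * r"
    have x0c: "x0 \<in> fst c" and y0a: "y0 \<in> ball (snd c x) a" using x0 by (auto simp: V_def y0_def)
    have \<rho>a: "\<rho> \<le> a" and \<rho>1: "\<rho> \<le> 1" and m\<rho>: "m * \<rho> \<le> r" and \<rho>0: "0 < \<rho>"
    proof -
      have "\<epsilon> * r \<le> \<epsilon> * 1" using \<epsilon> r by (intro mult_left_mono) auto
      then have "\<rho> \<le> \<epsilon>" by (simp only: \<rho>_def mult_1_right)
      then show "\<rho> \<le> a" "\<rho> \<le> 1" using \<epsilon> by auto
      have "m * \<epsilon> * r \<le> 1 * r" using \<epsilon> r by (intro mult_right_mono) auto
      then show "m * \<rho> \<le> r" by (simp add: \<rho>_def mult.assoc)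
      show "0 < \<rho>" using \<epsilon> r by (simp add: \<rho>_def)
    qed
    define \<Omega> where "\<Omega> = ball y0 \<rho>"
    have \<Omega>2: "\<Omega> \<subseteq> ball (snd c x) (2 * a)"
    proof
      fix z assume "z \<in> \<Omega>"
      then have "dist (snd c x) z < 2 * a"
        using y0a \<rho>a dist_triangle[of "snd c x" z y0] by (simp add: \<Omega>_def)
      then show "z \<in> ball (snd c x) (2 * a)" by simp
    qed
    have pre: "z \<in> cimg c" "cinv c z \<in> interior_pts \<A>" "0 < z $ (SOME i. True)" if "z \<in> \<Omega>" for z
      using coordinate_ball_in_interior[OF atlas c(1) x0(2) x0c _ _ am(2) m\<rho> gb, of z] \<Omega>2 am(3) up that
      unfolding \<Omega>_def y0_def by blast+
    have zB: "z \<in> ?B a" if "z \<in> \<Omega>" for z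
      using \<Omega>2 pre(3)[OF that] that by (auto simp: half_space_def)
    have op: "open \<Omega>" and \<Omega>c: "\<Omega> \<subseteq> cimg c" using pre(1) by (auto simp: \<Omega>_def)
    have \<Omega>i: "z \<in> interior (cimg c)" if "z \<in> \<Omega>" for z using op \<Omega>c that by (meson interior_maximal subsetD)
    define v where "v = u \<circ> cinv c"
    define Du where "Du = grad c u"
    have Du: "Du = pdv (cimg c) v" by (rule ext) (simp add: Du_def grad_def v_def)
    define H where "H z = (\<chi> j i. pdv (cimg c) (\<lambda>w. Du w $ j) z $ i)" for z
    have C3: "\<exists>U h. open U \<and> z \<in> U \<and> Ck_open 3 U h \<and> (\<forall>y\<in>U \<inter> \<Omega>. h y = v y)" if z: "z \<in> \<Omega>" for z
    proof -
      have sub: "w \<in> snd c ` (fst c \<inter> interior_pts \<A>)" if "w \<in> \<Omega>" for w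
        using ci(2,3)[OF pre(1)[OF that]] pre(2)[OF that] by (intro image_eqI[of _ _ "cinv c w"]) auto
      have "Ck_on 3 (snd c ` (fst c \<inter> interior_pts \<A>)) v"
        using u(1) c(1) by (simp add: C3_interior_def v_def)
      from this[unfolded Ck_on_def, rule_format, OF sub[OF z]] show ?thesis using sub by blast
    qed
    note der = pdv_locally_C3[OF op \<Omega>c _ C3, folded Du, folded H_def]
    have Hsym: "transpose (H z) = H z" if z: "z \<in> \<Omega>" for z
    proof (rule self_adjoint_imp_symmetric)
      obtain e where e: "0 < e" "ball z e \<subseteq> \<Omega>" using op z open_contains_ball by blast
      show "(H z *v a) \<bullet> b = a \<bullet> (H z *v b)" for a b
        by (rule second_derivative_symmetric[OF e(1) der(1) der(2)[OF z]]) (use e(2) in auto)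
    qed
    define T where "T z = hess g c u z + A c z (v z) (Du z)" for z
    define S where "S z = T z - H z" for z
    have Asym: "transpose (A c z s q) = A c z s q" if "z \<in> \<Omega>" for z s q
      using A c(1) pre(1)[OF that] by (simp add: smooth_symmetric_tensor_family_def)
    define \<Gamma> where "\<Gamma> z = (\<chi> i j. \<Sum>k\<in>UNIV. christoffel g c z k i j * Du z $ k)" for z
    have gsym: "transpose (g c z) = g c z" if "z \<in> cimg c" for z
      by (rule riemannian_metric_pos(1)[OF g c(1) that])
    have \<Gamma>sym: "transpose (\<Gamma> z) = \<Gamma> z" if "z \<in> \<Omega>" for z
      using christoffel_symmetric[where g = g and c = c, OF pre(1)[OF that] gsym] by (simp add: \<Gamma>_def transpose_def vec_eq_iff)
    have hess: "hess g c u z = H z - \<Gamma> z" if "z \<in> \<Omega>" for z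
    proof -
      \<comment> \<open>\<open>hess\<close> and \<open>H\<close> order the two indices oppositely;
        the symmetry of second derivatives identifies them.\<close>
      have "hess g c u z = transpose (H z) - \<Gamma> z"
        by (simp add: hess_def H_def \<Gamma>_def Du_def transpose_def vec_eq_iff)
      then show ?thesis using Hsym[OF that] by simp
    qed
    have transpose_arith: "transpose (M - N + P) = transpose M - transpose N + transpose P"
      for M N P :: "real ^ 'n ^ 'n"
      by (simp add: transpose_def vec_eq_iff)
    have Tsym: "transpose (T z) = T z" if "z \<in> \<Omega>" for z
      by (simp only: T_def hess[OF that] transpose_arith Hsym[OF that] \<Gamma>sym[OF that] Asym[OF that])
    have S: "S z = A c z (v z) (Du z) - \<Gamma> z" if "z \<in> \<Omega>" for z
      by (simp add: S_def T_def hess[OF that])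
    have vK: "\<bar>v z\<bar> \<le> K" if "z \<in> \<Omega>" for z using uK pre(2)[OF that] by (simp add: v_def)
    have gr: "R \<le> conorm (g c z) (Du z)"
      "1 + conorm (g c z) (Du z) powr \<gamma> \<le> 2 * m powr \<gamma>' * norm (Du z) powr \<gamma>'"
      if "z \<in> \<Omega>" "R' \<le> norm (Du z)" for z
      using growth_bound[OF gsym[OF pre(1)[OF that(1)]] am(2) low[OF zB[OF that(1)]] up[OF zB[OF that(1)]], of R "Du z" \<gamma> \<gamma>']
        that \<gamma> \<gamma>' by (auto simp: R'_def)
    have fA: "\<bar>f c z (v z) (Du z)\<bar> \<le> X * norm (Du z) powr \<gamma>'"
      "\<bar>\<xi> \<bullet> (A c z (v z) (Du z) *v \<xi>)\<bar> \<le> X * m * norm (Du z) powr \<gamma>' * (\<xi> \<bullet> \<xi>)"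
      if z: "z \<in> \<Omega>" "R' \<le> norm (Du z)" for z \<xi>
    proof -
      have sz: "snd c (cinv c z) = z" "cinv c z \<in> fst c" using ci(2,3) pre(1)[OF z(1)] by auto
      have Y: "Om * (1 + conorm (g c z) (Du z) powr \<gamma>) \<le> X * norm (Du z) powr \<gamma>'"
        using mult_left_mono[OF gr(2)[OF z] Om] by (simp add: X_def mult_ac)
      note gw = growth[OF c(1) sz(2), unfolded sz(1), OF gr(1)[OF z] _ vK[OF z(1)]]
      \<comment> \<open>The bound on \<open>f\<close> comes jointly with the one on \<open>A\<close>
        and so needs some nonzero test vector.\<close>
      have "axis undefined 1 \<noteq> (0 :: real ^ 'n)" by (simp add: axis_eq_0_iff)
      from gw[OF this] Y show "\<bar>f c z (v z) (Du z)\<bar> \<le> X * norm (Du z) powr \<gamma>'" by linarith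
      show "\<bar>\<xi> \<bullet> (A c z (v z) (Du z) *v \<xi>)\<bar> \<le> X * m * norm (Du z) powr \<gamma>' * (\<xi> \<bullet> \<xi>)"
      proof (cases "\<xi> = 0")
        case False
        have pos: "0 < \<xi> \<bullet> (g c z *v \<xi>)" by (rule riemannian_metric_pos(2)[OF g c(1) pre(1)[OF z(1)] False])
        then have vn: "vnorm (g c z) \<xi> * vnorm (g c z) \<xi> = \<xi> \<bullet> (g c z *v \<xi>)" by (simp add: vnorm_def)
        have "\<bar>\<xi> \<bullet> (A c z (v z) (Du z) *v \<xi>)\<bar> / (\<xi> \<bullet> (g c z *v \<xi>)) \<le> X * norm (Du z) powr \<gamma>'"
          using gw[OF False] Y unfolding vn by linarith
        then have "\<bar>\<xi> \<bullet> (A c z (v z) (Du z) *v \<xi>)\<bar> \<le> X * norm (Du z) powr \<gamma>' * (\<xi> \<bullet> (g c z *v \<xi>))"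
          using pos by (simp add: pos_divide_le_eq)
        also have "\<dots> \<le> X * norm (Du z) powr \<gamma>' * (m * (\<xi> \<bullet> \<xi>))"
          using up[OF zB[OF z(1)]] X by (intro mult_left_mono) auto
        finally show ?thesis by (simp add: mult_ac)
      qed simp
    qed
    have Sb: "\<bar>\<xi> \<bullet> (S z *v \<xi>)\<bar> \<le> cc * norm (Du z) powr \<gamma>' * (\<xi> \<bullet> \<xi>)"
      if z: "z \<in> \<Omega>" "R' \<le> norm (Du z)" for z \<xi>
    proof -
      have q1: "1 \<le> norm (Du z)" using z(2) by (simp add: R'_def)
      have "\<bar>\<Gamma> z $ i $ j\<bar> \<le> ?n * m * norm (Du z)" for i j
      proof -
        have "\<bar>\<Gamma> z $ i $ j\<bar> \<le> (\<Sum>k\<in>UNIV. \<bar>christoffel g c z k i j * Du z $ k\<bar>)"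
          unfolding \<Gamma>_def by (simp add: sum_abs)
        also have "\<dots> \<le> (\<Sum>k\<in>(UNIV :: 'n set). m * norm (Du z))"
        proof (rule sum_mono)
          fix k
          show "\<bar>christoffel g c z k i j * Du z $ k\<bar> \<le> m * norm (Du z)"
            unfolding abs_mult using chr[OF _ \<Omega>i[OF z(1)]] \<Omega>2 z(1) am(2)
            by (intro mult_mono component_le_norm_cart) auto
        qed
        finally show ?thesis by (simp add: mult_ac)
      qed
      then have "\<bar>\<xi> \<bullet> (\<Gamma> z *v \<xi>)\<bar> \<le> ?n\<^sup>2 * (?n * m * norm (Du z)) * (\<xi> \<bullet> \<xi>)"
        by (rule quadratic_form_bound)
      also have "\<dots> \<le> ?n\<^sup>2 * (?n * m * norm (Du z) powr \<gamma>') * (\<xi> \<bullet> \<xi>)"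
      proof (intro mult_right_mono mult_left_mono)
        show "norm (Du z) \<le> norm (Du z) powr \<gamma>'"
          using powr_mono[OF \<gamma>'(2) q1] q1 by simp
      qed (use am in auto)
      finally have G: "\<bar>\<xi> \<bullet> (\<Gamma> z *v \<xi>)\<bar> \<le> ?n\<^sup>2 * (?n * m * norm (Du z) powr \<gamma>') * (\<xi> \<bullet> \<xi>)" .
      have "\<xi> \<bullet> (S z *v \<xi>) = \<xi> \<bullet> (A c z (v z) (Du z) *v \<xi>) - \<xi> \<bullet> (\<Gamma> z *v \<xi>)"
        by (simp add: S[OF z(1)] matrix_vector_mult_diff_rdistrib inner_diff_right)
      moreover have "cc * norm (Du z) powr \<gamma>' * (\<xi> \<bullet> \<xi>) =
        ?n\<^sup>2 * (?n * m * norm (Du z) powr \<gamma>') * (\<xi> \<bullet> \<xi>) + X * m * norm (Du z) powr \<gamma>' * (\<xi> \<bullet> \<xi>)"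
        by (simp add: cc_def algebra_simps)
      ultimately show ?thesis using G fA(2)[OF z, of \<xi>] by linarith
    qed
    have adm: "eigenvalues (g c z) (T z) \<in> pcone p \<and> F_op p (eigenvalues (g c z) (T z)) = f c z (v z) (Du z)"
      if z: "z \<in> \<Omega>" for z
    proof -
      have "cinv c z \<in> fst c \<inter> interior_pts \<A>" "snd c (cinv c z) = z"
        using ci(2,3) pre[OF z] by auto
      then show ?thesis
        using u(2) c(1) unfolding admissible_solution_def Let_def T_def Du_def v_def o_def by metis
    qed
    have Fb: "F_op p (eigenvalues (g c z) (T z)) \<le> cc * norm (Du z) powr \<gamma>'"
      if z: "z \<in> \<Omega>" "R' \<le> norm (Du z)" for z
    proof -
      have "F_op p (eigenvalues (g c z) (T z)) \<le> X * norm (Du z) powr \<gamma>'"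
        using adm[OF z(1)] fA(1)[OF z] by linarith
      also have "\<dots> \<le> cc * norm (Du z) powr \<gamma>'" using cc by (intro mult_right_mono) auto
      finally show ?thesis .
    qed
    have th: "64 * K / \<rho> \<le> \<Lambda> / \<rho>" "4 * R' \<le> \<Lambda> / \<rho>"
      "5 * K * m ^ 8 + 64 * m * K / \<rho>\<^sup>2 + 2 * cc * m * (2 * (\<Lambda> / \<rho>)) powr \<gamma>'
        \<le> (\<Lambda> / \<rho>)\<^sup>2 / (12 * K * m) / (4 * (real p)\<^sup>2)"
      "cc * (2 * (\<Lambda> / \<rho>)) powr \<gamma>' < (\<Lambda> / \<rho>)\<^sup>2 / (12 * K * m) / (4 * real p)"
      using thr[OF \<rho>0 \<rho>1 refl] by auto
    have y0\<Omega>: "y0 \<in> \<Omega>" using \<rho>0 by (simp add: \<Omega>_def)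
    have grad_le: "norm (Du y0) \<le> \<Lambda> / \<rho>"
    proof (rule interior_gradient_bound[where u = v and Du = Du and ?y0.0 = y0 and G = "g c" and T = T and S = S and H = H,
          OF p \<rho>0 K am(2) cc(1) _ _ _ _ _ _ _ _ _ _ _ _ _ th(1,2,3,4)])
      fix z assume "z \<in> ball y0 \<rho>"
      then have z: "z \<in> \<Omega>" by (simp add: \<Omega>_def)
      show "(v has_derivative (\<lambda>w. Du z \<bullet> w)) (at z)" by (rule der(1)[OF z])
      show "(Du has_derivative (\<lambda>w. H z *v w)) (at z)" by (rule der(2)[OF z])
      show "\<bar>v z\<bar> \<le> K" by (rule vK[OF z])
      show "transpose (g c z) = g c z" by (rule gsym[OF pre(1)[OF z]])
      show "w \<bullet> w \<le> m * (w \<bullet> (g c z *v w))" for w by (rule low[OF zB[OF z]])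
      show "w \<bullet> (g c z *v w) \<le> m * (w \<bullet> w)" for w by (rule up[OF zB[OF z]])
      show "transpose (T z) = T z" by (rule Tsym[OF z])
      show "T z = H z + S z" by (simp add: S_def)
      show "eigenvalues (g c z) (T z) \<in> pcone p" using adm[OF z] by blast
      show "\<bar>w \<bullet> (S z *v w)\<bar> \<le> cc * norm (Du z) powr \<gamma>' * (w \<bullet> w)" if "R' \<le> norm (Du z)" for w
        by (rule Sb[OF z that])
      show "F_op p (eigenvalues (g c z) (T z)) \<le> cc * norm (Du z) powr \<gamma>'" if "R' \<le> norm (Du z)"
        by (rule Fb[OF z that])
    next
      fix y z w assume "y \<in> ball y0 \<rho>" "z \<in> ball y0 \<rho>"
      then show "\<bar>w \<bullet> (g c y *v w) - w \<bullet> (g c z *v w)\<bar> \<le> m * norm (y - z) * (w \<bullet> w)"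
        using zB by (intro lip) (auto simp: \<Omega>_def)
    next
      show "0 \<le> \<gamma>'" using \<gamma>' by simp
    qed
    have "conorm (g c y0) (Du y0) \<le> m * norm (Du y0)"
    proof -
      have b: "(conorm (g c y0) (Du y0))\<^sup>2 \<le> m * (norm (Du y0))\<^sup>2"
        by (rule matrix_inv_bounds(2)[OF gsym[OF pre(1)[OF y0\<Omega>]] _ low[OF zB[OF y0\<Omega>]] up[OF zB[OF y0\<Omega>]]]) (use am in simp)
      also have "\<dots> \<le> m\<^sup>2 * (norm (Du y0))\<^sup>2" using am by (intro mult_right_mono) (auto simp: power2_eq_square)
      finally have "(conorm (g c y0) (Du y0))\<^sup>2 \<le> (m * norm (Du y0))\<^sup>2" by (simp only: power_mult_distrib)
      then show ?thesis by (rule power2_le_imp_le) (use am in simp)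
    qed
    also have "\<dots> \<le> m * (\<Lambda> / \<rho>)" using grad_le am by (intro mult_left_mono) auto
    also have "\<dots> = m * (\<Lambda> / \<epsilon>) / r" by (simp add: \<rho>_def)
    finally have "conorm (g c y0) (Du y0) \<le> m * (\<Lambda> / \<epsilon>) / r" .
    moreover have "(v has_derivative (\<lambda>w. Du y0 \<bullet> w)) (at y0)" by (rule der(1)[OF y0\<Omega>])
    then have "conorm (g d (snd d x0)) (grad d u (snd d x0)) = conorm (g c y0) (Du y0)"
      unfolding Du_def y0_def v_def by (rule conorm_grad_chart_independent[OF atlas g x0(2) d c(1) x0c])
    ultimately show "conorm (g d (snd d x0)) (grad d u (snd d x0)) \<le> m * (\<Lambda> / \<epsilon>) / r" by simp
  qed
qed

text \<open>The local estimates have constants that vary with the base point; compactness of the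
  manifold leaves finitely many of them for each bound \<open>K\<close> on the solution.\<close>

theorem theorem3p1:
  fixes \<A> :: "('a::t2_space, 'n::finite) chart set"
    and g :: "('a, 'n) metric"
    and f :: "('a, 'n) bundle_fun"
    and A :: "('a, 'n) tensor_family"
    and p :: nat
    and \<gamma>0 \<gamma> C0 R :: real
    and \<omega>1 \<omega>2 :: "'a \<Rightarrow> real \<Rightarrow> real"
  assumes "compact (UNIV :: 'a set)"
    and "CARD('n) \<ge> 2"
    and "smooth_atlas \<A>"
    and "riemannian_metric \<A> g"
    and "1 \<le> p" "p \<le> CARD('n)"
    and "smooth_bundle_fun \<A> f"
    and "\<And>c y z q. c \<in> \<A> \<Longrightarrow> y \<in> cimg c \<Longrightarrow> 0 < f c y z q"
    and "smooth_symmetric_tensor_family \<A> A"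
    and "0 < \<gamma>0" "\<gamma>0 < 1" "0 < \<gamma>" "\<gamma> < 2" "0 < C0"
    and "continuous_on UNIV (\<lambda>(x, z). \<omega>1 x z)" "\<And>x z. 0 \<le> \<omega>1 x z"
    and "continuous_on UNIV (\<lambda>(x, z). \<omega>2 x z)" "\<And>x z. 0 \<le> \<omega>2 x z"
    and growth_i: "\<And>c x z q. c \<in> \<A> \<Longrightarrow> x \<in> fst c \<Longrightarrow>
      (let y = snd c x; G = g c y in
        conorm G (cov_x_fun g f c y z q)
        + \<bar>deriv (\<lambda>s. f c y s q) z\<bar> * conorm G q
        + vnorm G (pdv UNIV (f c y z) q) * (conorm G q)\<^sup>2
        \<le> C0 * conorm G q powr (2 + \<gamma>0))"
    and "0 < R"
    and growth_ii: "\<And>c x z q \<xi> \<eta>. c \<in> \<A> \<Longrightarrow> x \<in> fst c \<Longrightarrow> conorm (g c (snd c x)) q \<ge> R \<Longrightarrow>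
      (let y = snd c x; G = g c y in
        conorm G (cov_x_tensor g A c y z q \<xi> \<eta>) / conorm G q
        + \<bar>deriv (\<lambda>s. \<xi> \<bullet> (A c y s q *v \<eta>)) z\<bar>
        \<le> \<omega>1 x z * vnorm G \<xi> * vnorm G \<eta> * (1 + conorm G q powr \<gamma>))"
    and growth_iii: "\<And>c x z q \<xi> \<eta>. c \<in> \<A> \<Longrightarrow> x \<in> fst c \<Longrightarrow> conorm (g c (snd c x)) q \<ge> R \<Longrightarrow>
      \<xi> \<noteq> 0 \<Longrightarrow> \<eta> \<noteq> 0 \<Longrightarrow>
      (let y = snd c x; G = g c y in
        \<bar>f c y z q\<bar>
        + \<bar>q \<bullet> pdv UNIV (f c y z) q\<bar>
        + \<bar>\<xi> \<bullet> (A c y z q *v \<eta>)\<bar> / (vnorm G \<xi> * vnorm G \<eta>)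
        + \<bar>q \<bullet> pdv UNIV (\<lambda>w. \<xi> \<bullet> (A c y z w *v \<eta>)) q\<bar> / (vnorm G \<xi> * vnorm G \<eta>)
        \<le> \<omega>2 x z * (1 + conorm G q powr \<gamma>))"
  shows "\<exists>C :: real \<Rightarrow> real. (\<forall>K. 0 < C K) \<and>
    (\<forall>u. C3_interior \<A> u \<and> admissible_solution \<A> g p A f u \<and>
         bdd_above ((\<lambda>x. \<bar>u x\<bar>) ` interior_pts \<A>) \<longrightarrow>
      (\<forall>x0\<in>interior_pts \<A>. \<forall>r. 0 < r \<and> r < 1 \<and> geodesic_ball \<A> g x0 r \<subseteq> interior_pts \<A> \<longrightarrow>
        (\<forall>c\<in>\<A>. x0 \<in> fst c \<longrightarrow>
          conorm (g c (snd c x0)) (grad c u (snd c x0))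
            \<le> C (SUP x\<in>interior_pts \<A>. \<bar>u x\<bar>) / r)))"
proof -
  \<comment> \<open>Names the estimate for base points in \<open>W\<close>, so that neighbourhoods
    and constants can be chosen simultaneously for all points.\<close>
  define Est where "Est K W C \<longleftrightarrow> (\<forall>u x0 r d. C3_interior \<A> u \<longrightarrow> admissible_solution \<A> g p A f u \<longrightarrow>
      (\<forall>x\<in>interior_pts \<A>. \<bar>u x\<bar> \<le> K) \<longrightarrow> x0 \<in> W \<longrightarrow> x0 \<in> interior_pts \<A> \<longrightarrow>
      0 < r \<longrightarrow> r < 1 \<longrightarrow> geodesic_ball \<A> g x0 r \<subseteq> interior_pts \<A> \<longrightarrow> d \<in> \<A> \<longrightarrow> x0 \<in> fst d \<longrightarrow>
      conorm (g d (snd d x0)) (grad d u (snd d x0)) \<le> C / r)" for K W C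
  have ex: "\<exists>C>0. Est K UNIV C" if K: "0 < K" for K
  proof -
    \<comment> \<open>On the product of the compact manifold with \<open>[- K, K]\<close> the
      continuous \<open>\<omega>2\<close> is bounded, which removes the dependence on
      \<open>x\<close> and \<open>z\<close>.\<close>
    have "compact ((\<lambda>(x, z). \<omega>2 x z) ` (UNIV \<times> {- K..K}))"
      using assms(1,17) by (intro compact_continuous_image compact_Times compact_Icc)
        (auto intro: continuous_on_subset)
    then obtain Om where Om: "0 < Om" "\<And>y. y \<in> (\<lambda>(x, z). \<omega>2 x z) ` (UNIV \<times> {- K..K}) \<Longrightarrow> norm y \<le> Om"
      using compact_imp_bounded bounded_pos by metis
    have \<omega>Om: "\<omega>2 x z \<le> Om" if "\<bar>z\<bar> \<le> K" for x z
      using Om(2)[of "\<omega>2 x z"] that by force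
    have growth: "\<bar>f c (snd c x) z q\<bar> \<le> Om * (1 + conorm (g c (snd c x)) q powr \<gamma>) \<and>
        \<bar>\<xi> \<bullet> (A c (snd c x) z q *v \<xi>)\<bar> / (vnorm (g c (snd c x)) \<xi> * vnorm (g c (snd c x)) \<xi>)
          \<le> Om * (1 + conorm (g c (snd c x)) q powr \<gamma>)"
      if "c \<in> \<A>" "x \<in> fst c" "R \<le> conorm (g c (snd c x)) q" "\<xi> \<noteq> 0" "\<bar>z\<bar> \<le> K" for c x z q \<xi>
    proof -
      let ?w = "vnorm (g c (snd c x)) \<xi> * vnorm (g c (snd c x)) \<xi>"
      have le: "\<omega>2 x z * (1 + conorm (g c (snd c x)) q powr \<gamma>) \<le> Om * (1 + conorm (g c (snd c x)) q powr \<gamma>)"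
        using \<omega>Om[OF that(5)] by (intro mult_right_mono) (auto simp: add_nonneg_nonneg)
      have "0 \<le> ?w" by simp
      then have "0 \<le> \<bar>\<xi> \<bullet> (A c (snd c x) z q *v \<xi>)\<bar> / ?w"
        "0 \<le> \<bar>q \<bullet> pdv UNIV (\<lambda>w. \<xi> \<bullet> (A c (snd c x) z w *v \<xi>)) q\<bar> / ?w"
        by (simp_all only: divide_nonneg_nonneg abs_ge_zero)
      moreover have "0 \<le> \<bar>f c (snd c x) z q\<bar>" "0 \<le> \<bar>q \<bullet> pdv UNIV (f c (snd c x) z) q\<bar>" by simp_all
      ultimately show ?thesis
        using growth_iii[OF that(1-4) that(4), unfolded Let_def, of z] le by linarith
    qed
    have "\<exists>V C. open V \<and> x \<in> V \<and> 0 < C \<and> Est K V C" for x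
    proof -
      have "x \<in> (\<Union>c\<in>\<A>. fst c)" using assms(3) by (simp add: smooth_atlas_def)
      then obtain c where c: "c \<in> \<A>" "x \<in> fst c" by blast
      show ?thesis
      proof (rule local_gradient_estimate[OF assms(3,4,5,6,9,12,13) \<open>0 < R\<close> K less_imp_le[OF Om(1)] growth c])
        fix V C
        assume V: "open V" "x \<in> V" "0 < C" and "\<And>u x0 r d. C3_interior \<A> u \<Longrightarrow> admissible_solution \<A> g p A f u \<Longrightarrow>
          (\<And>x. x \<in> interior_pts \<A> \<Longrightarrow> \<bar>u x\<bar> \<le> K) \<Longrightarrow> x0 \<in> V \<Longrightarrow> x0 \<in> interior_pts \<A> \<Longrightarrow>
          0 < r \<Longrightarrow> r < 1 \<Longrightarrow> geodesic_ball \<A> g x0 r \<subseteq> interior_pts \<A> \<Longrightarrow> d \<in> \<A> \<Longrightarrow> x0 \<in> fst d \<Longrightarrow>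
          conorm (g d (snd d x0)) (grad d u (snd d x0)) \<le> C / r"
        then have "Est K V C" unfolding Est_def by (intro allI impI) simp
        with V show ?thesis by blast
      qed
    qed
    then obtain V C where VC: "\<And>x. open (V x)" "\<And>x. x \<in> V x" "\<And>x. 0 < C x" "\<And>x. Est K (V x) (C x)"
      by metis
    obtain I where I: "finite I" "UNIV \<subseteq> (\<Union>x\<in>I. V x)"
      by (rule compactE_image[OF assms(1), of UNIV V]) (use VC(1,2) in auto)
    \<comment> \<open>The sum dominates each of the finitely many constants; the 1 keeps the total
      positive even for empty \<open>I\<close>.\<close>
    have "Est K UNIV (1 + sum C I)"
      unfolding Est_def
    proof (intro allI impI)
      fix u x0 r d
      assume u: "C3_interior \<A> u" "admissible_solution \<A> g p A f u" "\<forall>x\<in>interior_pts \<A>. \<bar>u x\<bar> \<le> K"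
        and rest: "x0 \<in> interior_pts \<A>" "0 < r" "r < 1" "geodesic_ball \<A> g x0 r \<subseteq> interior_pts \<A>"
          "d \<in> \<A>" "x0 \<in> fst d"
      obtain i where i: "i \<in> I" "x0 \<in> V i" using I(2) by blast
      have "conorm (g d (snd d x0)) (grad d u (snd d x0)) \<le> C i / r"
        by (rule VC(4)[of i, unfolded Est_def, rule_format]) (use u i(2) rest in auto)
      also have "C i \<le> sum C I" using I(1) i(1) VC(3) by (intro member_le_sum) (auto intro: less_imp_le)
      then have "C i / r \<le> (1 + sum C I) / r" using rest by (intro divide_right_mono) auto
      finally show "conorm (g d (snd d x0)) (grad d u (snd d x0)) \<le> (1 + sum C I) / r" .
    qed
    moreover have "0 < 1 + sum C I" using VC(3) by (intro add_pos_nonneg sum_nonneg) (auto intro: less_imp_le)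
    ultimately show ?thesis by blast
  qed
  \<comment> \<open>The estimate requires a positive bound, whereas the supremum may be
    \<open>0\<close>, and over an empty interior it is an arbitrary real;
    \<open>\<bar>K\<bar> + 1\<close> serves in every case.\<close>
  have "\<exists>C>0. Est (\<bar>K\<bar> + 1) UNIV C" for K
    by (rule ex) (simp add: add_nonneg_pos)
  then obtain C where C: "\<And>K. 0 < C K" "\<And>K. Est (\<bar>K\<bar> + 1) UNIV (C K)" by metis
  show ?thesis
  proof (intro exI[of _ C] conjI allI impI ballI)
    show "0 < C K" for K by (rule C(1))
    fix u x0 r c
    assume u: "C3_interior \<A> u \<and> admissible_solution \<A> g p A f u \<and>
        bdd_above ((\<lambda>x. \<bar>u x\<bar>) ` interior_pts \<A>)"
      and x0: "x0 \<in> interior_pts \<A>"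
      and r: "0 < r \<and> r < 1 \<and> geodesic_ball \<A> g x0 r \<subseteq> interior_pts \<A>" and c: "c \<in> \<A>" "x0 \<in> fst c"
    let ?K = "SUP x\<in>interior_pts \<A>. \<bar>u x\<bar>"
    have "\<bar>u x\<bar> \<le> ?K" if "x \<in> interior_pts \<A>" for x using u that by (intro cSUP_upper) auto
    then have "\<forall>x\<in>interior_pts \<A>. \<bar>u x\<bar> \<le> \<bar>?K\<bar> + 1" by force
    then show "conorm (g c (snd c x0)) (grad c u (snd c x0)) \<le> C ?K / r"
      by (intro C(2)[unfolded Est_def, rule_format]) (use u x0 r c in auto)
  qed
qed

end
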